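(* Let $X$ be a locally compact Hausdorff space, let $E$ be a KB-space, and let $\pi:\mathrm{C}_0(X)\to\mathcal{L}_{\mathrm r}(E)$ be a positive (not necessarily multiplicative) operator. Then there exists a unique regular Borel measure $\mu:\mathscr{B}\to\overline{\mathcal{L}_{\mathrm r}(E)^+}$ on the Borel $\sigma$-algebra $\mathscr{B}$ of $X$ such that \[ \pi(f)=\int_X^{\mathrm{o}} f\,\mathrm{d}\mu \qquad (\ast) \] for all $f\in\mathrm{C}_{\mathrm c}(X)$. The measure $\mu$ is finite, and $(\ast)$ also holds for all $f\in\mathrm{C}_0(X)$. If $V$ is a non-empty open subset of $X$, then $\mu(V)=\bigvee\{\pi(f): f\prec V\}$ in $\mathcal{L}_{\mathrm r}(E)$. If $K$ is a compact subset of $X$, then $\mu(K)=\bigwedge\{\pi(f): K\prec f\}$ in $\mathcal{L}_{\mathrm r}(E)$. Suppose that $\{\Delta_n\}_{n=1}^\infty$ is a pairwise disjoint sequence in $\mathscr{B}$. Then, for $x\in E$, $\mu\left(\bigcup_{n=1}^\infty\Delta_n\right)x=\sum_{n=1}^\infty\mu(\Delta_n)x$ in the norm topology of $E$. Define the extension $\pi:\mathcal{L}^1(X,\mathscr{B},\mu;\mathbb{R})\to\mathcal{L}_{\mathrm r}(E)$ via $(\ast)$. For $x\in E^+$, $x'\in(E^\sim)^+$, and $\Delta\in\mathscr{B}$, set $\mu_{x,x'}(\Delta)=(\mu(\Delta)x,x')$. Then $\mu_{x,x'}:\mathscr{B}\to\mathbb{R}^+$ is a regular Borel measure on $X$ and,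 for $f\in\mathcal{L}^1(X,\mathscr{B},\mu;\mathbb{R})$, $\pi(f)$ is the unique element of $\mathcal{L}_{\mathrm r}(E)$ such that \[ (\pi(f)x,x')=\int_X f\,\mathrm{d}\mu_{x,x'} \] for all $x\in E^+$ and $x'\in(E^\sim)^+$. Furthermore, the SOT-closed linear subspaces of the bounded (not necessarily regular) operators on $E$ that are generated by the following sets are equal: (1) $\{\pi(f): f\in\mathrm{C}_{\mathrm c}(X)\}$; (2) $\{\pi(f): f\in\mathrm{C}_0(X)\}$; (3) $\{\pi(f): f\in\mathcal{B}(X,\mathscr{B};\mathbb{R})\}$; (4) $\{\pi(f): f\in\mathcal{L}^1(X,\mathscr{B},\mu;\mathbb{R})\}$; (5) $\{\mu(V): V\text{ is an open subset of }X\}$; (6) $\{\mu(K): K\text{ is a compact subset of }X\}$; (7) $\{\mu(\Delta):\Delta\text{ is a Borel subset of }X\}$.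
   Context: A KB-space is a (real) Banach lattice in which every increasing norm bounded net in the positive cone is norm convergent. $\mathcal{L}_{\mathrm r}(E)$ is the space of regular operators on $E$ (differences of positive linear operators $E\to E$), with positive cone $\mathcal{L}_{\mathrm r}(E)^+$ the set of positive operators; it is Dedekind complete. $E^{\sim}$ is the space of differences of positive functionals on $E$ (equal to the norm dual), with positive cone $(E^\sim)^+$; $(x,x')$ is the value of $x'\in E^\sim$ at $x\in E$. SOT is the strong operator topology. The definitions below are applied with $F=\mathcal{L}_{\mathrm r}(E)$. Extended space. For a partially ordered vector space $F$: $\overline{F}=F\cup\{\infty\}$ (disjoint union), ordered by the order of $F$ and $x\le\infty$ for all $x\in\overline F$; $\overline{F^+}=F^+\cup\{\infty\}$; $\infty+x=x+\infty=\infty$; $r\cdot\infty=\infty$ for real $r>0$, $0\cdot\infty=0$. Elements of $F$ are called finite. Measures. A positive $\overline F$-valued measure on $\mathscr{B}$ is a map $\mu:\mathscr{B}\to\overline{F^+}$ with $\mu(\emptyset)=0$ and $\mu(\bigcup_n\Delta_n)=\bigvee_{N=1}^\infty\sum_{n=1}^N\mu(\Delta_n)$ in $\overline F$ for pairwise disjoint sequences $(\Delta_n)$ in $\mathscr{B}$. It is finite if $\mu(X)\in F^+$. Order integral. For a measurable $\varphi=\sum_{i=1}^n r_i\chi_{\Delta_i}\ge 0$ taking finitely many finite values ($r_i\in\mathbb{R}^+$, $\Delta_i\in\mathscr{B}$), $\int_X^{\mathrm o}\varphi\,\mathrm d\mu=\sum_i r_i\mu(\Delta_i)\in\overline{F^+}$.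 For measurable $f:X\to[0,\infty]$, $\int_X^{\mathrm o}f\,\mathrm d\mu=\bigvee_n\int_X^{\mathrm o}\varphi_n\,\mathrm d\mu$ in $\overline{F}$, for any sequence of such elementary functions $\varphi_n\uparrow f$ pointwise (independent of the choice). $\mathcal{L}^1(X,\mathscr{B},\mu;\mathbb{R})$ is the set of measurable $f:X\to\mathbb{R}$ with $\int_X^{\mathrm o}|f|\,\mathrm d\mu$ finite; for such $f$, $\int_X^{\mathrm o}f\,\mathrm d\mu=\int_X^{\mathrm o}f^+\,\mathrm d\mu-\int_X^{\mathrm o}f^-\,\mathrm d\mu$. $\mathcal{B}(X,\mathscr{B};\mathbb{R})$ is the space of bounded Borel measurable functions $X\to\mathbb{R}$; it is contained in $\mathcal{L}^1(X,\mathscr{B},\mu;\mathbb{R})$ if $\mu$ is finite. Regularity (also used for $F=\mathbb{R}$). $\mu$ is a Borel measure if $\mu(K)\in F$ for all compact $K\subseteq X$; it is inner regular at $\Delta$ if $\mu(\Delta)=\bigvee\{\mu(K):K\text{ compact},K\subseteq\Delta\}$ in $\overline F$; outer regular at $\Delta$ if $\mu(\Delta)=\bigwedge\{\mu(V):V\text{ open},\Delta\subseteq V\}$ in $\overline F$. It is a regular Borel measure if it is a Borel measure that is inner regular at all open sets and outer regular at all Borel sets. Functions. $\mathrm{C}_{\mathrm c}(X)$ (resp. $\mathrm{C}_0(X)$) is the space of real-valued continuous functions on $X$ with compact support (resp. vanishing at infinity), with the pointwise order. For $S\subseteq X$, $f\prec S$ means $f\in\mathrm{C}_{\mathrm c}(X)$,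 $0\le f\le 1$ and $\operatorname{supp}f\subseteq S$; $S\prec f$ means $f\in\mathrm{C}_{\mathrm c}(X)$, $0\le f\le 1$ and $f=1$ on $S$. *)

theory Defs
  imports "HOL-Analysis.Analysis" "HOL-Library.Lattice_Algebras" "HOL-Library.Lub_Glb"
begin

section \<open>KB-spaces\<close>

class banach_lattice = banach + ordered_real_vector + lattice_ab_group_add_abs +
  assumes norm_le_of_abs_le: "\<bar>x\<bar> \<le> \<bar>y\<bar> \<Longrightarrow> norm x \<le> norm y"

definition directed :: "'i set \<Rightarrow> ('i \<Rightarrow> 'i \<Rightarrow> bool) \<Rightarrow> bool" where
  "directed I le \<longleftrightarrow> I \<noteq> {} \<and> (\<forall>i\<in>I. le i i) \<and>
     (\<forall>i\<in>I. \<forall>j\<in>I. \<forall>k\<in>I. le i j \<longrightarrow> le j k \<longrightarrow> le i k) \<and>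
     (\<forall>i\<in>I. \<forall>j\<in>I. \<exists>k\<in>I. le i k \<and> le j k)"

definition net_filter :: "'i set \<Rightarrow> ('i \<Rightarrow> 'i \<Rightarrow> bool) \<Rightarrow> 'i filter" where
  "net_filter I le = (INF i\<in>I. principal {j\<in>I. le i j})"

lemma eventually_net_filter:
  assumes "directed I le"
  shows "eventually P (net_filter I le) \<longleftrightarrow> (\<exists>i\<in>I. \<forall>j\<in>I. le i j \<longrightarrow> P j)"
proof -
  have "eventually P (net_filter I le) \<longleftrightarrow> (\<exists>i\<in>I. eventually P (principal {j\<in>I. le i j}))"
    unfolding net_filter_def
  proof (rule eventually_INF_base)
    show "I \<noteq> {}" using assms by (simp add: directed_def)
    fix a b assume ab: "a \<in> I" "b \<in> I"
    then obtain k where k: "k \<in> I" "le a k" "le b k"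
      using assms unfolding directed_def by blast
    have "{j\<in>I. le k j} \<subseteq> {j\<in>I. le a j} \<inter> {j\<in>I. le b j}"
      using k ab assms unfolding directed_def by blast
    then show "\<exists>x\<in>I. principal {j \<in> I. le x j} \<le> inf (principal {j \<in> I. le a j}) (principal {j \<in> I. le b j})"
      using k by (intro bexI[of _ k]) auto
  qed
  then show ?thesis by (auto simp: eventually_principal)
qed

text \<open>A class axiom cannot quantify over index types, so the nets in the axiom are indexed by subsets
  of the space itself (with arbitrary directed preorders); the lemma after the class shows that
  increasing norm bounded nets over an arbitrary index type then converge as well.\<close>

class kb_space = banach_lattice +
  assumes increasing_bounded_net_converges_self:
    "directed I le \<Longrightarrow> (\<And>i. i \<in> I \<Longrightarrow> 0 \<le> x i) \<Longrightarrow>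
     (\<And>i j. i \<in> I \<Longrightarrow> j \<in> I \<Longrightarrow> le i j \<Longrightarrow> x i \<le> x j) \<Longrightarrow>
     (\<And>i. i \<in> I \<Longrightarrow> norm (x i) \<le> c) \<Longrightarrow>
     \<exists>l. (x \<longlongrightarrow> l) (net_filter (I :: 'a set) le)"

lemma increasing_bounded_net_converges:
  fixes x :: "'i \<Rightarrow> 'a::kb_space" and c :: real
  assumes dir: "directed I le" and pos: "\<And>i. i \<in> I \<Longrightarrow> 0 \<le> x i"
    and mono: "\<And>i j. i \<in> I \<Longrightarrow> j \<in> I \<Longrightarrow> le i j \<Longrightarrow> x i \<le> x j"
    and bdd: "\<And>i. i \<in> I \<Longrightarrow> norm (x i) \<le> c"
  shows "\<exists>l. (x \<longlongrightarrow> l) (net_filter I le)"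
proof -
  have dir': "directed (x ` I) (\<le>)"
    unfolding directed_def
  proof (intro conjI ballI impI)
    show "x ` I \<noteq> {}" using dir by (auto simp: directed_def)
    fix a b assume "a \<in> x ` I" "b \<in> x ` I"
    then obtain i j where ij: "i \<in> I" "j \<in> I" "a = x i" "b = x j" by blast
    then obtain k where "k \<in> I" "le i k" "le j k" using dir unfolding directed_def by blast
    then show "\<exists>k\<in>x ` I. a \<le> k \<and> b \<le> k" using ij mono by blast
  qed auto
  have "\<exists>l. ((\<lambda>y. y) \<longlongrightarrow> l) (net_filter (x ` I) (\<le>))"
    by (rule increasing_bounded_net_converges_self[OF dir', of _ c]) (use pos bdd in auto)
  then obtain l where l: "((\<lambda>y. y) \<longlongrightarrow> l) (net_filter (x ` I) (\<le>))" by blast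
  have "(x \<longlongrightarrow> l) (net_filter I le)"
  proof (rule topological_tendstoI)
    fix S assume "open S" "l \<in> S"
    then have "eventually (\<lambda>y. y \<in> S) (net_filter (x ` I) (\<le>))"
      using l by (simp add: topological_tendstoD)
    then obtain i where "i \<in> I" "\<forall>j\<in>I. x i \<le> x j \<longrightarrow> x j \<in> S"
      by (auto simp: eventually_net_filter[OF dir'])
    then show "eventually (\<lambda>i. x i \<in> S) (net_filter I le)"
      unfolding eventually_net_filter[OF dir] using mono by blast
  qed
  then show ?thesis ..
qed


section \<open>Regular operators\<close>

definition positive_operator :: "('a::ordered_real_vector \<Rightarrow> 'b::ordered_real_vector) \<Rightarrow> bool" where
  "positive_operator P \<longleftrightarrow> linear P \<and> (\<forall>x\<ge>0. 0 \<le> P x)"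

definition regular_operator :: "('a::ordered_real_vector \<Rightarrow> 'b::ordered_real_vector) \<Rightarrow> bool" where
  "regular_operator T \<longleftrightarrow>
     (\<exists>P Q. positive_operator P \<and> positive_operator Q \<and> T = (\<lambda>x. P x - Q x))"

lemma positive_operator_zero: "positive_operator (\<lambda>x. 0)"
  by (simp add: positive_operator_def linear_zero)

lemma positive_operator_add:
  "positive_operator P \<Longrightarrow> positive_operator Q \<Longrightarrow> positive_operator (\<lambda>x. P x + Q x)"
  by (auto simp: positive_operator_def linear_compose_add)

lemma positive_operator_scale:
  "positive_operator P \<Longrightarrow> 0 \<le> r \<Longrightarrow> positive_operator (\<lambda>x. r *\<^sub>R P x)"
  by (auto simp: positive_operator_def linear_compose_scale_right scaleR_nonneg_nonneg)

lemma regular_operator_linear: "regular_operator T \<Longrightarrow> linear T"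
  by (auto simp: regular_operator_def positive_operator_def linear_compose_sub)

lemma regular_operator_zero: "regular_operator (\<lambda>x. 0)"
  unfolding regular_operator_def using positive_operator_zero by fastforce

lemma regular_operator_add:
  assumes "regular_operator S" "regular_operator T" shows "regular_operator (\<lambda>x. S x + T x)"
proof -
  obtain P Q where S: "positive_operator P" "positive_operator Q" "S = (\<lambda>x. P x - Q x)"
    using assms(1) unfolding regular_operator_def by blast
  obtain P' Q' where T: "positive_operator P'" "positive_operator Q'" "T = (\<lambda>x. P' x - Q' x)"
    using assms(2) unfolding regular_operator_def by blast
  have "(\<lambda>x. S x + T x) = (\<lambda>x. (P x + P' x) - (Q x + Q' x))"
    unfolding S(3) T(3) by (simp add: add_diff_add)
  then show ?thesis unfolding regular_operator_def
    using positive_operator_add S(1,2) T(1,2) by blast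
qed

lemma regular_operator_uminus:
  assumes "regular_operator T" shows "regular_operator (\<lambda>x. - T x)"
proof -
  obtain P Q where "positive_operator P" "positive_operator Q" "T = (\<lambda>x. P x - Q x)"
    using assms unfolding regular_operator_def by blast
  moreover from this(3) have "(\<lambda>x. - T x) = (\<lambda>x. Q x - P x)" by simp
  ultimately show ?thesis unfolding regular_operator_def by blast
qed

lemma regular_operator_scale:
  fixes T :: "'a::ordered_real_vector \<Rightarrow> 'b::ordered_real_vector"
  assumes "regular_operator T" shows "regular_operator (\<lambda>x. r *\<^sub>R T x)"
proof -
  have *: "regular_operator (\<lambda>x. r *\<^sub>R T x)" if r: "0 \<le> r" and T: "regular_operator T"
    for r and T :: "'a \<Rightarrow> 'b"
  proof -
    obtain P Q where "positive_operator P" "positive_operator Q" "T = (\<lambda>x. P x - Q x)"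
      using T unfolding regular_operator_def by blast
    moreover have "(\<lambda>x. r *\<^sub>R (P x - Q x)) = (\<lambda>x. r *\<^sub>R P x - r *\<^sub>R Q x)" for P Q :: "'a \<Rightarrow> 'b"
      by (simp add: scaleR_diff_right)
    ultimately show ?thesis unfolding regular_operator_def
      using positive_operator_scale[OF _ r] by blast
  qed
  show ?thesis
  proof (cases "0 \<le> r")
    case False
    then show ?thesis using *[of "- r", OF _ regular_operator_uminus[OF assms]] by simp
  qed (use * assms in blast)
qed

text \<open>The domain is a vector lattice, so that its positive cone is generating and the operator order
  is antisymmetric. The type is used both for the regular operators on \<open>E\<close>, as
  \<open>('e, 'e) regop\<close>, and for the order dual of \<open>E\<close>, as \<open>('e, real) regop\<close>.\<close>

typedef (overloaded) ('a, 'b) regop =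
  "{T :: 'a::{ordered_real_vector, lattice} \<Rightarrow> 'b::ordered_real_vector. regular_operator T}"
  morphisms regop_apply Regop
  using regular_operator_zero by blast

setup_lifting type_definition_regop

lemma generating_cone:
  fixes S T :: "'a::{ordered_real_vector, lattice} \<Rightarrow> 'b::real_vector"
  assumes "linear S" "linear T" "\<And>x. 0 \<le> x \<Longrightarrow> S x = T x"
  shows "S = T"
proof
  fix x :: 'a
  define y where "y = sup x 0"
  have y: "0 \<le> y" "0 \<le> y - x" by (simp_all add: y_def)
  have "S x = S y - S (y - x)" "T x = T y - T (y - x)"
    using assms(1,2) by (simp_all add: linear_diff)
  then show "S x = T x" using assms(3) y by simp
qed

instantiation regop :: ("{ordered_real_vector, lattice}", ordered_real_vector) ordered_real_vector
begin

lift_definition zero_regop :: "('a, 'b) regop" is "\<lambda>x. 0" by (rule regular_operator_zero)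
lift_definition plus_regop :: "('a, 'b) regop \<Rightarrow> ('a, 'b) regop \<Rightarrow> ('a, 'b) regop"
  is "\<lambda>S T x. S x + T x" by (rule regular_operator_add)
lift_definition uminus_regop :: "('a, 'b) regop \<Rightarrow> ('a, 'b) regop"
  is "\<lambda>T x. - T x" by (rule regular_operator_uminus)
lift_definition minus_regop :: "('a, 'b) regop \<Rightarrow> ('a, 'b) regop \<Rightarrow> ('a, 'b) regop"
  is "\<lambda>S T x. S x - T x" using regular_operator_add regular_operator_uminus by fastforce
lift_definition scaleR_regop :: "real \<Rightarrow> ('a, 'b) regop \<Rightarrow> ('a, 'b) regop"
  is "\<lambda>r T x. r *\<^sub>R T x" by (rule regular_operator_scale)
lift_definition less_eq_regop :: "('a, 'b) regop \<Rightarrow> ('a, 'b) regop \<Rightarrow> bool"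
  is "\<lambda>S T. \<forall>x\<ge>0. S x \<le> T x" .
definition less_regop :: "('a, 'b) regop \<Rightarrow> ('a, 'b) regop \<Rightarrow> bool"
  where "less_regop S T \<longleftrightarrow> S \<le> T \<and> \<not> T \<le> S"

instance
proof
  fix S T U :: "('a, 'b) regop" and r s :: real
  show "S + T + U = S + (T + U)" by transfer (simp add: add.assoc)
  show "S + T = T + S" by transfer (simp add: add.commute)
  show "0 + S = S" by transfer simp
  show "- S + S = 0" by transfer simp
  show "S - T = S + - T" by transfer simp
  show "r *\<^sub>R (S + T) = r *\<^sub>R S + r *\<^sub>R T" by transfer (simp add: scaleR_add_right)
  show "(r + s) *\<^sub>R S = r *\<^sub>R S + s *\<^sub>R S" by transfer (simp add: scaleR_add_left)
  show "r *\<^sub>R s *\<^sub>R S = (r * s) *\<^sub>R S" by transfer simp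
  show "1 *\<^sub>R S = S" by transfer simp
  show "S < T \<longleftrightarrow> S \<le> T \<and> \<not> T \<le> S" by (rule less_regop_def)
  show "S \<le> S" by transfer simp
  show "S \<le> T \<Longrightarrow> T \<le> U \<Longrightarrow> S \<le> U" by transfer (meson order_trans)
  show "S \<le> T \<Longrightarrow> T \<le> S \<Longrightarrow> S = T"
    by transfer (meson generating_cone order_antisym regular_operator_linear)
  show "S \<le> T \<Longrightarrow> U + S \<le> U + T" by transfer simp
  show "S \<le> T \<Longrightarrow> 0 \<le> r \<Longrightarrow> r *\<^sub>R S \<le> r *\<^sub>R T" by transfer (simp add: scaleR_left_mono)
  show "r \<le> s \<Longrightarrow> 0 \<le> S \<Longrightarrow> r *\<^sub>R S \<le> s *\<^sub>R S" by transfer (simp add: scaleR_right_mono)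
qed

end


subsection \<open>Regular operators between Banach lattices are bounded\<close>

lemma norm_abs_lattice: "norm \<bar>x::'a::banach_lattice\<bar> = norm x"
  by (intro antisym norm_le_of_abs_le) simp_all

lemma norm_mono_nonneg: "0 \<le> x \<Longrightarrow> x \<le> y \<Longrightarrow> norm x \<le> norm y" for x y :: "'a::banach_lattice"
  by (rule norm_le_of_abs_le) (simp add: abs_of_nonneg)

lemma nonneg_limit:
  fixes x :: "'a::banach_lattice"
  assumes lim: "u \<longlonglongrightarrow> x" and pos: "\<And>n. N \<le> n \<Longrightarrow> 0 \<le> u n"
  shows "0 \<le> x"
proof -
  have "norm (sup (- x) 0) \<le> norm (u n - x)" if "N \<le> n" for n
  proof (rule norm_le_of_abs_le)
    have "- x \<le> u n - x" using pos[OF that] by simp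
    also have "\<dots> \<le> \<bar>u n - x\<bar>" by (rule abs_ge_self)
    finally have "sup (- x) 0 \<le> \<bar>u n - x\<bar>" by simp
    then show "\<bar>sup (- x) 0\<bar> \<le> \<bar>u n - x\<bar>" by (simp add: abs_of_nonneg)
  qed
  moreover have "(\<lambda>n. norm (u n - x)) \<longlonglongrightarrow> 0"
    using lim LIM_zero tendsto_norm_zero by blast
  ultimately have "norm (sup (- x) 0) \<le> 0"
    by (intro LIMSEQ_le_const) auto
  then have "sup (- x) 0 = 0" by simp
  then have "- x \<le> 0" by (metis sup_ge1)
  then show ?thesis by simp
qed

lemma positive_operator_bounded:
  fixes P :: "'a::banach_lattice \<Rightarrow> 'b::banach_lattice"
  assumes "positive_operator P"
  shows "bounded_linear P"
proof (rule ccontr)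
  have lin: "linear P" and pos: "\<And>x. 0 \<le> x \<Longrightarrow> 0 \<le> P x"
    using assms by (auto simp: positive_operator_def)
  have mono: "P x \<le> P y" if "x \<le> y" for x y
    using pos[of "y - x"] that linear_diff[OF lin, of y x] by simp
  assume "\<not> bounded_linear P"
  then have "\<not> (\<exists>K. \<forall>x. norm (P x) \<le> norm x * K)"
    using lin by (auto simp: bounded_linear_def bounded_linear_axioms_def)
  then have "\<forall>n. \<exists>x. norm x * 4 ^ n < norm (P x)" by (meson not_le)
  then obtain x where x: "\<And>n::nat. norm (x n) * 4 ^ n < norm (P (x n))" by metis
  have nz: "norm (x n) > 0" for n using x[of n] linear_0[OF lin] by (cases "x n = 0") auto
  define y where "y n = (1 / norm (x n)) *\<^sub>R \<bar>x n\<bar>" for n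
  have y_pos: "0 \<le> y n" for n by (simp add: y_def scaleR_nonneg_nonneg)
  have y_norm: "norm (y n) = 1" for n using nz[of n] by (simp add: y_def norm_abs_lattice)
  have y_big: "4 ^ n \<le> norm (P (y n))" for n
  proof -
    have "P (x n) \<le> P \<bar>x n\<bar>" "- P (x n) \<le> P \<bar>x n\<bar>"
      using mono[of "x n" "\<bar>x n\<bar>"] mono[of "- x n" "\<bar>x n\<bar>"] abs_ge_self[of "x n"] abs_ge_minus_self[of "x n"]
      by (auto simp: linear_neg[OF lin])
    then have "\<bar>P (x n)\<bar> \<le> P \<bar>x n\<bar>" by (rule abs_leI)
    then have "norm (P (x n)) \<le> norm (P \<bar>x n\<bar>)"
      using norm_mono_nonneg[of "\<bar>P (x n)\<bar>"] by (simp add: norm_abs_lattice)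
    then have "norm (x n) * 4 ^ n \<le> norm (P \<bar>x n\<bar>)" using x[of n] by linarith
    then show ?thesis using nz[of n]
      by (simp add: y_def linear_scale[OF lin] field_simps)
  qed
  let ?s = "\<lambda>n. (1/2::real) ^ n *\<^sub>R y n"
  have summ: "summable ?s"
    by (rule summable_norm_cancel) (simp add: y_norm summable_geometric)
  define z where "z = suminf ?s"
  have s_pos: "0 \<le> ?s n" for n using y_pos by (simp add: scaleR_nonneg_nonneg)
  have z_ge: "?s n \<le> z" for n
  proof -
    have "(\<lambda>k. (\<Sum>i<k. ?s i) - ?s n) \<longlonglongrightarrow> z - ?s n"
      unfolding z_def by (intro tendsto_diff summable_LIMSEQ[OF summ] tendsto_const)
    moreover have "0 \<le> (\<Sum>i<k. ?s i) - ?s n" if "Suc n \<le> k" for k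
    proof -
      have "(\<Sum>i<k. ?s i) = ?s n + (\<Sum>i\<in>{..<k} - {n}. ?s i)"
        using that by (intro sum.remove) auto
      then show ?thesis using sum_nonneg[of "{..<k} - {n}" ?s] s_pos by simp
    qed
    ultimately have "0 \<le> z - ?s n" by (rule nonneg_limit)
    then show ?thesis by simp
  qed
  have "2 ^ n \<le> norm (P z)" for n
  proof -
    have "2 ^ n = (1/2::real) ^ n * 4 ^ n" by (simp flip: power_mult_distrib)
    also have "\<dots> \<le> (1/2) ^ n * norm (P (y n))" using y_big by (intro mult_left_mono) auto
    also have "\<dots> = norm (P (?s n))" by (simp add: linear_scale[OF lin])
    also have "\<dots> \<le> norm (P z)" by (intro norm_mono_nonneg pos s_pos mono z_ge)
    finally show ?thesis .
  qed
  then show False using real_arch_pow[of 2 "norm (P z)"] by (auto simp flip: not_le)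
qed

lift_definition regop_blinfun ::
    "('a::banach_lattice, 'b::banach_lattice) regop \<Rightarrow> 'a \<Rightarrow>\<^sub>L 'b" is "\<lambda>T. T"
  by (auto simp: regular_operator_def intro: bounded_linear_sub positive_operator_bounded)


section \<open>The extended space\<close>

datatype 'a extd = Fin 'a | Infty

primrec finite_part :: "'a extd \<Rightarrow> 'a" where
  "finite_part (Fin a) = a"

definition is_finite :: "'a extd \<Rightarrow> bool" where
  "is_finite a \<longleftrightarrow> a \<noteq> Infty"

instantiation extd :: (order) order
begin

fun less_eq_extd :: "'a extd \<Rightarrow> 'a extd \<Rightarrow> bool" where
  "less_eq_extd a Infty \<longleftrightarrow> True"
| "less_eq_extd Infty (Fin b) \<longleftrightarrow> False"
| "less_eq_extd (Fin a) (Fin b) \<longleftrightarrow> a \<le> b"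

definition less_extd :: "'a extd \<Rightarrow> 'a extd \<Rightarrow> bool" where
  "less_extd a b \<longleftrightarrow> a \<le> b \<and> \<not> b \<le> a"

instance
proof
  fix a b c :: "'a extd"
  show "a < b \<longleftrightarrow> a \<le> b \<and> \<not> b \<le> a" by (rule less_extd_def)
  show "a \<le> a" by (cases a) auto
  show "a \<le> b \<Longrightarrow> b \<le> c \<Longrightarrow> a \<le> c" by (cases a; cases b; cases c) auto
  show "a \<le> b \<Longrightarrow> b \<le> a \<Longrightarrow> a = b" by (cases a; cases b) auto
qed

end

instantiation extd :: (comm_monoid_add) comm_monoid_add
begin

definition zero_extd :: "'a extd" where
  "zero_extd = Fin 0"

fun plus_extd :: "'a extd \<Rightarrow> 'a extd \<Rightarrow> 'a extd" where
  "plus_extd (Fin a) (Fin b) = Fin (a + b)"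
| "plus_extd Infty b = Infty"
| "plus_extd a Infty = Infty"

instance
proof
  fix a b c :: "'a extd"
  show "a + b + c = a + (b + c)" by (cases a; cases b; cases c) (auto simp: add.assoc)
  show "a + b = b + a" by (cases a; cases b) (auto simp: add.commute)
  show "0 + a = a" by (cases a) (auto simp: zero_extd_def)
qed

end

text \<open>The value of \<open>r *\<^sub>R Infty\<close> for \<open>r < 0\<close> is a dummy.\<close>

instantiation extd :: (real_vector) scaleR
begin

fun scaleR_extd :: "real \<Rightarrow> 'a extd \<Rightarrow> 'a extd" where
  "scaleR_extd r (Fin a) = Fin (r *\<^sub>R a)"
| "scaleR_extd r Infty = (if r = 0 then Fin 0 else Infty)"

instance ..

end


section \<open>Measures with values in an extended space and the order integral\<close>

text \<open>As in the library's measure theory, a \<open>'x measure\<close> serves as the measurable space; its own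
  \<open>emeasure\<close> plays no role. The values of a set function outside the \<open>\<sigma>\<close>-algebra are immaterial.\<close>

definition order_measure :: "'x measure \<Rightarrow> ('x set \<Rightarrow> 'f::ordered_real_vector extd) \<Rightarrow> bool" where
  "order_measure M \<mu> \<longleftrightarrow> (\<forall>\<Delta>\<in>sets M. 0 \<le> \<mu> \<Delta>) \<and> \<mu> {} = 0 \<and>
     (\<forall>A :: nat \<Rightarrow> 'x set. range A \<subseteq> sets M \<longrightarrow> disjoint_family A \<longrightarrow>
        isLub UNIV (range (\<lambda>N. \<Sum>n\<le>N. \<mu> (A n))) (\<mu> (\<Union>n. A n)))"

definition elementary_integral ::
    "'x measure \<Rightarrow> ('x set \<Rightarrow> 'f::ordered_real_vector extd) \<Rightarrow> ('x \<Rightarrow> real) \<Rightarrow> 'f extd" where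
  "elementary_integral M \<mu> \<phi> = (\<Sum>r\<in>\<phi> ` space M. r *\<^sub>R \<mu> (\<phi> -` {r} \<inter> space M))"

definition elementary_approx :: "'x measure \<Rightarrow> (nat \<Rightarrow> 'x \<Rightarrow> real) \<Rightarrow> ('x \<Rightarrow> ennreal) \<Rightarrow> bool" where
  "elementary_approx M \<phi> f \<longleftrightarrow> (\<forall>n. simple_function M (\<phi> n)) \<and>
     (\<forall>x\<in>space M. (\<forall>n. 0 \<le> \<phi> n x) \<and> incseq (\<lambda>n. \<phi> n x) \<and> (SUP n. ennreal (\<phi> n x)) = f x)"

text \<open>The supremum below is the same for all approximating sequences of \<open>f\<close> when \<open>\<mu>\<close> is a measure and
  \<open>'f\<close> is \<open>\<sigma>\<close>-monotone complete, as the regular operators on a KB-space and the reals are.\<close>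

definition order_nn_integral ::
    "'x measure \<Rightarrow> ('x set \<Rightarrow> 'f::ordered_real_vector extd) \<Rightarrow> ('x \<Rightarrow> ennreal) \<Rightarrow> 'f extd" where
  "order_nn_integral M \<mu> f =
     (THE a. \<exists>\<phi>. elementary_approx M \<phi> f \<and> isLub UNIV (range (\<lambda>n. elementary_integral M \<mu> (\<phi> n))) a)"

definition order_L1 ::
    "'x measure \<Rightarrow> ('x set \<Rightarrow> 'f::ordered_real_vector extd) \<Rightarrow> ('x \<Rightarrow> real) set" where
  "order_L1 M \<mu> = {f \<in> borel_measurable M. is_finite (order_nn_integral M \<mu> (\<lambda>x. ennreal \<bar>f x\<bar>))}"

definition order_integral ::
    "'x measure \<Rightarrow> ('x set \<Rightarrow> 'f::ordered_real_vector extd) \<Rightarrow> ('x \<Rightarrow> real) \<Rightarrow> 'f" where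
  "order_integral M \<mu> f =
     finite_part (order_nn_integral M \<mu> (\<lambda>x. ennreal (max 0 (f x)))) -
     finite_part (order_nn_integral M \<mu> (\<lambda>x. ennreal (max 0 (- f x))))"

definition has_order_integral ::
    "'x measure \<Rightarrow> ('x set \<Rightarrow> 'f::ordered_real_vector extd) \<Rightarrow> ('x \<Rightarrow> real) \<Rightarrow> 'f \<Rightarrow> bool" where
  "has_order_integral M \<mu> f T \<longleftrightarrow> f \<in> order_L1 M \<mu> \<and> order_integral M \<mu> f = T"


section \<open>Regular Borel measures\<close>

definition borel_of :: "'x topology \<Rightarrow> 'x measure" where
  "borel_of X = sigma (topspace X) {U. openin X U}"

definition regular_borel_measure ::
    "'x topology \<Rightarrow> ('x set \<Rightarrow> 'f::ordered_real_vector extd) \<Rightarrow> bool" where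
  "regular_borel_measure X \<mu> \<longleftrightarrow> order_measure (borel_of X) \<mu> \<and>
     (\<forall>K. compactin X K \<longrightarrow> is_finite (\<mu> K)) \<and>
     (\<forall>V. openin X V \<longrightarrow> isLub UNIV {\<mu> K |K. compactin X K \<and> K \<subseteq> V} (\<mu> V)) \<and>
     (\<forall>\<Delta>\<in>sets (borel_of X). isGlb UNIV {\<mu> V |V. openin X V \<and> \<Delta> \<subseteq> V} (\<mu> \<Delta>))"


section \<open>Function spaces\<close>

text \<open>A real function on the space \<open>X\<close> is represented by its extension by zero to the whole type,
  so that a map defined on a function space depends on the function on \<open>X\<close> only. In
  \<open>order_L1\<close> this is not needed, since order integrals ignore the values off the space.\<close>

definition real_functions :: "'x topology \<Rightarrow> ('x \<Rightarrow> real) set" where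
  "real_functions X = {f. \<forall>x. x \<notin> topspace X \<longrightarrow> f x = 0}"

definition fun_support :: "'x topology \<Rightarrow> ('x \<Rightarrow> real) \<Rightarrow> 'x set" where
  "fun_support X f = X closure_of {x \<in> topspace X. f x \<noteq> 0}"

definition Cc_functions :: "'x topology \<Rightarrow> ('x \<Rightarrow> real) set" where
  "Cc_functions X = {f \<in> real_functions X.
     continuous_map X euclideanreal f \<and> compactin X (fun_support X f)}"

definition C0_functions :: "'x topology \<Rightarrow> ('x \<Rightarrow> real) set" where
  "C0_functions X = {f \<in> real_functions X. continuous_map X euclideanreal f \<and>
     (\<forall>\<epsilon>>0. \<exists>K. compactin X K \<and> (\<forall>x\<in>topspace X - K. \<bar>f x\<bar> < \<epsilon>))}"

definition bounded_borel_functions :: "'x topology \<Rightarrow> ('x \<Rightarrow> real) set" where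
  "bounded_borel_functions X = {f \<in> real_functions X.
     f \<in> borel_measurable (borel_of X) \<and> bounded (f ` topspace X)}"

definition subordinate :: "'x topology \<Rightarrow> ('x \<Rightarrow> real) \<Rightarrow> 'x set \<Rightarrow> bool" where
  "subordinate X f S \<longleftrightarrow> f \<in> Cc_functions X \<and> (\<forall>x\<in>topspace X. 0 \<le> f x \<and> f x \<le> 1) \<and> fun_support X f \<subseteq> S"

definition dominates :: "'x topology \<Rightarrow> 'x set \<Rightarrow> ('x \<Rightarrow> real) \<Rightarrow> bool" where
  "dominates X S f \<longleftrightarrow> f \<in> Cc_functions X \<and> (\<forall>x\<in>topspace X. 0 \<le> f x \<and> f x \<le> 1) \<and> (\<forall>x\<in>S. f x = 1)"

definition positive_on_C0 :: "'x topology \<Rightarrow> (('x \<Rightarrow> real) \<Rightarrow> 'f::ordered_real_vector) \<Rightarrow> bool" where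
  "positive_on_C0 X \<pi> \<longleftrightarrow>
     (\<forall>f\<in>C0_functions X. \<forall>g\<in>C0_functions X. \<pi> (\<lambda>x. f x + g x) = \<pi> f + \<pi> g) \<and>
     (\<forall>r. \<forall>f\<in>C0_functions X. \<pi> (\<lambda>x. r * f x) = r *\<^sub>R \<pi> f) \<and>
     (\<forall>f\<in>C0_functions X. (\<forall>x\<in>topspace X. 0 \<le> f x) \<longrightarrow> 0 \<le> \<pi> f)"


section \<open>Operator valued measures\<close>

text \<open>\<open>pairing\<close> and \<open>pairing_measure\<close> are meant for finite \<open>\<mu>\<close>, where \<open>finite_part\<close> does not lose anything.\<close>

definition pairing ::
    "('x set \<Rightarrow> ('e::banach_lattice, 'e) regop extd) \<Rightarrow> 'e \<Rightarrow> ('e, real) regop \<Rightarrow> 'x set \<Rightarrow> real" where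
  "pairing \<mu> x x' \<Delta> = regop_apply x' (regop_apply (finite_part (\<mu> \<Delta>)) x)"

definition pairing_measure ::
    "'x topology \<Rightarrow> ('x set \<Rightarrow> ('e::banach_lattice, 'e) regop extd) \<Rightarrow> 'e \<Rightarrow> ('e, real) regop \<Rightarrow> 'x measure" where
  "pairing_measure X \<mu> x x' =
     measure_of (topspace X) (sets (borel_of X)) (\<lambda>\<Delta>. ennreal (pairing \<mu> x x' \<Delta>))"

definition sot_closed_span :: "('e::banach_lattice, 'e) regop set \<Rightarrow> ('e \<Rightarrow>\<^sub>L 'e) set" where
  "sot_closed_span S =
     (\<lambda>W. subspace W \<and> closedin strong_operator_topology W) hull (regop_blinfun ` S)"

end

theory Submission
  imports Defs
begin

text \<open>Everything is reduced to scalar measures. For \<open>x \<ge> 0\<close> and \<open>x' \<ge> 0\<close>, the functional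
  \<open>f \<mapsto> (\<pi>(f) x, x')\<close> is positive and bounded on the unit interval of \<open>C\<^sub>0(X)\<close>, so that it is
  represented by a finite regular Borel measure by a Riesz theorem. Since \<open>E\<close> is a KB-space, the
  increasing nets \<open>\<pi>(f)\<close>, \<open>f \<prec> V\<close>, and the decreasing nets \<open>\<mu>(V)\<close>, \<open>V \<supseteq> \<Delta>\<close>, converge strongly,
  which yields operators \<open>\<mu>(\<Delta>)\<close> such that \<open>(\<mu>(\<Delta>) x, x')\<close> are the values of these scalar measures.
  By the Hahn-Banach theorem, the positive functionals determine the order of \<open>E\<close>, so that the
  statements on suprema, infima and order integrals can be checked on the scalar measures. Strong
  convergence of the monotone nets gives the equality of the SOT-closed spans. For uniqueness, a
  competing measure, which may be infinite, is restricted to the support of a given \<open>f \<in> C\<^sub>c(X)\<close>.\<close>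

section \<open>Sublinear functionals\<close>

text \<open>The pairing with \<open>x\<close> and \<open>x'\<close> does not by itself commute with
  order suprema of operators. It does here because the monotone nets converge in norm at every
  vector and positive functionals on a Banach lattice are norm continuous; this is why suprema and
  infima are built together with their strong limits. Conversely, an operator is recovered from its
  pairings, but only once a candidate operator is at hand: a family of scalar measures alone would
  give mere bilinear forms, and the limits of nets supply the operators. Finiteness is forced by the
  completeness of \<open>C0_functions X\<close>, since no norm estimate on \<open>\<pi>\<close> is
  assumed: if the images of the unit interval were unbounded at some \<open>x\<close>, a single
  function would dominate a whole weighted sequence of offending ones. The uniqueness proof is then
  the one place where a measure may take the value \<open>Infty\<close>.\<close>

definition sublinear :: "('a::real_vector \<Rightarrow> real) \<Rightarrow> bool" where
  "sublinear p \<longleftrightarrow> p 0 = 0 \<and> (\<forall>x y. p (x + y) \<le> p x + p y) \<and> (\<forall>r>0. \<forall>x. p (r *\<^sub>R x) \<le> r * p x)"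

lemma sublinearD:
  assumes "sublinear p"
  shows "p 0 = 0" "p (x + y) \<le> p x + p y" "0 \<le> r \<Longrightarrow> p (r *\<^sub>R x) = r * p x" "- p (- x) \<le> p x"
proof -
  have le: "p (r *\<^sub>R x) \<le> r * p x" if "r > 0" for r x
    using assms that by (simp add: sublinear_def)
  show z: "p 0 = 0" and add: "p (x + y) \<le> p x + p y" for x y
    using assms by (simp_all add: sublinear_def)
  show "p (r *\<^sub>R x) = r * p x" if "0 \<le> r"
  proof (cases "r = 0")
    case False
    with that have "r > 0" by simp
    then have "r * p (inverse r *\<^sub>R (r *\<^sub>R x)) \<le> r * (inverse r * p (r *\<^sub>R x))"
      by (intro mult_left_mono le) auto
    then have "r * p x \<le> p (r *\<^sub>R x)" using \<open>r > 0\<close> by (simp flip: mult.assoc)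
    then show ?thesis using le[OF \<open>r > 0\<close>, of x] by simp
  qed (simp add: z)
  show "- p (- x) \<le> p x"
    using add[of x "- x"] z by simp
qed

text \<open>Subadditivity of the infimum compares \<open>q\<close> at \<open>x\<close> with
  \<open>r\<close> at \<open>y\<close> for different members of \<open>C\<close>; directedness
  replaces both by one member below them. Applied to chains, this provides the bounds that Zorn's
  lemma asks for.\<close>

lemma sublinear_INF:
  fixes C :: "('a::real_vector \<Rightarrow> real) set"
  assumes ne: "C \<noteq> {}" and sub: "\<And>q. q \<in> C \<Longrightarrow> sublinear q"
    and bdd: "\<And>x. bdd_below ((\<lambda>q. q x) ` C)"
    and dir: "\<And>q r. q \<in> C \<Longrightarrow> r \<in> C \<Longrightarrow> \<exists>s\<in>C. s \<le> q \<and> s \<le> r"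
  shows "sublinear (\<lambda>x. INF q\<in>C. q x)"
  unfolding sublinear_def
proof (intro conjI allI impI)
  let ?i = "\<lambda>x. INF q\<in>C. q x"
  have low: "?i x \<le> q x" if "q \<in> C" for q x
    using that bdd by (rule cINF_lower[rotated])
  show "?i 0 = 0"
    using ne by (simp add: sublinearD(1)[OF sub] cong: INF_cong_simp)
  show "?i (x + y) \<le> ?i x + ?i y" for x y
  proof -
    have "?i (x + y) - q x \<le> r y" if qr: "q \<in> C" "r \<in> C" for q r
    proof -
      obtain s where s: "s \<in> C" "s \<le> q" "s \<le> r" using dir[OF qr] by blast
      have "?i (x + y) \<le> s (x + y)" using s low by blast
      also have "\<dots> \<le> s x + s y" using s sub sublinearD(2) by blast
      also have "\<dots> \<le> q x + r y" using s by (intro add_mono) (auto simp: le_fun_def)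
      finally show ?thesis by simp
    qed
    then have "?i (x + y) - q x \<le> ?i y" if "q \<in> C" for q
      using that ne by (intro cINF_greatest) auto
    then have "?i (x + y) - ?i y \<le> ?i x"
      using ne by (intro cINF_greatest) (auto simp: algebra_simps)
    then show ?thesis by simp
  qed
  show "?i (r *\<^sub>R x) \<le> r * ?i x" if "r > 0" for r x
  proof -
    have "?i (r *\<^sub>R x) / r \<le> q x" if "q \<in> C" for q
      using low[OF that, of "r *\<^sub>R x"] sublinearD(3)[OF sub[OF that], of r x] \<open>r > 0\<close>
      by (simp add: field_simps)
    then have "?i (r *\<^sub>R x) / r \<le> ?i x" using ne by (intro cINF_greatest) auto
    then show ?thesis using \<open>r > 0\<close> by (simp add: field_simps)
  qed
qed

text \<open>The largest sublinear functional below \<open>p\<close> that is linear along \<open>x\<close> and agrees with \<open>p\<close> at \<open>x\<close>.\<close>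

lemma sublinear_shift:
  fixes p :: "'a::real_vector \<Rightarrow> real" and x :: 'a
  assumes p: "sublinear p"
  defines "q \<equiv> \<lambda>y. INF t\<in>{0..}. p (y + t *\<^sub>R x) - t * p x"
  shows "sublinear q" "q \<le> p" "q (- x) \<le> - p x" "q (y + x) \<ge> q y + p x"
proof -
  have bdd: "bdd_below ((\<lambda>t. p (y + t *\<^sub>R x) - t * p x) ` {0..})" for y
  proof (rule bdd_belowI2)
    fix t :: real assume "t \<in> {0..}"
    then have "t * p x = p ((y + t *\<^sub>R x) + - y)" using sublinearD(3)[OF p, of t x] by simp
    also have "\<dots> \<le> p (y + t *\<^sub>R x) + p (- y)" by (rule sublinearD(2)[OF p])
    finally show "- p (- y) \<le> p (y + t *\<^sub>R x) - t * p x" by simp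
  qed
  have low: "q y \<le> p (y + t *\<^sub>R x) - t * p x" if "t \<ge> 0" for y t
    unfolding q_def using that by (intro cINF_lower bdd) auto
  have great: "c \<le> q y" if "\<And>t. 0 \<le> t \<Longrightarrow> c \<le> p (y + t *\<^sub>R x) - t * p x" for c y
    unfolding q_def using that by (intro cINF_greatest) auto
  show "q \<le> p" using low[of 0] by (simp add: le_fun_def)
  show "q (- x) \<le> - p x" using low[of 1 "- x"] sublinearD(1)[OF p] by simp
  show "q (y + x) \<ge> q y + p x"
  proof (rule great)
    fix t :: real assume "0 \<le> t"
    then have "q y \<le> p (y + (t + 1) *\<^sub>R x) - (t + 1) * p x" by (intro low) simp
    also have "y + (t + 1) *\<^sub>R x = y + x + t *\<^sub>R x" by (simp add: algebra_simps)
    finally show "q y + p x \<le> p (y + x + t *\<^sub>R x) - t * p x" by (simp add: algebra_simps)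
  qed
  show "sublinear q" unfolding sublinear_def
  proof (intro conjI allI impI)
    show "q 0 = 0"
    proof (rule antisym)
      show "q 0 \<le> 0" using low[of 0 0] sublinearD(1)[OF p] by simp
      show "0 \<le> q 0" by (rule great) (simp add: sublinearD(3)[OF p])
    qed
    show "q (y + z) \<le> q y + q z" for y z
    proof -
      have *: "q (y + z) \<le> (p (y + t *\<^sub>R x) - t * p x) + (p (z + s *\<^sub>R x) - s * p x)" if "0 \<le> t" "0 \<le> s" for t s
      proof -
        have "q (y + z) \<le> p (y + z + (t + s) *\<^sub>R x) - (t + s) * p x" using that by (intro low) simp
        also have "y + z + (t + s) *\<^sub>R x = (y + t *\<^sub>R x) + (z + s *\<^sub>R x)" by (simp add: algebra_simps)
        also have "p \<dots> \<le> p (y + t *\<^sub>R x) + p (z + s *\<^sub>R x)" by (rule sublinearD(2)[OF p])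
        finally show ?thesis by (simp add: algebra_simps)
      qed
      have "q (y + z) - (p (y + t *\<^sub>R x) - t * p x) \<le> q z" if "0 \<le> t" for t
      proof (rule great)
        show "q (y + z) - (p (y + t *\<^sub>R x) - t * p x) \<le> p (z + s *\<^sub>R x) - s * p x" if "0 \<le> s" for s
          using *[OF \<open>0 \<le> t\<close> that] by linarith
      qed
      then have "q (y + z) - q z \<le> p (y + t *\<^sub>R x) - t * p x" if "0 \<le> t" for t
        using that by fastforce
      then have "q (y + z) - q z \<le> q y" by (rule great)
      then show ?thesis by simp
    qed
    show "q (r *\<^sub>R y) \<le> r * q y" if "r > 0" for r y
    proof -
      have "q (r *\<^sub>R y) / r \<le> p (y + t *\<^sub>R x) - t * p x" if "0 \<le> t" for t
      proof -
        have "q (r *\<^sub>R y) \<le> p (r *\<^sub>R y + (r * t) *\<^sub>R x) - (r * t) * p x"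
          using that \<open>r > 0\<close> by (intro low) simp
        also have "r *\<^sub>R y + (r * t) *\<^sub>R x = r *\<^sub>R (y + t *\<^sub>R x)" by (simp add: algebra_simps)
        also have "p \<dots> = r * p (y + t *\<^sub>R x)" using \<open>r > 0\<close> by (simp add: sublinearD(3)[OF p])
        finally show ?thesis using \<open>r > 0\<close> by (simp add: field_simps)
      qed
      then have "q (r *\<^sub>R y) / r \<le> q y" by (rule great)
      then show ?thesis using \<open>r > 0\<close> by (simp add: field_simps)
    qed
  qed
qed

text \<open>A sublinear functional that is minimal in the pointwise order is linear: each of its
  shifts lies below it and so equals it, which turns subadditivity into additivity. Homogeneity for
  negative scalars then follows from additivity.\<close>

theorem Hahn_Banach_sublinear:
  fixes p :: "'a::real_vector \<Rightarrow> real"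
  assumes p: "sublinear p"
  obtains \<phi> where "linear \<phi>" "\<phi> \<le> p" "\<phi> y = p y"
proof -
  \<comment> \<open>Minimality is sought below the shift \<open>p'\<close> rather than below
    \<open>p\<close>: since \<open>p' (- y) \<le> - p y\<close>, every linear functional below
    \<open>p'\<close> takes at least the value \<open>p y\<close> at \<open>y\<close>.\<close>
  define p' where "p' z = (INF t\<in>{0..}. p (z + t *\<^sub>R y) - t * p y)" for z
  have p': "sublinear p'" "p' \<le> p" "p' (- y) \<le> - p y"
    using sublinear_shift[OF p, of y] by (simp_all add: p'_def[abs_def])
  define A where "A = {q. sublinear q \<and> q \<le> p'}"
  have "\<exists>m\<in>A. \<forall>a\<in>A. a \<le> m \<longrightarrow> a = m"
  \<comment> \<open>The order is reversed, so that the maximal element from Zorn's lemma is a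
    minimal functional.\<close>
  proof (rule predicate_Zorn[where P = "\<lambda>x y. y \<le> x"])
    show "partial_order_on A (relation_of (\<lambda>x y. y \<le> x) A)"
      by (rule partial_order_on_relation_ofI) auto
    fix C assume C: "C \<in> Chains (relation_of (\<lambda>x y. y \<le> x) A)"
    have CA: "C \<subseteq> A" and lin: "\<And>q r. q \<in> C \<Longrightarrow> r \<in> C \<Longrightarrow> q \<le> r \<or> r \<le> q"
      using C by (auto simp: Chains_def relation_of_def)
    show "\<exists>u\<in>A. \<forall>a\<in>C. u \<le> a"
    proof (cases "C = {}")
      case True then show ?thesis using p' by (auto simp: A_def)
    next
      case False
      have bdd: "bdd_below ((\<lambda>q. q x) ` C)" for x
      proof (rule bdd_belowI2)
        fix q assume "q \<in> C"
        then have "sublinear q" "q \<le> p'" using CA by (auto simp: A_def)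
        then have "- p' (- x) \<le> - q (- x)" by (simp add: le_fun_def)
        also have "\<dots> \<le> q x" by (rule sublinearD) fact
        finally show "- p' (- x) \<le> q x" .
      qed
      let ?u = "\<lambda>x. INF q\<in>C. q x"
      have low: "?u \<le> q" if "q \<in> C" for q
        using that bdd by (auto simp: le_fun_def intro: cINF_lower)
      have "sublinear ?u"
      proof (rule sublinear_INF[OF False _ bdd])
        show "\<exists>s\<in>C. s \<le> q \<and> s \<le> r" if "q \<in> C" "r \<in> C" for q r
          using lin[OF that] that by blast
      qed (use CA in \<open>auto simp: A_def\<close>)
      moreover obtain q where "q \<in> C" using False by blast
      ultimately have "?u \<in> A" using low[OF \<open>q \<in> C\<close>] CA unfolding A_def by (blast intro: order_trans)
      then show ?thesis using low by blast
    qed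
  qed
  then obtain m where m: "m \<in> A" and min: "\<And>a. a \<in> A \<Longrightarrow> a \<le> m \<Longrightarrow> a = m" by blast
  have ms: "sublinear m" and mp: "m \<le> p'" using m by (auto simp: A_def)
  have add: "m (v + x) = m v + m x" for v x
  proof (rule antisym)
    have eq: "(\<lambda>v. INF t\<in>{0..}. m (v + t *\<^sub>R x) - t * m x) = m" (is "?q = m")
    proof (rule min)
      show "?q \<le> m" by (rule sublinear_shift(2)[OF ms])
      then show "?q \<in> A" using mp sublinear_shift(1)[OF ms] by (auto simp: A_def intro: order_trans)
    qed
    show "m v + m x \<le> m (v + x)"
      using sublinear_shift(4)[OF ms, of v x] fun_cong[OF eq, of v] fun_cong[OF eq, of "v + x"] by linarith
  qed (rule sublinearD(2)[OF ms])
  have neg: "m (- x) = - m x" for x using add[of x "- x"] sublinearD(1)[OF ms] by simp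
  have lin: "linear m"
  proof (rule linearI)
    show "m (r *\<^sub>R x) = r *\<^sub>R m x" for r x
    proof (cases "0 \<le> r")
      case False
      then have "m (- (r *\<^sub>R x)) = - r * m x" using sublinearD(3)[OF ms, of "- r" x] by simp
      then show ?thesis using neg by simp
    qed (simp add: sublinearD(3)[OF ms])
  qed (rule add)
  have mle: "m x \<le> p x" for x using mp p'(2) by (auto simp: le_fun_def intro: order_trans)
  have "m (- y) \<le> - p y" using mp p'(3) by (auto simp: le_fun_def intro: order_trans)
  then have "m y = p y" using neg[of y] mle[of y] by simp
  then show ?thesis using that lin mle by (auto simp: le_fun_def)
qed


section \<open>Positive functionals determine the order\<close>

text \<open>Functionals \<open>('e, real) regop\<close> become operators between Banach lattices, so
  the automatic boundedness of such operators yields the continuity of every element of the order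
  dual.\<close>

instance real :: banach_lattice
  by standard simp

lemma regop_linear: "linear (regop_apply T)"
  using regop_apply[of T] by (auto intro: regular_operator_linear)

lemmas regop_apply_simps [simp] =
  zero_regop.rep_eq plus_regop.rep_eq minus_regop.rep_eq uminus_regop.rep_eq scaleR_regop.rep_eq

lemma regop_apply_linear [simp]:
  "regop_apply T 0 = 0" "regop_apply T (x + y) = regop_apply T x + regop_apply T y"
  "regop_apply T (x - y) = regop_apply T x - regop_apply T y"
  "regop_apply T (- x) = - regop_apply T x" "regop_apply T (r *\<^sub>R x) = r *\<^sub>R regop_apply T x"
  using regop_linear[of T]
  by (simp_all add: linear_0 linear_add linear_diff linear_neg linear_scale)

lemma regop_apply_sum_left: "regop_apply (\<Sum>i\<in>I. T i) x = (\<Sum>i\<in>I. regop_apply (T i) x)"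
  by (induction I rule: infinite_finite_induct) auto

lemma regop_apply_sum_right: "regop_apply T (\<Sum>i\<in>I. x i) = (\<Sum>i\<in>I. regop_apply T (x i))"
  by (induction I rule: infinite_finite_induct) auto

lemma regop_apply_nonneg: "0 \<le> T \<Longrightarrow> 0 \<le> x \<Longrightarrow> 0 \<le> regop_apply T x"
  by (simp add: less_eq_regop.rep_eq)

lemma regop_apply_mono: "0 \<le> T \<Longrightarrow> x \<le> y \<Longrightarrow> regop_apply T x \<le> regop_apply T y"
  using regop_apply_nonneg[of T "y - x"] by simp

lemma bounded_linear_regop:
  fixes T :: "('a::banach_lattice, 'b::banach_lattice) regop"
  shows "bounded_linear (regop_apply T)"
  using blinfun.bounded_linear_right[of "regop_blinfun T"] by (simp add: regop_blinfun.rep_eq)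

lemma nonneg_parts:
  fixes x :: "'a::lattice_ab_group_add"
  obtains u v where "0 \<le> u" "0 \<le> v" "x = u - v"
proof
  show "x = sup x 0 - (sup x 0 - x)" by (metis add_diff_cancel_left' diff_diff_eq2)
qed simp_all

text \<open>The norm of the positive part is sublinear and vanishes at \<open>- z\<close> for
  \<open>z \<ge> 0\<close>, so a linear functional below it is positive. Hahn-Banach with equality
  at \<open>y\<close> gives the value \<open>norm (sup y 0)\<close>, which is nonzero because
  \<open>y \<le> 0\<close> fails.\<close>

lemma positive_functional_separates:
  fixes y :: "'e::banach_lattice"
  assumes "\<not> y \<le> 0"
  obtains x' :: "('e, real) regop" where "0 \<le> x'" "0 < regop_apply x' y"
proof -
  let ?p = "\<lambda>z::'e. norm (sup z 0)"
  have "sublinear ?p" unfolding sublinear_def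
  proof (intro conjI allI impI)
    fix u v :: 'e and r :: real
    show "?p (u + v) \<le> ?p u + ?p v"
    proof -
      have "?p (u + v) \<le> norm (sup u 0 + sup v 0)"
        by (intro norm_mono_nonneg le_supI add_mono add_nonneg_nonneg) auto
      also have "\<dots> \<le> ?p u + ?p v" by (rule norm_triangle_ineq)
      finally show ?thesis .
    qed
    assume "0 < r"
    then have "?p (r *\<^sub>R u) \<le> norm (r *\<^sub>R sup u 0)"
      by (intro norm_mono_nonneg le_supI scaleR_left_mono scaleR_nonneg_nonneg) auto
    then show "?p (r *\<^sub>R u) \<le> r * ?p u" using \<open>0 < r\<close> by simp
  qed simp
  then obtain \<phi> where \<phi>: "linear \<phi>" "\<phi> \<le> ?p" "\<phi> y = ?p y" by (rule Hahn_Banach_sublinear)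
  have "0 \<le> \<phi> z" if "0 \<le> z" for z
  proof -
    have "\<phi> (- z) \<le> ?p (- z)" using \<phi>(2) by (simp add: le_fun_def)
    also have "sup (- z) 0 = 0" using that by (simp add: sup_absorb2)
    finally show ?thesis using \<phi>(1) by (simp add: linear_neg)
  qed
  then have pos: "positive_operator \<phi>" using \<phi>(1) by (simp add: positive_operator_def)
  then have "regular_operator \<phi>" unfolding regular_operator_def
    using positive_operator_zero by fastforce
  then have ap: "regop_apply (Regop \<phi>) = \<phi>" by (simp add: Regop_inverse)
  show thesis
  proof (rule that[of "Regop \<phi>"])
    show "0 \<le> Regop \<phi>" using pos by (simp add: less_eq_regop.rep_eq ap positive_operator_def)
    have "sup y 0 \<noteq> 0" using assms by (metis sup_ge1)
    then show "0 < regop_apply (Regop \<phi>) y" by (simp add: ap \<phi>(3))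
  qed
qed

lemma le_iff_positive_functionals:
  fixes x y :: "'e::banach_lattice"
  shows "x \<le> y \<longleftrightarrow> (\<forall>x'::('e, real) regop. 0 \<le> x' \<longrightarrow> regop_apply x' x \<le> regop_apply x' y)"
proof
  assume *: "\<forall>x'::('e, real) regop. 0 \<le> x' \<longrightarrow> regop_apply x' x \<le> regop_apply x' y"
  show "x \<le> y"
  proof (rule ccontr)
    assume "\<not> x \<le> y"
    then have "\<not> x - y \<le> 0" by simp
    then obtain x' :: "('e, real) regop" where "0 \<le> x'" "0 < regop_apply x' (x - y)"
      by (rule positive_functional_separates)
    then show False using * by fastforce
  qed
qed (auto intro: regop_apply_mono)

text \<open>The operator order is tested on positive vectors and the order of \<open>'e\<close> on
  positive functionals, so an operator inequality becomes a family of real inequalities. The later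
  proofs about measures and integrals rely on this translation.\<close>

lemma regop_le_iff_scalar:
  fixes S T :: "('a::banach_lattice, 'e::banach_lattice) regop"
  shows "S \<le> T \<longleftrightarrow> (\<forall>x\<ge>0. \<forall>x'::('e, real) regop. 0 \<le> x' \<longrightarrow>
    regop_apply x' (regop_apply S x) \<le> regop_apply x' (regop_apply T x))"
proof -
  have "(regop_apply S x \<le> regop_apply T x) = (\<forall>x'::('e, real) regop. 0 \<le> x' \<longrightarrow>
    regop_apply x' (regop_apply S x) \<le> regop_apply x' (regop_apply T x))" for x
    by (rule le_iff_positive_functionals)
  then show ?thesis by (simp add: less_eq_regop.rep_eq[of S T])
qed

lemma regop_scalar_mono:
  fixes S T :: "('a::banach_lattice, 'e::banach_lattice) regop" and x' :: "('e, real) regop"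
  assumes "S \<le> T" "0 \<le> x" "0 \<le> x'"
  shows "regop_apply x' (regop_apply S x) \<le> regop_apply x' (regop_apply T x)"
  using assms(1,2) by (intro regop_apply_mono[OF assms(3)]) (simp add: less_eq_regop.rep_eq)

lemma regop_eqI_scalar:
  fixes S T :: "('a::banach_lattice, 'e::banach_lattice) regop"
  assumes "\<And>x x'::('e, real) regop. 0 \<le> x \<Longrightarrow> 0 \<le> x' \<Longrightarrow>
    regop_apply x' (regop_apply S x) = regop_apply x' (regop_apply T x)"
  shows "S = T"
  by (rule antisym; rule regop_le_iff_scalar[THEN iffD2]) (simp_all add: assms)


section \<open>Monotone nets of operators\<close>

lemma closed_nonneg: "closed {x::'a::banach_lattice. 0 \<le> x}"
  unfolding closed_sequential_limits by (auto intro: nonneg_limit[where N = 0])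

lemma tendsto_le_lattice:
  fixes f g :: "'i \<Rightarrow> 'a::banach_lattice"
  assumes "F \<noteq> bot" "(f \<longlongrightarrow> a) F" "(g \<longlongrightarrow> b) F" "\<forall>\<^sub>F i in F. f i \<le> g i"
  shows "a \<le> b"
proof -
  have "b - a \<in> {x. 0 \<le> x}"
    by (rule Lim_in_closed_set[OF closed_nonneg _ assms(1) tendsto_diff[OF assms(3,2)]])
      (use assms(4) in simp)
  then show ?thesis by simp
qed

lemma net_filter_neq_bot:
  assumes "directed I le"
  shows "net_filter I le \<noteq> bot"
proof -
  have "\<forall>i\<in>I. le i i" using assms by (simp add: directed_def)
  then show ?thesis by (auto simp: trivial_limit_def eventually_net_filter[OF assms])
qed

lemma eventually_net_filterI:
  assumes dir: "directed I le" and P: "\<And>i. i \<in> I \<Longrightarrow> P i"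
  shows "eventually P (net_filter I le)"
proof -
  have "I \<noteq> {}" using dir by (simp add: directed_def)
  then obtain i where "i \<in> I" by blast
  then show ?thesis unfolding eventually_net_filter[OF dir] by (intro bexI[of _ i] ballI impI P)
qed

lemma directed_nat: "directed (UNIV :: nat set) (\<le>)"
  unfolding directed_def by (auto intro: max.cobounded1 max.cobounded2)

lemma net_filter_nat: "net_filter (UNIV :: nat set) (\<le>) = sequentially"
  by (rule filter_eqI) (auto simp: eventually_net_filter[OF directed_nat] eventually_sequentially)

text \<open>The KB property acts at each positive vector separately, so a bound depending on the
  vector is enough. The pointwise limit is linear and positive, and closedness of the positive cone
  makes it the least upper bound; supremum and strong limit are thus obtained together.\<close>

lemma increasing_regop_net:
  fixes T :: "'i \<Rightarrow> ('a::banach_lattice, 'e::kb_space) regop"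
  assumes dir: "directed I le"
    and mono: "\<And>i j. i \<in> I \<Longrightarrow> j \<in> I \<Longrightarrow> le i j \<Longrightarrow> T i \<le> T j"
    and pos: "\<And>i. i \<in> I \<Longrightarrow> 0 \<le> T i"
    and bdd: "\<And>x. 0 \<le> x \<Longrightarrow> \<exists>c. \<forall>i\<in>I. norm (regop_apply (T i) x) \<le> c"
  obtains S where "isLub UNIV (T ` I) S"
    "\<And>x. ((\<lambda>i. regop_apply (T i) x) \<longlongrightarrow> regop_apply S x) (net_filter I le)"
proof -
  let ?F = "net_filter I le"
  note nb = net_filter_neq_bot[OF dir]
  have ev: "\<forall>\<^sub>F j in ?F. j \<in> I \<and> le i j" if "i \<in> I" for i
    unfolding eventually_net_filter[OF dir] using that by blast
  obtain i0 where "i0 \<in> I" using dir by (auto simp: directed_def)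
  have evI: "\<forall>\<^sub>F j in ?F. j \<in> I" using ev[OF \<open>i0 \<in> I\<close>] by (rule eventually_mono) simp
  have pl: "\<exists>l. ((\<lambda>i. regop_apply (T i) x) \<longlongrightarrow> l) ?F" if x: "0 \<le> x" for x
  proof -
    obtain c where "\<forall>i\<in>I. norm (regop_apply (T i) x) \<le> c" using bdd[OF x] by blast
    then show ?thesis
      by (intro increasing_bounded_net_converges[OF dir, of _ c])
        (use mono pos x in \<open>auto simp: less_eq_regop.rep_eq\<close>)
  qed
  \<comment> \<open>The nets are increasing only at positive vectors; other vectors are differences
    of these.\<close>
  have "\<exists>l. ((\<lambda>i. regop_apply (T i) x) \<longlongrightarrow> l) ?F" for x
  proof -
    obtain u v where uv: "0 \<le> u" "0 \<le> v" "x = u - v" by (rule nonneg_parts)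
    obtain a b where "((\<lambda>i. regop_apply (T i) u) \<longlongrightarrow> a) ?F" "((\<lambda>i. regop_apply (T i) v) \<longlongrightarrow> b) ?F"
      using pl[OF uv(1)] pl[OF uv(2)] by blast
    then have "((\<lambda>i. regop_apply (T i) u - regop_apply (T i) v) \<longlongrightarrow> a - b) ?F" by (rule tendsto_diff)
    then show ?thesis unfolding uv(3) by auto
  qed
  then obtain l where l: "\<And>x. ((\<lambda>i. regop_apply (T i) x) \<longlongrightarrow> l x) ?F" by metis
  have lin: "linear l"
  proof (rule linearI)
    show "l (x + y) = l x + l y" for x y
      by (rule tendsto_unique[OF nb l]) (use tendsto_add[OF l l] in simp)
    show "l (r *\<^sub>R x) = r *\<^sub>R l x" for r x
      by (rule tendsto_unique[OF nb l]) (use tendsto_scaleR[OF tendsto_const l] in simp)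
  qed
  have "0 \<le> l x" if "0 \<le> x" for x
    by (rule tendsto_le_lattice[OF nb tendsto_const l])
      (use evI that pos in \<open>auto elim!: eventually_mono intro!: regop_apply_nonneg\<close>)
  then have "positive_operator l" using lin by (simp add: positive_operator_def)
  then have "regular_operator l" unfolding regular_operator_def
    using positive_operator_zero by fastforce
  then have ap: "regop_apply (Regop l) = l" by (simp add: Regop_inverse)
  show thesis
  proof (rule that[of "Regop l"])
    show "isLub UNIV (T ` I) (Regop l)"
    proof (rule isLubI2)
      show "isUb UNIV (T ` I) (Regop l)"
      proof (rule isUb_UNIV_I, clarify)
        fix i assume i: "i \<in> I"
        have "regop_apply (T i) x \<le> l x" if "0 \<le> x" for x
          by (rule tendsto_le_lattice[OF nb tendsto_const l])
            (use ev[OF i] i that mono in \<open>auto elim!: eventually_mono simp: less_eq_regop.rep_eq\<close>)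
        then show "T i \<le> Regop l" by (simp add: less_eq_regop.rep_eq ap)
      qed
      show "Regop l <=* Collect (isUb UNIV (T ` I))"
      proof (rule setgeI, clarify)
        fix U assume U: "isUb UNIV (T ` I) U"
        have "l x \<le> regop_apply U x" if "0 \<le> x" for x
          by (rule tendsto_le_lattice[OF nb l tendsto_const])
            (use evI that isUbD[OF U] in \<open>auto elim!: eventually_mono simp: less_eq_regop.rep_eq\<close>)
        then show "Regop l \<le> U" by (simp add: less_eq_regop.rep_eq ap)
      qed
    qed
  qed (simp add: ap l)
qed

section \<open>Functions vanishing at infinity\<close>

text \<open>The compact set in the definition involves a choice, and the level set is a canonical
  one: it is closed by continuity and lies inside any admissible compact set.\<close>

lemma C0_iff:
  "f \<in> C0_functions X \<longleftrightarrow> f \<in> real_functions X \<and> continuous_map X euclideanreal f \<and>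
    (\<forall>\<epsilon>>0. compactin X {x \<in> topspace X. \<epsilon> \<le> \<bar>f x\<bar>})"
  (is "_ \<longleftrightarrow> ?R")
proof
  assume f: "f \<in> C0_functions X"
  then have cont: "continuous_map X euclideanreal f" by (simp add: C0_functions_def)
  have "compactin X {x \<in> topspace X. \<epsilon> \<le> \<bar>f x\<bar>}" if "\<epsilon> > 0" for \<epsilon>
  proof -
    have "\<exists>K. compactin X K \<and> (\<forall>x\<in>topspace X - K. \<bar>f x\<bar> < \<epsilon>)"
      using f that by (simp add: C0_functions_def)
    then obtain K where K: "compactin X K" "\<forall>x\<in>topspace X - K. \<bar>f x\<bar> < \<epsilon>" by blast
    have "closedin X {x \<in> topspace X. \<bar>f x\<bar> \<in> {\<epsilon>..}}"
      by (rule closedin_continuous_map_preimage[OF continuous_map_real_abs[OF cont]]) simp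
    then show ?thesis by (intro closed_compactin[OF K(1)]) (use K(2) in \<open>auto simp flip: not_le\<close>)
  qed
  then show ?R using f by (auto simp: C0_functions_def)
next
  assume R: ?R
  have "\<exists>K. compactin X K \<and> (\<forall>x\<in>topspace X - K. \<bar>f x\<bar> < \<epsilon>)" if "\<epsilon> > 0" for \<epsilon>
    by (rule exI[of _ "{x \<in> topspace X. \<epsilon> \<le> \<bar>f x\<bar>}"]) (use R that in auto)
  then show "f \<in> C0_functions X" using R by (simp add: C0_functions_def)
qed

lemma Cc_subset_C0: "Cc_functions X \<subseteq> C0_functions X"
proof
  fix f assume f: "f \<in> Cc_functions X"
  have "{x \<in> topspace X. f x \<noteq> 0} \<subseteq> fun_support X f"
    unfolding fun_support_def by (rule closure_of_subset) auto
  then have "\<forall>x\<in>topspace X - fun_support X f. f x = 0" by auto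
  then have "\<exists>K. compactin X K \<and> (\<forall>x\<in>topspace X - K. \<bar>f x\<bar> < \<epsilon>)" if "\<epsilon> > 0" for \<epsilon>
    using f that by (intro exI[of _ "fun_support X f"]) (auto simp: Cc_functions_def)
  then show "f \<in> C0_functions X" using f by (simp add: C0_functions_def Cc_functions_def)
qed

lemma C0_continuous: "f \<in> C0_functions X \<Longrightarrow> continuous_map X euclideanreal f"
  and C0_outside: "f \<in> C0_functions X \<Longrightarrow> x \<notin> topspace X \<Longrightarrow> f x = 0"
  by (simp_all add: C0_functions_def real_functions_def)

text \<open>One estimate serves all the vector space and lattice operations below: \<open>k\<close>
  is small, or zero, wherever both \<open>f\<close> and \<open>g\<close> are.\<close>

lemma C0_dominated:
  assumes f: "f \<in> C0_functions X" and g: "g \<in> C0_functions X"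
    and k: "continuous_map X euclideanreal k" and le: "\<And>x. \<bar>k x\<bar> \<le> c * (\<bar>f x\<bar> + \<bar>g x\<bar>)"
  shows "k \<in> C0_functions X"
proof -
  have "k x = 0" if "x \<notin> topspace X" for x
    using le[of x] C0_outside[OF f that] C0_outside[OF g that] by simp
  then have "k \<in> real_functions X" by (simp add: real_functions_def)
  moreover have "\<exists>K. compactin X K \<and> (\<forall>x\<in>topspace X - K. \<bar>k x\<bar> < \<epsilon>)" if "\<epsilon> > 0" for \<epsilon>
  proof -
    \<comment> \<open>\<open>c\<close> may be zero or negative; \<open>b\<close> is a positive
      constant that still bounds it from above.\<close>
    define b where "b = \<bar>c\<bar> + 1"
    have "b > 0" by (simp add: b_def)
    define \<delta> where "\<delta> = \<epsilon> / (2 * b)"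
    have "\<delta> > 0" using that \<open>b > 0\<close> by (simp add: \<delta>_def)
    let ?K = "{x \<in> topspace X. \<delta> \<le> \<bar>f x\<bar>} \<union> {x \<in> topspace X. \<delta> \<le> \<bar>g x\<bar>}"
    have "\<bar>k x\<bar> < \<epsilon>" if x: "x \<in> topspace X - ?K" for x
    proof -
      have *: "\<bar>f x\<bar> + \<bar>g x\<bar> < 2 * \<delta>" using x by auto
      have "\<bar>k x\<bar> \<le> c * (\<bar>f x\<bar> + \<bar>g x\<bar>)" by (rule le)
      also have "\<dots> \<le> (\<bar>c\<bar> + 1) * (\<bar>f x\<bar> + \<bar>g x\<bar>)" by (intro mult_right_mono) auto
      also have "\<dots> < (\<bar>c\<bar> + 1) * (2 * \<delta>)" using * by (intro mult_strict_left_mono) auto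
      also have "\<dots> = \<epsilon>" using \<open>b > 0\<close> by (simp add: \<delta>_def flip: b_def)
      finally show ?thesis .
    qed
    moreover have "compactin X ?K"
      using f g \<open>\<delta> > 0\<close> by (intro compactin_Un) (auto simp: C0_iff)
    ultimately show ?thesis by blast
  qed
  ultimately show ?thesis using k by (simp add: C0_functions_def)
qed

lemma C0_zero [simp]: "(\<lambda>x. 0) \<in> C0_functions X"
  by (auto simp: C0_functions_def real_functions_def intro: exI[of _ "{}"])

lemma C0_add: "f \<in> C0_functions X \<Longrightarrow> g \<in> C0_functions X \<Longrightarrow> (\<lambda>x. f x + g x) \<in> C0_functions X"
  by (rule C0_dominated[where c = 1 and f = f and g = g])
    (auto intro: continuous_map_add C0_continuous abs_triangle_ineq)

lemma C0_scale: "f \<in> C0_functions X \<Longrightarrow> (\<lambda>x. r * f x) \<in> C0_functions X"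
  by (rule C0_dominated[where c = "\<bar>r\<bar>", of f X "\<lambda>x. 0"])
    (auto intro: continuous_map_real_mult_left C0_continuous simp: abs_mult)

lemma C0_uminus: "f \<in> C0_functions X \<Longrightarrow> (\<lambda>x. - f x) \<in> C0_functions X"
  using C0_scale[of f X "-1"] by simp

lemma C0_diff: "f \<in> C0_functions X \<Longrightarrow> g \<in> C0_functions X \<Longrightarrow> (\<lambda>x. f x - g x) \<in> C0_functions X"
  using C0_add[of f X "\<lambda>x. - g x"] C0_uminus[of g X] by simp

lemma C0_min: "f \<in> C0_functions X \<Longrightarrow> g \<in> C0_functions X \<Longrightarrow> (\<lambda>x. min (f x) (g x)) \<in> C0_functions X"
  and C0_max: "f \<in> C0_functions X \<Longrightarrow> g \<in> C0_functions X \<Longrightarrow> (\<lambda>x. max (f x) (g x)) \<in> C0_functions X"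
  by (rule C0_dominated[where c = 1 and f = f and g = g];
      auto intro!: continuous_map_real_min continuous_map_real_max dest: C0_continuous)+

lemma C0_abs: "f \<in> C0_functions X \<Longrightarrow> (\<lambda>x. \<bar>f x\<bar>) \<in> C0_functions X"
  by (rule C0_dominated[where c = 1, of f X "\<lambda>x. 0"])
    (auto intro!: continuous_map_real_abs dest: C0_continuous)

lemma C0_sum:
  "(\<And>i. i \<in> I \<Longrightarrow> f i \<in> C0_functions X) \<Longrightarrow> (\<lambda>x. \<Sum>i\<in>I. f i x) \<in> C0_functions X"
  by (induction I rule: infinite_finite_induct) (auto intro: C0_add)

lemma C0_bounded:
  assumes f: "f \<in> C0_functions X"
  obtains c where "c > 0" "\<And>x. \<bar>f x\<bar> \<le> c"
proof -
  let ?K = "{x \<in> topspace X. 1 \<le> \<bar>f x\<bar>}"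
  have "compactin X ?K" using f by (simp add: C0_iff)
  then have "compactin euclideanreal (f ` ?K)"
    by (rule image_compactin) (rule C0_continuous[OF f])
  then have "bounded (f ` ?K)" by (simp add: compact_imp_bounded)
  then obtain b where "\<forall>y\<in>f ` ?K. \<bar>y\<bar> \<le> b" by (auto simp: bounded_iff)
  then have b: "\<And>x. x \<in> ?K \<Longrightarrow> \<bar>f x\<bar> \<le> b" by blast
  have "\<bar>f x\<bar> \<le> max b 1" for x
    using b[of x] C0_outside[OF f, of x] by (cases "x \<in> ?K") force+
  then show thesis using that[of "max b 1"] by simp
qed

section \<open>Compactly supported bump functions on locally compact Hausdorff spaces\<close>

locale lch_space =
  fixes X :: "'x topology"
  assumes loc_compact: "locally_compact_space X" and Hausdorff: "Hausdorff_space X"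
begin

lemma Cc_supportI:
  assumes "continuous_map X euclideanreal f" "compactin X K" "\<And>x. x \<notin> K \<Longrightarrow> f x = 0"
  shows "f \<in> Cc_functions X" "fun_support X f \<subseteq> K"
proof -
  have KX: "K \<subseteq> topspace X" and cl: "closedin X K"
    using assms(2) Hausdorff by (auto simp: compactin_subset_topspace compactin_imp_closedin)
  show sub: "fun_support X f \<subseteq> K" unfolding fun_support_def
    by (rule closure_of_minimal[OF _ cl]) (use assms(3) in auto)
  have "compactin X (fun_support X f)"
    by (rule closed_compactin[OF assms(2) sub]) (simp add: fun_support_def)
  moreover have "f \<in> real_functions X" using KX assms(3) by (auto simp: real_functions_def)
  ultimately show "f \<in> Cc_functions X" using assms(1) by (simp add: Cc_functions_def)
qed

lemma fun_support_outside:
  assumes "f \<in> Cc_functions X" "x \<notin> fun_support X f"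
  shows "f x = 0"
proof -
  have "{x \<in> topspace X. f x \<noteq> 0} \<subseteq> fun_support X f"
    unfolding fun_support_def by (rule closure_of_subset) auto
  then show ?thesis using assms by (auto simp: Cc_functions_def real_functions_def)
qed

text \<open>The bounds hold at every point of the type, because members of
  \<open>Cc_functions X\<close> are zero off the space.\<close>

lemma subordinateD:
  assumes "subordinate X f V"
  shows "f \<in> Cc_functions X" "f \<in> C0_functions X" "0 \<le> f x" "f x \<le> 1"
    "compactin X (fun_support X f)" "fun_support X f \<subseteq> V" "x \<notin> V \<Longrightarrow> f x = 0"
proof -
  show Cc: "f \<in> Cc_functions X" and V: "fun_support X f \<subseteq> V"
    using assms by (simp_all add: subordinate_def)
  then show "f \<in> C0_functions X" "compactin X (fun_support X f)"
    using Cc_subset_C0 by (auto simp: Cc_functions_def)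
  then have "x \<notin> topspace X \<Longrightarrow> f x = 0" by (simp add: C0_outside)
  then have "0 \<le> f x \<and> f x \<le> 1"
    using assms by (cases "x \<in> topspace X") (auto simp: subordinate_def)
  then show "0 \<le> f x" "f x \<le> 1" by auto
  show "x \<notin> V \<Longrightarrow> f x = 0" using fun_support_outside[OF Cc] V by blast
qed

lemma subordinateI:
  assumes "f \<in> C0_functions X" "\<And>x. 0 \<le> f x \<and> f x \<le> 1" "compactin X K" "K \<subseteq> V"
    "\<And>x. x \<notin> K \<Longrightarrow> f x = 0"
  shows "subordinate X f V"
  using Cc_supportI[OF C0_continuous[OF assms(1)] assms(3,5)] assms(2,4)
  by (auto simp: subordinate_def)

lemma subordinate_zero: "subordinate X (\<lambda>x. 0) V"
  by (rule subordinateI[where K = "{}"]) auto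

text \<open>Single points have compact neighbourhoods inside \<open>V\<close>, and finitely many of
  these cover \<open>K\<close>.\<close>

lemma compact_neighbourhood:
  assumes K: "compactin X K" and V: "openin X V" "K \<subseteq> V"
  obtains U C where "openin X U" "compactin X C" "K \<subseteq> U" "U \<subseteq> C" "C \<subseteq> V"
proof -
  have nb: "neighbourhood_base_of (compactin X) X"
    using locally_compact_space_neighbourhood_base loc_compact Hausdorff by blast
  have "\<forall>x\<in>K. \<exists>U C. openin X U \<and> compactin X C \<and> x \<in> U \<and> U \<subseteq> C \<and> C \<subseteq> V"
    using nb V unfolding neighbourhood_base_of by blast
  then obtain U C where UC: "\<And>x. x \<in> K \<Longrightarrow>
      openin X (U x) \<and> compactin X (C x) \<and> x \<in> U x \<and> U x \<subseteq> C x \<and> C x \<subseteq> V"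
    by metis
  then obtain \<F> where \<F>: "finite \<F>" "\<F> \<subseteq> U ` K" "K \<subseteq> \<Union>\<F>"
    using compactinD[OF K, of "U ` K"] by blast
  then obtain F where F: "finite F" "F \<subseteq> K" "\<F> = U ` F" by (meson finite_subset_image)
  show thesis
  proof (rule that)
    show "openin X (\<Union>x\<in>F. U x)" using UC F by blast
    show "compactin X (\<Union>x\<in>F. C x)" using UC F by (intro compactin_Union) auto
  qed (use UC F \<F> in blast)+
qed

text \<open>The value 1 on a whole neighbourhood \<open>W\<close> of \<open>K\<close>, not only on
  \<open>K\<close>, is what \<open>subordinate_split\<close> needs to make a remainder vanish on an
  open set. Complete regularity supplies a function for each point of \<open>K\<close>; finitely
  many of them are added and truncated.\<close>

lemma Urysohn_compact_open:
  assumes K: "compactin X K" and V: "openin X V" "K \<subseteq> V"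
  obtains f W where "subordinate X f V" "openin X W" "K \<subseteq> W" "\<And>x. x \<in> W \<Longrightarrow> f x = 1"
proof -
  obtain U C where UC: "openin X U" "compactin X C" "K \<subseteq> U" "U \<subseteq> C" "C \<subseteq> V"
    using compact_neighbourhood[OF assms] .
  have KX: "K \<subseteq> topspace X" using K by (rule compactin_subset_topspace)
  have "completely_regular_space X"
    using loc_compact Hausdorff locally_compact_Hausdorff_imp_regular_space
      locally_compact_regular_imp_completely_regular_space by blast
  then have "\<forall>S x. openin X S \<longrightarrow> x \<in> S \<longrightarrow>
      (\<exists>g. continuous_map X euclideanreal g \<and> g x = 1 \<and> g ` (topspace X - S) \<subseteq> {0})"
    by (rule completely_regular_space_gen_alt'[THEN iffD1, rotated]) simp
  then have "\<forall>x\<in>K. \<exists>g. continuous_map X euclideanreal g \<and> g x = 1 \<and> g ` (topspace X - U) \<subseteq> {0}"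
    using UC(1,3) by blast
  then obtain g where g: "\<And>x. x \<in> K \<Longrightarrow>
      continuous_map X euclideanreal (g x) \<and> g x x = 1 \<and> g x ` (topspace X - U) \<subseteq> {0}"
    by metis
  let ?N = "\<lambda>x. {y \<in> topspace X. \<bar>g x y\<bar> \<in> {1/2<..}}"
  have opN: "openin X (?N x)" if "x \<in> K" for x
    by (rule openin_continuous_map_preimage[OF continuous_map_real_abs]) (use g[OF that] in auto)
  moreover have "K \<subseteq> \<Union>(?N ` K)" using g KX by fastforce
  ultimately obtain \<F> where \<F>: "finite \<F>" "\<F> \<subseteq> ?N ` K" "K \<subseteq> \<Union>\<F>"
    using compactinD[OF K, of "?N ` K"] by blast
  then obtain F where F: "finite F" "F \<subseteq> K" "\<F> = ?N ` F" by (meson finite_subset_image)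
  \<comment> \<open>The factor 2 matches the threshold 1/2 in \<open>?N\<close>: where one summand
    exceeds 1/2, the truncated sum is 1.\<close>
  define h where "h y = min 1 (2 * (\<Sum>x\<in>F. \<bar>g x y\<bar>))" for y
  have h: "continuous_map X euclideanreal h" unfolding h_def using F g
    by (intro continuous_map_real_min continuous_map_real_mult_left continuous_map_sum
        continuous_map_real_abs) auto
  \<comment> \<open>On the space \<open>h\<close> already vanishes off \<open>U\<close>; the case
    distinction only fixes the value 0 outside the space, where the functions \<open>g x\<close> are
    arbitrary.\<close>
  define f where "f y = (if y \<in> U then h y else 0)" for y
  have "f y = h y" if "y \<in> topspace X" for y
  proof (cases "y \<in> U")
    case False
    then have "\<And>x. x \<in> F \<Longrightarrow> g x y = 0" using F g that by fastforce
    then show ?thesis using False by (simp add: f_def h_def)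
  qed (simp add: f_def)
  then have cont: "continuous_map X euclideanreal f" using h continuous_map_eq by metis
  have f01: "0 \<le> f y \<and> f y \<le> 1" for y by (simp add: f_def h_def sum_nonneg)
  have out: "f y = 0" if "y \<notin> C" for y using that UC by (auto simp: f_def)
  show thesis
  proof (rule that)
    show "subordinate X f V"
      by (rule subordinateI[OF _ f01 UC(2,5) out]) (use Cc_supportI[OF cont UC(2) out] Cc_subset_C0 in auto)
    show "openin X ((\<Union>x\<in>F. ?N x) \<inter> U)" using opN F UC by (intro openin_Int) auto
    show "K \<subseteq> (\<Union>x\<in>F. ?N x) \<inter> U" using \<F> F UC by auto
    fix y assume y: "y \<in> (\<Union>x\<in>F. ?N x) \<inter> U"
    then obtain x where x: "x \<in> F" "1/2 < \<bar>g x y\<bar>" by auto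
    have "\<bar>g x y\<bar> \<le> (\<Sum>x\<in>F. \<bar>g x y\<bar>)" using F x by (intro member_le_sum) auto
    then show "f y = 1" using x y by (auto simp: f_def h_def)
  qed
qed

end

section \<open>Borel sets of an abstract topology\<close>

lemma space_borel_of [simp]: "space (borel_of X) = topspace X"
  and sets_borel_of: "sets (borel_of X) = sigma_sets (topspace X) {U. openin X U}"
proof -
  have "{U. openin X U} \<subseteq> Pow (topspace X)" using openin_subset by blast
  then show "space (borel_of X) = topspace X"
    and "sets (borel_of X) = sigma_sets (topspace X) {U. openin X U}"
    by (simp_all add: borel_of_def space_measure_of sets_measure_of)
qed

lemma borel_of_open [intro]: "openin X U \<Longrightarrow> U \<in> sets (borel_of X)"
  by (simp add: sets_borel_of)

lemma borel_of_closed [intro]: "closedin X C \<Longrightarrow> C \<in> sets (borel_of X)"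
proof -
  assume C: "closedin X C"
  then have "topspace X - (topspace X - C) \<in> sets (borel_of X)"
    by (metis borel_of_open openin_diff openin_topspace sets.compl_sets space_borel_of)
  then show ?thesis using C by (simp add: closedin_def double_diff)
qed

lemma borel_of_subset: "A \<in> sets (borel_of X) \<Longrightarrow> A \<subseteq> topspace X"
  using sets.sets_into_space[of A "borel_of X"] by simp

lemma (in lch_space) borel_of_compact [intro]: "compactin X K \<Longrightarrow> K \<in> sets (borel_of X)"
  using compactin_imp_closedin[OF Hausdorff] by blast

lemma borel_measurable_continuous_map:
  assumes "continuous_map X euclideanreal f"
  shows "f \<in> borel_measurable (borel_of X)"
proof (rule borel_measurableI)
  fix S :: "real set" assume "open S"
  then have "openin X {x \<in> topspace X. f x \<in> S}"
    using assms by (intro openin_continuous_map_preimage) auto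
  moreover have "f -` S \<inter> space (borel_of X) = {x \<in> topspace X. f x \<in> S}" by auto
  ultimately show "f -` S \<inter> space (borel_of X) \<in> sets (borel_of X)" by auto
qed

section \<open>The Riesz representation theorem for bounded functionals\<close>

text \<open>Instantiated twice: with the functionals coming from \<open>\<pi>\<close> and with the
  integral against the measure built from such a functional. \<open>B\<close> controls the unit
  interval and makes that measure finite.\<close>

locale C0_functional = lch_space X for X :: "'x topology" +
  fixes \<Lambda> :: "('x \<Rightarrow> real) \<Rightarrow> real" and B :: real
  assumes positive: "positive_on_C0 X \<Lambda>"
    and bound: "f \<in> C0_functions X \<Longrightarrow> (\<And>x. 0 \<le> f x \<and> f x \<le> 1) \<Longrightarrow> \<Lambda> f \<le> B"
begin

lemma add: "f \<in> C0_functions X \<Longrightarrow> g \<in> C0_functions X \<Longrightarrow> \<Lambda> (\<lambda>x. f x + g x) = \<Lambda> f + \<Lambda> g"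
  and scale: "f \<in> C0_functions X \<Longrightarrow> \<Lambda> (\<lambda>x. r * f x) = r * \<Lambda> f"
  and nonneg: "f \<in> C0_functions X \<Longrightarrow> (\<And>x. 0 \<le> f x) \<Longrightarrow> 0 \<le> \<Lambda> f"
  using positive by (simp_all add: positive_on_C0_def)

lemma zero: "\<Lambda> (\<lambda>x. 0) = 0"
  using scale[of "\<lambda>x. 0" 0] by simp

lemma diff: "f \<in> C0_functions X \<Longrightarrow> g \<in> C0_functions X \<Longrightarrow> \<Lambda> (\<lambda>x. f x - g x) = \<Lambda> f - \<Lambda> g"
  using add[of f "\<lambda>x. -1 * g x"] scale[of g "-1"] C0_scale[of g X "-1"] by simp

lemma sum:
  assumes "\<And>i. i \<in> I \<Longrightarrow> f i \<in> C0_functions X"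
  shows "\<Lambda> (\<lambda>x. \<Sum>i\<in>I. f i x) = (\<Sum>i\<in>I. \<Lambda> (f i))"
  using assms by (induction I rule: infinite_finite_induct) (auto simp: zero add C0_sum)

lemma mono:
  assumes "f \<in> C0_functions X" "g \<in> C0_functions X" "\<And>x. f x \<le> g x"
  shows "\<Lambda> f \<le> \<Lambda> g"
  using nonneg[OF C0_diff[OF assms(2,1)]] diff[OF assms(2,1)] assms(3) by simp

section \<open>Caratheodory construction from the functional\<close>

definition content :: "'x set \<Rightarrow> ennreal" where
  "content V = (SUP f\<in>{f. subordinate X f V}. ennreal (\<Lambda> f))"

text \<open>Infima over open neighbourhoods put outer regularity into the construction; what has to
  be proved is that Borel sets satisfy Caratheodory's condition.\<close>

definition outer :: "'x set \<Rightarrow> ennreal" where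
  "outer A = (INF V\<in>{V. openin X V \<and> A \<subseteq> V}. content V)"

lemma content_upper: "subordinate X f V \<Longrightarrow> ennreal (\<Lambda> f) \<le> content V"
  unfolding content_def by (rule SUP_upper) simp

lemma content_least: "(\<And>f. subordinate X f V \<Longrightarrow> ennreal (\<Lambda> f) \<le> c) \<Longrightarrow> content V \<le> c"
  unfolding content_def by (rule SUP_least) simp

lemma content_mono: "V \<subseteq> W \<Longrightarrow> content V \<le> content W"
  by (rule content_least) (auto intro: content_upper simp: subordinate_def)

lemma content_bound: "content V \<le> ennreal B"
  by (rule content_least) (auto intro!: ennreal_leI bound dest: subordinateD)

lemma content_empty: "content {} = 0"
proof -
  have "\<Lambda> f = 0" if "subordinate X f {}" for f
  proof -
    have "f = (\<lambda>x. 0)" using subordinateD(7)[OF that] by auto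
    then show ?thesis by (simp add: zero)
  qed
  then have "content {} \<le> 0" by (intro content_least) simp
  then show ?thesis by simp
qed

lemma outer_lower: "openin X V \<Longrightarrow> A \<subseteq> V \<Longrightarrow> outer A \<le> content V"
  unfolding outer_def by (rule INF_lower) simp

lemma outer_greatest: "(\<And>V. openin X V \<Longrightarrow> A \<subseteq> V \<Longrightarrow> c \<le> content V) \<Longrightarrow> c \<le> outer A"
  unfolding outer_def by (rule INF_greatest) simp

lemma outer_mono: "A \<subseteq> A' \<Longrightarrow> outer A \<le> outer A'"
  by (rule outer_greatest) (auto intro: outer_lower)

lemma outer_open: "openin X V \<Longrightarrow> outer V = content V"
  by (intro antisym outer_lower outer_greatest content_mono) auto

text \<open>A partition of unity by minima instead of products. The bump function \<open>u\<close>
  is 1 on a neighbourhood \<open>U\<close> of the part of the support outside \<open>W\<close>; as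
  \<open>f \<le> 1\<close>, the remainder \<open>f - min f u\<close> vanishes on \<open>U\<close>,
  and so it vanishes off \<open>?K - U\<close>, a compact subset of \<open>W\<close>.\<close>

lemma subordinate_split:
  assumes f: "subordinate X f (V \<union> W)" and V: "openin X V" and W: "openin X W"
  obtains g h where "subordinate X g V" "subordinate X h W" "f = (\<lambda>x. g x + h x)"
proof -
  let ?K = "fun_support X f"
  note fD = subordinateD[OF f]
  have "compactin X (?K - W)"
  proof (rule closed_compactin[OF fD(5)])
    show "closedin X (?K - W)"
      using compactin_imp_closedin[OF Hausdorff fD(5)] W by (rule closedin_diff)
  qed auto
  moreover have "?K - W \<subseteq> V" using fD(6) by blast
  ultimately obtain u U where u: "subordinate X u V" "openin X U" "?K - W \<subseteq> U" "\<And>x. x \<in> U \<Longrightarrow> u x = 1"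
    using Urysohn_compact_open[OF _ V] by blast
  note uD = subordinateD[OF u(1)]
  have C0: "(\<lambda>x. min (f x) (u x)) \<in> C0_functions X" by (rule C0_min[OF fD(2) uD(2)])
  have "compactin X (?K - U)"
  proof (rule closed_compactin[OF fD(5)])
    show "closedin X (?K - U)"
      using compactin_imp_closedin[OF Hausdorff fD(5)] u(2) by (rule closedin_diff)
  qed auto
  from C0_diff[OF fD(2) C0] _ this have "subordinate X (\<lambda>x. f x - min (f x) (u x)) W"
  proof (rule subordinateI)
    show "0 \<le> f x - min (f x) (u x) \<and> f x - min (f x) (u x) \<le> 1" for x
      using fD(3,4)[of x] uD(3)[of x] by (auto simp: min_def)
    show "?K - U \<subseteq> W" using u(3) by blast
    show "f x - min (f x) (u x) = 0" if "x \<notin> ?K - U" for x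
      using that u(4)[of x] fD(4)[of x] fun_support_outside[OF fD(1), of x] uD(3)[of x]
      by (cases "x \<in> U") (auto simp: min_def)
  qed
  moreover have "subordinate X (\<lambda>x. min (f x) (u x)) V"
  proof (rule subordinateI[OF C0 _ uD(5,6)])
    show "0 \<le> min (f x) (u x) \<and> min (f x) (u x) \<le> 1" for x
      using fD(3,4)[of x] uD(3)[of x] by (auto simp: min_def)
    show "min (f x) (u x) = 0" if "x \<notin> fun_support X u" for x
      using fun_support_outside[OF uD(1) that] fD(3)[of x] by simp
  qed
  ultimately show thesis by (intro that[of "\<lambda>x. min (f x) (u x)" "\<lambda>x. f x - min (f x) (u x)"]) auto
qed

lemma content_Un:
  assumes "openin X V" "openin X W"
  shows "content (V \<union> W) \<le> content V + content W"
proof (rule content_least)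
  fix f assume "subordinate X f (V \<union> W)"
  then obtain g h where gh: "subordinate X g V" "subordinate X h W" "f = (\<lambda>x. g x + h x)"
    using subordinate_split[OF _ assms] by blast
  note g = subordinateD[OF gh(1)] and h = subordinateD[OF gh(2)]
  have "ennreal (\<Lambda> f) = ennreal (\<Lambda> g) + ennreal (\<Lambda> h)"
    unfolding gh(3) add[OF g(2) h(2)] using g h by (intro ennreal_plus nonneg)
  also have "\<dots> \<le> content V + content W" by (intro add_mono content_upper gh)
  finally show "ennreal (\<Lambda> f) \<le> content V + content W" .
qed

lemma content_UN_finite:
  "finite I \<Longrightarrow> (\<And>i. i \<in> I \<Longrightarrow> openin X (V i)) \<Longrightarrow> content (\<Union>i\<in>I. V i) \<le> (\<Sum>i\<in>I. content (V i))"
proof (induction I rule: finite_induct)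
  case (insert i I)
  have "content (\<Union>j\<in>insert i I. V j) = content (V i \<union> (\<Union>j\<in>I. V j))" by simp
  also have "\<dots> \<le> content (V i) + content (\<Union>j\<in>I. V j)" using insert by (intro content_Un) auto
  also have "\<dots> \<le> content (V i) + (\<Sum>j\<in>I. content (V j))" using insert by (intro add_left_mono) auto
  finally show ?case using insert by simp
qed (simp add: content_empty)

text \<open>The compact support of \<open>f\<close> is covered by finitely many members of the
  union, which reduces countable to finite subadditivity.\<close>

lemma content_UN:
  assumes V: "\<And>n::nat. openin X (V n)"
  shows "content (\<Union>n. V n) \<le> (\<Sum>n. content (V n))"
proof (rule content_least)
  fix f assume f: "subordinate X f (\<Union>n. V n)"
  note fD = subordinateD[OF f]
  obtain \<F> where \<F>: "finite \<F>" "\<F> \<subseteq> range V" "fun_support X f \<subseteq> \<Union>\<F>"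
    using compactinD[OF fD(5), of "range V"] V fD(6) by blast
  then obtain I where I: "finite I" "\<F> = V ` I" by (meson finite_subset_image)
  have "subordinate X f (\<Union>n\<in>I. V n)" using f \<F>(3) I by (simp add: subordinate_def)
  then have "ennreal (\<Lambda> f) \<le> content (\<Union>n\<in>I. V n)" by (rule content_upper)
  also have "\<dots> \<le> (\<Sum>n\<in>I. content (V n))" by (intro content_UN_finite I V)
  also have "\<dots> \<le> (\<Sum>n. content (V n))" using I by (intro sum_le_suminf) auto
  finally show "ennreal (\<Lambda> f) \<le> (\<Sum>n. content (V n))" .
qed

lemma outer_less_top: "A \<subseteq> topspace X \<Longrightarrow> outer A < top"
  using outer_lower[of "topspace X" A] content_bound[of "topspace X"]
  by (meson ennreal_less_top le_less_trans openin_topspace order_trans)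

lemma outer_measure_space: "outer_measure_space (Pow (topspace X)) outer"
  unfolding outer_measure_space_def
proof (intro conjI)
  show "positive (Pow (topspace X)) outer"
    using outer_open[of "{}"] by (simp add: positive_def content_empty)
  show "increasing (Pow (topspace X)) outer"
    by (auto simp: increasing_def intro: outer_mono)
  show "countably_subadditive (Pow (topspace X)) outer"
    unfolding countably_subadditive_def
  proof (intro allI impI)
    fix A :: "nat \<Rightarrow> 'x set"
    assume A: "range A \<subseteq> Pow (topspace X)"
    show "outer (\<Union>n. A n) \<le> (\<Sum>n. outer (A n))"
    proof (rule ennreal_le_epsilon)
      fix e :: real assume e: "0 < e"
      \<comment> \<open>The margins \<open>e / 2 ^ (n + 1)\<close> add up to \<open>e\<close>. A
        neighbourhood within the margin exists because \<open>outer (A n)\<close> is finite.\<close>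
      have "\<exists>V. openin X V \<and> A n \<subseteq> V \<and> content V \<le> outer (A n) + ennreal (e * (1/2) ^ Suc n)" for n
      proof -
        have "outer (A n) \<noteq> top" using outer_less_top[of "A n"] A by (force simp: less_top)
        moreover have "0 < e * (1/2) ^ Suc n" using e by simp
        ultimately have "outer (A n) < outer (A n) + ennreal (e * (1/2) ^ Suc n)"
          by (cases "outer (A n)") (simp_all add: ennreal_lessI flip: ennreal_plus)
        then show ?thesis unfolding outer_def[of "A n"] INF_less_iff
          by (auto simp: outer_def intro: less_imp_le)
      qed
      then obtain V where V: "\<And>n. openin X (V n)" "\<And>n. A n \<subseteq> V n"
        "\<And>n. content (V n) \<le> outer (A n) + ennreal (e * (1/2) ^ Suc n)" by metis
      have "outer (\<Union>n. A n) \<le> content (\<Union>n. V n)" using V by (intro outer_lower) auto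
      also have "\<dots> \<le> (\<Sum>n. content (V n))" by (rule content_UN) (rule V)
      also have "\<dots> \<le> (\<Sum>n. outer (A n) + ennreal (e * (1/2) ^ Suc n))"
        by (intro suminf_le V) auto
      also have "\<dots> = (\<Sum>n. outer (A n)) + (\<Sum>n. ennreal (e * (1/2) ^ Suc n))"
        by (rule suminf_add[symmetric]) auto
      also have "(\<Sum>n. ennreal (e * (1/2) ^ Suc n)) = ennreal e"
        using sums_mult[OF power_half_series, of e] e
        by (subst suminf_ennreal2) (auto simp: sums_iff)
      finally show "outer (\<Union>n. A n) \<le> (\<Sum>n. outer (A n)) + ennreal e" .
    qed
  qed
qed

lemma outer_Un:
  assumes "A \<subseteq> topspace X" "A' \<subseteq> topspace X" "A \<inter> A' = {}"
  shows "outer (A \<union> A') \<le> outer A + outer A'"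
proof -
  interpret P: sigma_algebra "topspace X" "Pow (topspace X)" by (rule sigma_algebra_Pow)
  have "subadditive (Pow (topspace X)) outer"
    using outer_measure_space
    by (intro P.countably_subadditive_subadditive) (auto simp: outer_measure_space_def)
  then show ?thesis using assms by (simp add: subadditive_def)
qed

text \<open>Caratheodory's condition is tested on open \<open>U\<close> containing \<open>A\<close>.
  If \<open>f\<close> is subordinate to \<open>U \<inter> V\<close> and \<open>g\<close> to
  \<open>U - fun_support X f\<close>, then \<open>g\<close> vanishes on the support of
  \<open>f\<close>, so \<open>f + g\<close> is still subordinate to \<open>U\<close>. Since
  \<open>U - V\<close> lies in \<open>U - fun_support X f\<close>, suprema over \<open>g\<close> and
  then over \<open>f\<close> give the inequality that subadditivity does not.\<close>

lemma open_in_lambda_system: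
  assumes V: "openin X V"
  shows "V \<in> lambda_system (topspace X) (Pow (topspace X)) outer"
proof -
  have VX: "V \<subseteq> topspace X" using V by (rule openin_subset)
  have "outer (V \<inter> A) + outer ((topspace X - V) \<inter> A) = outer A" if A: "A \<subseteq> topspace X" for A
  proof (rule antisym)
    have "outer ((V \<inter> A) \<union> ((topspace X - V) \<inter> A)) \<le> outer (V \<inter> A) + outer ((topspace X - V) \<inter> A)"
      using A by (intro outer_Un) auto
    also have "(V \<inter> A) \<union> ((topspace X - V) \<inter> A) = A" using A by blast
    finally show "outer A \<le> outer (V \<inter> A) + outer ((topspace X - V) \<inter> A)" .
    show "outer (V \<inter> A) + outer ((topspace X - V) \<inter> A) \<le> outer A"
    proof (rule outer_greatest)
      fix U assume U: "openin X U" "A \<subseteq> U"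
      have le: "ennreal (\<Lambda> f) + outer (U - V) \<le> content U" if f: "subordinate X f (U \<inter> V)" for f
      proof -
        note fD = subordinateD[OF f]
        let ?W = "U - fun_support X f"
        have W: "openin X ?W"
          using compactin_imp_closedin[OF Hausdorff fD(5)] U(1) by (intro openin_diff)
        have "ennreal (\<Lambda> f) + ennreal (\<Lambda> g) \<le> content U" if g: "subordinate X g ?W" for g
        proof -
          note gD = subordinateD[OF g]
          have "subordinate X (\<lambda>x. f x + g x) U"
          proof (rule subordinateI[OF C0_add[OF fD(2) gD(2)]])
            show "compactin X (fun_support X f \<union> fun_support X g)" using fD gD by (intro compactin_Un)
            show "fun_support X f \<union> fun_support X g \<subseteq> U" using fD gD by blast
            show "0 \<le> f x + g x \<and> f x + g x \<le> 1" for x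
              using fD(3,4)[of x] gD(3,4)[of x] gD(7)[of x] fun_support_outside[OF fD(1), of x]
              by (cases "x \<in> fun_support X f") auto
          qed (simp add: fun_support_outside fD(1) gD(1))
          then have "ennreal (\<Lambda> f + \<Lambda> g) \<le> content U"
            using content_upper add[OF fD(2) gD(2)] by metis
          then show ?thesis using fD gD by (subst ennreal_plus[symmetric]) (auto intro: nonneg)
        qed
        then have "(SUP g\<in>{g. subordinate X g ?W}. ennreal (\<Lambda> f) + ennreal (\<Lambda> g)) \<le> content U"
          by (intro SUP_least) simp
        also have "(SUP g\<in>{g. subordinate X g ?W}. ennreal (\<Lambda> f) + ennreal (\<Lambda> g)) = ennreal (\<Lambda> f) + content ?W"
          unfolding content_def[of ?W] using subordinate_zero[of ?W]
          by (intro ennreal_SUP_add_right[symmetric]) auto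
        finally have "ennreal (\<Lambda> f) + content ?W \<le> content U" .
        moreover have "outer (U - V) \<le> content ?W" using W fD(6) by (intro outer_lower) auto
        ultimately show ?thesis by (meson add_left_mono order_trans)
      qed
      have "outer (V \<inter> A) + outer ((topspace X - V) \<inter> A) \<le> content (U \<inter> V) + outer (U - V)"
        using U V by (intro add_mono outer_lower outer_mono) auto
      also have "\<dots> = (SUP f\<in>{f. subordinate X f (U \<inter> V)}. ennreal (\<Lambda> f) + outer (U - V))"
        unfolding content_def[of "U \<inter> V"] using subordinate_zero[of "U \<inter> V"]
        by (intro ennreal_SUP_add_left[symmetric]) auto
      also have "\<dots> \<le> content U"
        by (intro SUP_least) (simp add: le)
      finally show "outer (V \<inter> A) + outer ((topspace X - V) \<inter> A) \<le> content U" .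
    qed
  qed
  then show ?thesis using VX by (simp add: lambda_system_def)
qed

definition riesz_measure :: "'x measure" where
  "riesz_measure = measure_of (topspace X) (sets (borel_of X)) outer"

lemma sets_riesz [simp]: "sets riesz_measure = sets (borel_of X)"
  and space_riesz [simp]: "space riesz_measure = topspace X"
  using sets.space_closed[of "borel_of X"] sets.sigma_sets_eq[of "borel_of X"]
  by (simp_all add: riesz_measure_def space_measure_of_conv sets_measure_of_conv)

text \<open>\<open>measure_of\<close> reproduces \<open>outer\<close> once countable additivity on
  the Borel sets is known; it holds on Caratheodory's sigma-algebra, which contains the open sets
  and hence all Borel sets.\<close>

lemma emeasure_riesz:
  assumes "A \<in> sets (borel_of X)"
  shows "emeasure riesz_measure A = outer A"
proof -
  let ?L = "lambda_system (topspace X) (Pow (topspace X)) outer"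
  interpret P: sigma_algebra "topspace X" "Pow (topspace X)" by (rule sigma_algebra_Pow)
  have L: "measure_space (topspace X) ?L outer"
    by (rule P.caratheodory_lemma) (rule outer_measure_space)
  have "sigma_sets (topspace X) {U. openin X U} \<subseteq> ?L"
    using L open_in_lambda_system
    by (intro sigma_algebra.sigma_sets_subset) (auto simp: measure_space_def)
  then have sub: "sets (borel_of X) \<subseteq> ?L" by (simp add: sets_borel_of)
  show ?thesis
  proof (rule emeasure_measure_of[OF riesz_measure_def])
    show "positive (sets riesz_measure) outer"
      using L sub by (auto simp: measure_space_def positive_def)
    show "countably_additive (sets riesz_measure) outer"
      using L sub unfolding measure_space_def countably_additive_def by (simp add: subset_eq)
  qed (use assms sets.space_closed[of "borel_of X"] in auto)
qed

lemma finite_riesz: "finite_measure riesz_measure"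
  using outer_less_top[of "topspace X"] sets.top[of "borel_of X"]
  by (intro finite_measureI) (simp add: emeasure_riesz)

lemma emeasure_riesz_open:
  "openin X V \<Longrightarrow> emeasure riesz_measure V = (SUP f\<in>{f. subordinate X f V}. ennreal (\<Lambda> f))"
  by (simp add: emeasure_riesz borel_of_open outer_open content_def)

lemma emeasure_riesz_outer:
  assumes "A \<in> sets (borel_of X)"
  shows "emeasure riesz_measure A = (INF V\<in>{V. openin X V \<and> A \<subseteq> V}. emeasure riesz_measure V)"
  using assms by (simp add: emeasure_riesz borel_of_open outer_open outer_def[of A] cong: INF_cong_simp)

text \<open>\<open>K\<close> need not have an open neighbourhood on which \<open>f = 1\<close>, so
  the open sets \<open>{f > a}\<close> with \<open>a < 1\<close> are used: every \<open>g\<close>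
  subordinate to such a set satisfies \<open>a * g \<le> f\<close>. Letting \<open>a\<close> tend to
  1 removes the factor.\<close>

lemma outer_le_functional:
  assumes f: "f \<in> C0_functions X" "\<And>x. 0 \<le> f x \<and> f x \<le> 1" and K: "K \<subseteq> topspace X" "\<And>x. x \<in> K \<Longrightarrow> f x = 1"
  shows "outer K \<le> ennreal (\<Lambda> f)"
proof -
  have le: "outer K \<le> ennreal (\<Lambda> f / a)" if a: "0 < a" "a < 1" for a
  proof -
    let ?V = "{x \<in> topspace X. f x \<in> {a<..}}"
    have "outer K \<le> content ?V"
      by (rule outer_lower, rule openin_continuous_map_preimage[OF C0_continuous[OF f(1)]]) (use K a in auto)
    also have "\<dots> \<le> ennreal (\<Lambda> f / a)"
    proof (rule content_least)
      fix g assume g: "subordinate X g ?V"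
      note gD = subordinateD[OF g]
      have "a * g x \<le> f x" for x
      proof (cases "x \<in> ?V")
        case True
        then have "a * g x \<le> a * 1" using gD(4)[of x] a by (intro mult_left_mono) auto
        then show ?thesis using True by auto
      next
        case False then show ?thesis using gD(7)[OF False] f(2)[of x] by simp
      qed
      then have "a * \<Lambda> g \<le> \<Lambda> f"
        using mono[OF C0_scale[OF gD(2)] f(1), of a] scale[OF gD(2), of a] by simp
      then show "ennreal (\<Lambda> g) \<le> ennreal (\<Lambda> f / a)" using a by (intro ennreal_leI) (simp add: field_simps)
    qed
    finally show ?thesis .
  qed
  have "((\<lambda>a. ennreal (\<Lambda> f / a)) \<longlongrightarrow> ennreal (\<Lambda> f / 1)) (at_left 1)"
    by (intro tendsto_intros) auto
  moreover have "\<forall>\<^sub>F a::real in at_left 1. outer K \<le> ennreal (\<Lambda> f / a)"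
    by (rule eventually_mono[OF eventually_at_left_real[of 0 1]]) (use le in auto)
  ultimately have "outer K \<le> ennreal (\<Lambda> f / 1)" by (rule tendsto_lowerbound) simp
  then show ?thesis by simp
qed

lemma functional_le_outer:
  assumes f: "f \<in> C0_functions X" "\<And>x. 0 \<le> f x \<and> f x \<le> 1" and K: "compactin X K" "\<And>x. x \<notin> K \<Longrightarrow> f x = 0"
  shows "ennreal (\<Lambda> f) \<le> outer K"
  by (rule outer_greatest, rule content_upper, rule subordinateI[OF f K(1) _ K(2)])

end

definition layer :: "nat \<Rightarrow> real \<Rightarrow> real" where
  "layer k y = min (max (y - real k) 0) 1"

lemma sum_layer: "0 \<le> y \<Longrightarrow> (\<Sum>k<n. layer k y) = min (real n) y"
  by (induction n) (auto simp: layer_def)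

text \<open>If \<open>0 \<le> f \<le> 1\<close> then \<open>n f\<close> is the sum of the layers \<open>h\<^sub>k = layer k (n f)\<close>, \<open>k < n\<close>. Here \<open>h\<^sub>k = 1\<close> on
  \<open>{f \<ge> (k + 1) / n}\<close>, off which \<open>h\<^sub>k\<^sub>+\<^sub>1 = 0\<close>, so that \<open>\<Lambda> h\<^sub>k\<^sub>+\<^sub>1 \<le> \<Lambda>' h\<^sub>k\<close> and \<open>\<Lambda> f \<le> \<Lambda>' f + B / n\<close>.\<close>

lemma layer_cake_le:
  assumes "C0_functional X \<Lambda> B" "C0_functional X \<Lambda>' B'"
    and le: "\<And>K f g. compactin X K \<Longrightarrow> f \<in> C0_functions X \<Longrightarrow> g \<in> C0_functions X \<Longrightarrow>
      (\<And>x. 0 \<le> f x \<and> f x \<le> 1) \<Longrightarrow> (\<And>x. 0 \<le> g x \<and> g x \<le> 1) \<Longrightarrow>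
      (\<And>x. x \<notin> K \<Longrightarrow> f x = 0) \<Longrightarrow> (\<And>x. x \<in> K \<Longrightarrow> g x = 1) \<Longrightarrow> \<Lambda> f \<le> \<Lambda>' g"
    and f: "f \<in> C0_functions X" "\<And>x. 0 \<le> f x"
  shows "\<Lambda> f \<le> \<Lambda>' f"
proof -
  interpret L: C0_functional X \<Lambda> B by fact
  interpret L': C0_functional X \<Lambda>' B' by fact
  have main: "\<Lambda> f \<le> \<Lambda>' f" if f: "f \<in> C0_functions X" "\<And>x. 0 \<le> f x \<and> f x \<le> 1" for f
  proof -
    have step: "\<Lambda> f \<le> \<Lambda>' f + B / real (Suc n)" for n
    proof -
      let ?N = "real (Suc n)"
      define h where "h k x = layer k (?N * f x)" for k x
      have h: "h k \<in> C0_functions X" for k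
      \<comment> \<open>The domination lemma takes two functions; \<open>f\<close> serves as both,
        since a layer never exceeds its nonnegative argument.\<close>
      proof (rule C0_dominated[OF f(1) f(1), where c = ?N])
        show "continuous_map X euclideanreal (h k)" unfolding h_def layer_def
          by (intro continuous_map_real_min continuous_map_real_max continuous_map_diff
              continuous_map_real_mult_left C0_continuous[OF f(1)]) auto
        fix x
        have "0 \<le> ?N * f x" using f(2)[of x] by (intro mult_nonneg_nonneg) auto
        moreover have "\<bar>layer k y\<bar> \<le> y + y" if "0 \<le> y" for y
          using that by (auto simp: layer_def min_def max_def)
        ultimately show "\<bar>h k x\<bar> \<le> ?N * (\<bar>f x\<bar> + \<bar>f x\<bar>)" using f(2)[of x]
          unfolding h_def by (simp only: abs_of_nonneg distrib_left)
      qed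
      have h01: "0 \<le> h k x \<and> h k x \<le> 1" for k x by (simp add: h_def layer_def)
      have eq: "(\<Sum>k<Suc n. h k x) = ?N * f x" for x
      proof -
        have "?N * f x \<le> ?N * 1" using f(2)[of x] by (intro mult_left_mono) auto
        then show ?thesis unfolding h_def using f(2)[of x] by (subst sum_layer) auto
      qed
      have NL: "?N * \<Lambda> f = (\<Sum>k<Suc n. \<Lambda> (h k))"
        using L.sum[of "{..<Suc n}" h] h L.scale[OF f(1)] eq by simp
      have NL': "?N * \<Lambda>' f = (\<Sum>k<Suc n. \<Lambda>' (h k))"
        using L'.sum[of "{..<Suc n}" h] h L'.scale[OF f(1)] eq by simp
      have hh: "\<Lambda> (h (Suc k)) \<le> \<Lambda>' (h k)" for k
      proof (rule le[OF _ h h h01 h01])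
        let ?K = "{x \<in> topspace X. real (Suc k) / ?N \<le> \<bar>f x\<bar>}"
        show "compactin X ?K" using f(1) by (simp add: C0_iff)
        show "h (Suc k) x = 0" if "x \<notin> ?K" for x
        proof (cases "x \<in> topspace X")
          case True
          then have "?N * f x < real (Suc k)" using that f(2)[of x] by (auto simp: field_simps)
          then show ?thesis by (simp add: h_def layer_def)
        qed (use C0_outside[OF h] in auto)
        show "h k x = 1" if "x \<in> ?K" for x
        proof -
          have "real (Suc k) \<le> ?N * f x" using that f(2)[of x] by (auto simp: field_simps)
          then show ?thesis by (simp add: h_def layer_def)
        qed
      qed
      \<comment> \<open>\<open>h 0\<close> has no predecessor and is estimated by \<open>B\<close>;
        the missing top term \<open>\<Lambda>' (h n)\<close> is added by nonnegativity. Dividing by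
        \<open>?N\<close> leaves an error that tends to zero.\<close>
      have "?N * \<Lambda> f = \<Lambda> (h 0) + (\<Sum>k<n. \<Lambda> (h (Suc k)))"
        unfolding NL by (rule sum.lessThan_Suc_shift)
      also have "\<dots> \<le> B + (\<Sum>k<n. \<Lambda>' (h k))"
        by (intro add_mono sum_mono hh L.bound h h01)
      also have "\<dots> \<le> B + (\<Sum>k<Suc n. \<Lambda>' (h k))"
        using L'.nonneg[OF h] h01 by simp
      also have "\<dots> = B + ?N * \<Lambda>' f" by (simp only: NL')
      finally show ?thesis by (simp add: field_simps del: of_nat_Suc)
    qed
    have "(\<lambda>n. \<Lambda>' f + B * inverse (real (Suc n))) \<longlonglongrightarrow> \<Lambda>' f + B * 0"
      by (intro tendsto_intros LIMSEQ_inverse_real_of_nat)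
    then show ?thesis
      by (intro LIMSEQ_le_const[of _ "\<Lambda>' f"]) (use step in \<open>auto simp: divide_inverse\<close>)
  qed
  \<comment> \<open>The layers were counted for functions bounded by 1; boundedness of
    \<open>f\<close> and homogeneity give the general case.\<close>
  obtain c where c: "c > 0" "\<And>x. \<bar>f x\<bar> \<le> c" using C0_bounded[OF f(1)] by blast
  have "\<Lambda> (\<lambda>x. inverse c * f x) \<le> \<Lambda>' (\<lambda>x. inverse c * f x)"
    by (rule main[OF C0_scale[OF f(1)]]) (use c f(2) in \<open>auto simp: field_simps abs_le_iff\<close>)
  then show ?thesis using c(1) by (simp add: L.scale[OF f(1)] L'.scale[OF f(1)])
qed

section \<open>The functional as an integral\<close>

context C0_functional
begin

lemma integrable_riesz: "f \<in> C0_functions X \<Longrightarrow> integrable riesz_measure f"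
proof -
  assume f: "f \<in> C0_functions X"
  interpret finite_measure riesz_measure by (rule finite_riesz)
  obtain c where "c > 0" "\<And>x. \<bar>f x\<bar> \<le> c" using C0_bounded[OF f] by blast
  moreover have "f \<in> borel_measurable riesz_measure"
    using borel_measurable_continuous_map[OF C0_continuous[OF f]]
    by (simp cong: measurable_cong_sets)
  ultimately show ?thesis by (intro integrable_const_bound[of _ c]) auto
qed

text \<open>With this instance the comparison \<open>layer_cake_le\<close> can be applied in both
  directions between the integral and \<open>\<Lambda>\<close>.\<close>

lemma C0_functional_riesz:
  "C0_functional X (integral\<^sup>L riesz_measure) (measure riesz_measure (topspace X))"
proof
  show "positive_on_C0 X (integral\<^sup>L riesz_measure)"
    by (auto simp: positive_on_C0_def integrable_riesz intro!: integral_nonneg_AE AE_I2)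
  fix f assume f: "f \<in> C0_functions X" "\<And>x. 0 \<le> f x \<and> f x \<le> 1"
  interpret finite_measure riesz_measure by (rule finite_riesz)
  have "(\<integral>x. f x \<partial>riesz_measure) \<le> (\<integral>x. 1 \<partial>riesz_measure)"
    using f by (intro integral_mono integrable_riesz[OF f(1)]) auto
  then show "(\<integral>x. f x \<partial>riesz_measure) \<le> measure riesz_measure (topspace X)" by simp
qed

lemma integral_le_measure:
  assumes f: "f \<in> C0_functions X" "\<And>x. f x \<le> 1" and K: "K \<in> sets (borel_of X)" "\<And>x. x \<notin> K \<Longrightarrow> f x = 0"
  shows "(\<integral>x. f x \<partial>riesz_measure) \<le> measure riesz_measure K"
proof -
  interpret finite_measure riesz_measure by (rule finite_riesz)
  have "(\<integral>x. f x \<partial>riesz_measure) \<le> (\<integral>x. indicator K x \<partial>riesz_measure)"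
    using assms by (intro integral_mono integrable_riesz[OF f(1)] integrable_real_indicator)
      (auto split: split_indicator simp: emeasure_eq_measure)
  then show ?thesis using K borel_of_subset[OF K(1)] by (simp add: Int_absorb2)
qed

lemma measure_le_integral:
  assumes f: "f \<in> C0_functions X" "\<And>x. 0 \<le> f x" and K: "K \<in> sets (borel_of X)" "\<And>x. x \<in> K \<Longrightarrow> f x = 1"
  shows "measure riesz_measure K \<le> (\<integral>x. f x \<partial>riesz_measure)"
proof -
  interpret finite_measure riesz_measure by (rule finite_riesz)
  have "(\<integral>x. indicator K x \<partial>riesz_measure) \<le> (\<integral>x. f x \<partial>riesz_measure)"
    using assms by (intro integral_mono integrable_riesz[OF f(1)] integrable_real_indicator)
      (auto split: split_indicator simp: emeasure_eq_measure)
  then show ?thesis using K borel_of_subset[OF K(1)] by (simp add: Int_absorb2)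
qed

text \<open>If \<open>f\<close> vanishes off a compact set \<open>K\<close> and \<open>g\<close> is
  1 on it, the measure of \<open>K\<close> lies between the value of either functional at
  \<open>f\<close> and the value of the other one at \<open>g\<close>. This is the hypothesis of the
  layer comparison, whence equality on nonnegative functions.\<close>

lemma integral_riesz:
  assumes f: "f \<in> C0_functions X"
  shows "(\<integral>x. f x \<partial>riesz_measure) = \<Lambda> f"
proof -
  let ?I = "integral\<^sup>L riesz_measure"
  interpret finite_measure riesz_measure by (rule finite_riesz)
  interpret I: C0_functional X ?I "measure riesz_measure (topspace X)" by (rule C0_functional_riesz)
  have outer: "ennreal (measure riesz_measure K) = outer K" if "compactin X K" for K
    using emeasure_riesz[of K] that by (simp add: emeasure_eq_measure borel_of_compact)
  have pos: "?I f = \<Lambda> f" if f: "f \<in> C0_functions X" "\<And>x. 0 \<le> f x" for f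
  proof (rule antisym)
    show "?I f \<le> \<Lambda> f"
    proof (rule layer_cake_le[OF C0_functional_riesz C0_functional_axioms _ f])
      fix K f g
      assume *: "compactin X K" "f \<in> C0_functions X" "g \<in> C0_functions X"
        "\<And>x. 0 \<le> f x \<and> f x \<le> 1" "\<And>x. 0 \<le> g x \<and> g x \<le> 1"
        "\<And>x. x \<notin> K \<Longrightarrow> f x = 0" "\<And>x. x \<in> K \<Longrightarrow> g x = 1"
      have "?I f \<le> measure riesz_measure K" using * by (intro integral_le_measure) auto
      also have "ennreal \<dots> \<le> ennreal (\<Lambda> g)" unfolding outer[OF *(1)]
        by (rule outer_le_functional) (use * compactin_subset_topspace[OF *(1)] in auto)
      then have "measure riesz_measure K \<le> \<Lambda> g" using nonneg[OF *(3)] *(5) by simp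
      finally show "?I f \<le> \<Lambda> g" .
    qed
    show "\<Lambda> f \<le> ?I f"
    proof (rule layer_cake_le[OF C0_functional_axioms C0_functional_riesz _ f])
      fix K f g
      assume *: "compactin X K" "f \<in> C0_functions X" "g \<in> C0_functions X"
        "\<And>x. 0 \<le> f x \<and> f x \<le> 1" "\<And>x. 0 \<le> g x \<and> g x \<le> 1"
        "\<And>x. x \<notin> K \<Longrightarrow> f x = 0" "\<And>x. x \<in> K \<Longrightarrow> g x = 1"
      have "ennreal (\<Lambda> f) \<le> ennreal (measure riesz_measure K)" unfolding outer[OF *(1)]
        by (rule functional_le_outer) (use * in auto)
      then have "\<Lambda> f \<le> measure riesz_measure K" by simp
      also have "\<dots> \<le> ?I g" using * by (intro measure_le_integral) auto
      finally show "\<Lambda> f \<le> ?I g" .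
    qed
  qed
  have f1: "(\<lambda>x. max (f x) 0) \<in> C0_functions X" and f2: "(\<lambda>x. max (f x) 0 - f x) \<in> C0_functions X"
    using C0_max[OF f C0_zero] C0_diff[OF C0_max[OF f C0_zero] f] by simp_all
  have "?I f = ?I (\<lambda>x. max (f x) 0) - ?I (\<lambda>x. max (f x) 0 - f x)"
    using I.diff[OF f1 f2] by simp
  also have "\<dots> = \<Lambda> (\<lambda>x. max (f x) 0) - \<Lambda> (\<lambda>x. max (f x) 0 - f x)"
    by (simp add: pos f1 f2)
  also have "\<dots> = \<Lambda> f" using diff[OF f1 f2] by simp
  finally show ?thesis .
qed

end

section \<open>The order integral of an operator measure\<close>

lemma le_Infty [simp]: "a \<le> Infty"
  by (cases a) auto

lemma le_Fin_iff: "a \<le> Fin b \<longleftrightarrow> (\<exists>c. a = Fin c \<and> c \<le> b)"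
  by (cases a) auto

lemma sum_Fin: "(\<Sum>i\<in>I. Fin (a i)) = Fin (\<Sum>i\<in>I. a i)"
  by (induction I rule: infinite_finite_induct) (auto simp: zero_extd_def)

lemma is_finite_iff: "is_finite a \<longleftrightarrow> (\<exists>T. a = Fin T)"
  by (cases a) (auto simp: is_finite_def)

lemma Fin_finite_part: "is_finite a \<Longrightarrow> Fin (finite_part a) = a"
  by (auto simp: is_finite_iff)

lemma isLub_UNIV_iff:
  "isLub UNIV A (a::'a::order) \<longleftrightarrow> (\<forall>y\<in>A. y \<le> a) \<and> (\<forall>b. (\<forall>y\<in>A. y \<le> b) \<longrightarrow> a \<le> b)"
  by (auto simp: isLub_def leastP_def isUb_def setle_def setge_def)

lemma isGlb_UNIV_iff:
  "isGlb UNIV A (a::'a::order) \<longleftrightarrow> (\<forall>y\<in>A. a \<le> y) \<and> (\<forall>b. (\<forall>y\<in>A. b \<le> y) \<longrightarrow> b \<le> a)"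
  by (auto simp: isGlb_def greatestP_def isLb_def setle_def setge_def)

lemma isLub_unique_order: "isLub UNIV A a \<Longrightarrow> isLub UNIV A b \<Longrightarrow> a = (b::'a::order)"
  by (meson antisym isLub_isUb isLub_le_isUb)

text \<open>\<open>Infty\<close> is an additional upper bound, but it lies above everything and
  cannot compete with a finite least one.\<close>

lemma isLub_Fin_iff:
  fixes a :: "'a::order"
  shows "isLub UNIV (Fin ` A) (Fin a) \<longleftrightarrow> isLub UNIV A a"
proof
  assume L: "isLub UNIV (Fin ` A) (Fin a)"
  show "isLub UNIV A a" unfolding isLub_UNIV_iff
  proof (intro conjI allI impI)
    show "\<forall>y\<in>A. y \<le> a" using L by (auto simp: isLub_UNIV_iff)
    fix b assume "\<forall>y\<in>A. y \<le> b"
    then have "Fin a \<le> Fin b" using L unfolding isLub_UNIV_iff by (auto elim: allE[of _ "Fin b"])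
    then show "a \<le> b" by simp
  qed
next
  assume L: "isLub UNIV A a"
  show "isLub UNIV (Fin ` A) (Fin a)" unfolding isLub_UNIV_iff
  proof (intro conjI allI impI)
    fix b assume "\<forall>y\<in>Fin ` A. y \<le> b"
    then show "Fin a \<le> b" using L by (cases b) (auto simp: isLub_UNIV_iff)
  qed (use L in \<open>auto simp: isLub_UNIV_iff\<close>)
qed

text \<open>Nonemptiness matters: \<open>Infty\<close> is a lower bound of the empty set in the
  extended space, and a member of \<open>A\<close> excludes it.\<close>

lemma isGlb_Fin_iff:
  fixes a :: "'a::order"
  assumes "A \<noteq> {}"
  shows "isGlb UNIV (Fin ` A) (Fin a) \<longleftrightarrow> isGlb UNIV A a"
proof
  assume L: "isGlb UNIV (Fin ` A) (Fin a)"
  show "isGlb UNIV A a" unfolding isGlb_UNIV_iff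
  proof (intro conjI allI impI)
    show "\<forall>y\<in>A. a \<le> y" using L by (auto simp: isGlb_UNIV_iff)
    fix b assume "\<forall>y\<in>A. b \<le> y"
    then have "Fin b \<le> Fin a" using L unfolding isGlb_UNIV_iff by (auto elim: allE[of _ "Fin b"])
    then show "b \<le> a" by simp
  qed
next
  assume L: "isGlb UNIV A a"
  show "isGlb UNIV (Fin ` A) (Fin a)" unfolding isGlb_UNIV_iff
  proof (intro conjI allI impI)
    fix b assume "\<forall>y\<in>Fin ` A. b \<le> y"
    then show "b \<le> Fin a" using L assms by (cases b) (auto simp: isGlb_UNIV_iff)
  qed (use L in \<open>auto simp: isGlb_UNIV_iff\<close>)
qed

lemma increasing_regop_seq:
  fixes S :: "nat \<Rightarrow> ('a::banach_lattice, 'e::kb_space) regop"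
  assumes "incseq S" "\<And>n. 0 \<le> S n" "\<And>n. S n \<le> U"
  obtains T where "isLub UNIV (range S) T" "\<And>x. (\<lambda>n. regop_apply (S n) x) \<longlonglongrightarrow> regop_apply T x"
proof (rule increasing_regop_net[OF directed_nat, of S])
  show "S i \<le> S j" if "i \<le> j" for i j using assms(1) that by (rule incseqD)
  show "\<exists>c. \<forall>i\<in>UNIV. norm (regop_apply (S i) x) \<le> c" if "0 \<le> x" for x
    using assms(2,3) that
    by (intro exI[of _ "norm (regop_apply U x)"])
      (auto simp: less_eq_regop.rep_eq intro!: norm_mono_nonneg)
qed (use assms that in \<open>auto simp: net_filter_nat\<close>)

text \<open>Turns an order statement into a topological one: the net converges strongly to some
  least upper bound, and least upper bounds are unique. \<open>S\<close> itself provides the norm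
  bounds.\<close>

lemma increasing_regop_net_lub:
  fixes T :: "'i \<Rightarrow> ('a::banach_lattice, 'e::kb_space) regop"
  assumes dir: "directed I le"
    and mono: "\<And>i j. i \<in> I \<Longrightarrow> j \<in> I \<Longrightarrow> le i j \<Longrightarrow> T i \<le> T j"
    and pos: "\<And>i. i \<in> I \<Longrightarrow> 0 \<le> T i"
    and S: "isLub UNIV (T ` I) S"
  shows "((\<lambda>i. regop_apply (T i) x) \<longlongrightarrow> regop_apply S x) (net_filter I le)"
proof -
  have le: "\<And>i. i \<in> I \<Longrightarrow> T i \<le> S" using S by (simp add: isLub_UNIV_iff)
  have bdd: "\<exists>c. \<forall>i\<in>I. norm (regop_apply (T i) x) \<le> c" if "0 \<le> x" for x
    using pos le that
    by (intro exI[of _ "norm (regop_apply S x)"])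
      (auto simp: less_eq_regop.rep_eq intro!: norm_mono_nonneg)
  show ?thesis
  proof (rule increasing_regop_net[OF dir, where T = T])
    fix S' assume "isLub UNIV (T ` I) S'"
      and "\<And>x. ((\<lambda>i. regop_apply (T i) x) \<longlongrightarrow> regop_apply S' x) (net_filter I le)"
    then show ?thesis using isLub_unique_order[OF S] by simp
  qed (use mono pos bdd in auto)
qed

lemma increasing_regop_seq_lub:
  fixes S :: "nat \<Rightarrow> ('a::banach_lattice, 'e::kb_space) regop"
  assumes S: "incseq S" "\<And>n. 0 \<le> S n" and T: "isLub UNIV (range S) T"
  shows "(\<lambda>n. regop_apply (S n) x) \<longlonglongrightarrow> regop_apply T x"
  using increasing_regop_net_lub[OF directed_nat incseqD[OF S(1)] S(2) T]
  by (simp add: net_filter_nat)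

text \<open>Covers both the representing measure and, in the uniqueness proof, a competing measure
  cut down to a compact set.\<close>

locale finite_operator_measure =
  fixes X :: "'x topology" and \<mu> :: "'x set \<Rightarrow> ('e::kb_space, 'e) regop extd"
  assumes order_measure: "order_measure (borel_of X) \<mu>"
    and finite: "\<Delta> \<in> sets (borel_of X) \<Longrightarrow> is_finite (\<mu> \<Delta>)"
begin

definition op :: "'x set \<Rightarrow> ('e, 'e) regop" where
  "op \<Delta> = finite_part (\<mu> \<Delta>)"

abbreviation scalar :: "'e \<Rightarrow> ('e, real) regop \<Rightarrow> 'x measure" where
  "scalar \<equiv> pairing_measure X \<mu>"

abbreviation pair :: "('e, real) regop \<Rightarrow> ('e, 'e) regop \<Rightarrow> 'e \<Rightarrow> real" where
  "pair x' T x \<equiv> regop_apply x' (regop_apply T x)"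

lemma pairing_eq: "pairing \<mu> x x' \<Delta> = pair x' (op \<Delta>) x"
  by (simp add: pairing_def op_def)

lemma pair_nonneg: "0 \<le> x \<Longrightarrow> 0 \<le> x' \<Longrightarrow> 0 \<le> T \<Longrightarrow> 0 \<le> pair x' T x"
  by (intro regop_apply_nonneg)

lemma pair_mono: "0 \<le> x \<Longrightarrow> 0 \<le> x' \<Longrightarrow> S \<le> T \<Longrightarrow> pair x' S x \<le> pair x' T x"
  by (rule regop_scalar_mono)

lemma Fin_op: "\<Delta> \<in> sets (borel_of X) \<Longrightarrow> \<mu> \<Delta> = Fin (op \<Delta>)"
  by (simp add: op_def Fin_finite_part finite)

lemma op_nonneg: "\<Delta> \<in> sets (borel_of X) \<Longrightarrow> 0 \<le> op \<Delta>"
  using order_measure Fin_op[of \<Delta>] by (force simp: order_measure_def zero_extd_def)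

lemma op_empty: "op {} = 0"
  using order_measure by (simp add: order_measure_def op_def zero_extd_def)

text \<open>Partial sums of positive operators increase, so the order supremum in the definition of
  a measure is a strong limit. Here order sigma-additivity becomes norm convergence at each
  vector.\<close>

lemma op_sums:
  assumes A: "range A \<subseteq> sets (borel_of X)" "disjoint_family (A :: nat \<Rightarrow> 'x set)"
  shows "(\<lambda>n. regop_apply (op (A n)) x) sums regop_apply (op (\<Union>n. A n)) x"
proof -
  let ?S = "\<lambda>N. \<Sum>n\<le>N. op (A n)"
  have An: "A n \<in> sets (borel_of X)" for n using A by blast
  have "isLub UNIV (range (\<lambda>N. \<Sum>n\<le>N. \<mu> (A n))) (\<mu> (\<Union>n. A n))"
    using order_measure A by (simp add: order_measure_def)
  moreover have "range (\<lambda>N. \<Sum>n\<le>N. \<mu> (A n)) = Fin ` range ?S"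
    by (auto simp: Fin_op[OF An] sum_Fin image_image)
  moreover have "(\<Union>n. A n) \<in> sets (borel_of X)" using An by blast
  ultimately have L: "isLub UNIV (range ?S) (op (\<Union>n. A n))"
    by (simp add: Fin_op isLub_Fin_iff)
  have "(\<lambda>N. regop_apply (?S N) x) \<longlonglongrightarrow> regop_apply (op (\<Union>n. A n)) x"
    by (rule increasing_regop_seq_lub[OF _ _ L])
      (auto intro!: incseq_SucI sum_nonneg op_nonneg An)
  then show ?thesis by (simp add: sums_def_le regop_apply_sum_left)
qed

lemma space_scalar [simp]: "space (scalar x x') = topspace X"
  and sets_scalar [simp, measurable_cong]: "sets (scalar x x') = sets (borel_of X)"
  using sets.space_closed[of "borel_of X"] sets.sigma_sets_eq[of "borel_of X"]
  by (simp_all add: pairing_measure_def space_measure_of_conv sets_measure_of_conv)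

text \<open>Countable additivity of the pairing comes from \<open>op_sums\<close> and the norm
  continuity of \<open>x'\<close>; with it \<open>measure_of\<close> returns the intended
  values.\<close>

lemma emeasure_scalar:
  assumes "0 \<le> x" "0 \<le> x'" "\<Delta> \<in> sets (borel_of X)"
  shows "emeasure (scalar x x') \<Delta> = ennreal (pair x' (op \<Delta>) x)"
  unfolding pairing_eq[symmetric]
proof (rule emeasure_measure_of[OF pairing_measure_def])
  show "positive (sets (scalar x x')) (\<lambda>\<Delta>. ennreal (pairing \<mu> x x' \<Delta>))"
    by (simp add: positive_def pairing_eq op_empty)
  show "countably_additive (sets (scalar x x')) (\<lambda>\<Delta>. ennreal (pairing \<mu> x x' \<Delta>))"
    unfolding countably_additive_def
  proof (intro allI impI)
    fix A :: "nat \<Rightarrow> 'x set"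
    assume A: "range A \<subseteq> sets (scalar x x')" "disjoint_family A"
    have "(\<lambda>n. pair x' (op (A n)) x) sums pair x' (op (\<Union>n. A n)) x"
      using A by (intro bounded_linear.sums[OF bounded_linear_regop] op_sums) auto
    moreover have "0 \<le> pair x' (op (A n)) x" for n
      using A assms by (intro pair_nonneg op_nonneg) auto
    ultimately show "(\<Sum>n. ennreal (pairing \<mu> x x' (A n))) = ennreal (pairing \<mu> x x' (\<Union>n. A n))"
      by (simp add: pairing_eq suminf_ennreal2 sums_iff)
  qed
qed (use assms sets.space_closed[of "borel_of X"] in auto)

lemma finite_scalar: "0 \<le> x \<Longrightarrow> 0 \<le> x' \<Longrightarrow> finite_measure (scalar x x')"
  using sets.top[of "borel_of X"] by (intro finite_measureI) (simp add: emeasure_scalar)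

definition elementary :: "('x \<Rightarrow> real) \<Rightarrow> ('e, 'e) regop" where
  "elementary \<phi> = (\<Sum>r\<in>\<phi> ` topspace X. r *\<^sub>R op (\<phi> -` {r} \<inter> topspace X))"

lemma level_sets:
  assumes "simple_function (borel_of X) \<phi>"
  shows "\<phi> -` {r} \<inter> topspace X \<in> sets (borel_of X)"
proof (cases "r \<in> \<phi> ` topspace X")
  case False
  then have "\<phi> -` {r} \<inter> topspace X = {}" by auto
  then show ?thesis by simp
qed (use assms in \<open>auto simp: simple_function_def\<close>)

lemma elementary_integral_eq:
  assumes "simple_function (borel_of X) \<phi>"
  shows "elementary_integral (borel_of X) \<mu> \<phi> = Fin (elementary \<phi>)"
  by (simp add: elementary_integral_def elementary_def Fin_op level_sets[OF assms] sum_Fin)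

lemma elementary_nonneg:
  assumes "simple_function (borel_of X) \<phi>" "\<And>x. x \<in> topspace X \<Longrightarrow> 0 \<le> \<phi> x"
  shows "0 \<le> elementary \<phi>"
  unfolding elementary_def
  using assms by (auto intro!: sum_nonneg scaleR_nonneg_nonneg op_nonneg level_sets)

lemma nn_integral_elementary:
  assumes \<phi>: "simple_function (borel_of X) \<phi>" "\<And>x. x \<in> topspace X \<Longrightarrow> 0 \<le> \<phi> x"
    and x: "0 \<le> x" "0 \<le> x'"
  shows "(\<integral>\<^sup>+y. ennreal (\<phi> y) \<partial>scalar x x') = ennreal (pair x' (elementary \<phi>) x)"
proof -
  let ?A = "\<lambda>r. \<phi> -` {r} \<inter> topspace X"
  have fin: "finite (\<phi> ` topspace X)" using \<phi>(1) by (simp add: simple_function_def)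
  have "(\<integral>\<^sup>+y. ennreal (\<phi> y) \<partial>scalar x x') =
      (\<integral>\<^sup>+y. (\<Sum>r\<in>\<phi> ` topspace X. ennreal r * indicator (?A r) y) \<partial>scalar x x')"
  proof (rule nn_integral_cong)
    fix y assume "y \<in> space (scalar x x')"
    then have y: "y \<in> topspace X" by simp
    have "(\<Sum>r\<in>\<phi> ` topspace X. ennreal r * indicator (?A r) y) =
        (\<Sum>r\<in>\<phi> ` topspace X. if r = \<phi> y then ennreal (\<phi> y) else 0)"
      using y by (intro sum.cong) (auto simp: indicator_def)
    then show "ennreal (\<phi> y) = (\<Sum>r\<in>\<phi> ` topspace X. ennreal r * indicator (?A r) y)"
      using fin y by simp
  qed
  also have "\<dots> = (\<Sum>r\<in>\<phi> ` topspace X. \<integral>\<^sup>+y. ennreal r * indicator (?A r) y \<partial>scalar x x')"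
    by (rule nn_integral_sum) (use level_sets[OF \<phi>(1)] in measurable)
  also have "\<dots> = (\<Sum>r\<in>\<phi> ` topspace X. ennreal (r * pair x' (op (?A r)) x))"
    using \<phi> x by (intro sum.cong refl)
      (auto simp: nn_integral_cmult_indicator level_sets emeasure_scalar ennreal_mult
        pair_nonneg op_nonneg)
  also have "\<dots> = ennreal (\<Sum>r\<in>\<phi> ` topspace X. r * pair x' (op (?A r)) x)"
    using \<phi> x by (intro sum_ennreal) (auto intro!: mult_nonneg_nonneg pair_nonneg op_nonneg level_sets)
  also have "(\<Sum>r\<in>\<phi> ` topspace X. r * pair x' (op (?A r)) x) = pair x' (elementary \<phi>) x"
    by (simp add: elementary_def regop_apply_sum_left regop_apply_sum_right)
  finally show ?thesis .
qed

lemma elementary_approxD: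
  assumes "elementary_approx (borel_of X) \<phi> g"
  shows "simple_function (borel_of X) (\<phi> n)" "y \<in> topspace X \<Longrightarrow> 0 \<le> \<phi> n y"
    "m \<le> n \<Longrightarrow> y \<in> topspace X \<Longrightarrow> \<phi> m y \<le> \<phi> n y"
    "y \<in> topspace X \<Longrightarrow> (SUP n. ennreal (\<phi> n y)) = g y"
  using assms by (auto simp: elementary_approx_def incseq_def)

lemma elementary_approx_exists:
  assumes "g \<in> borel_measurable (borel_of X)"
  obtains \<phi> where "elementary_approx (borel_of X) \<phi> g"
proof -
  obtain f where f: "\<And>i. simple_function (borel_of X) (f i)" "incseq f" "\<And>i x. f i x < top"
      "\<And>x. (SUP i. f i x) = g x"
    using borel_measurable_implies_simple_function_sequence'[OF assms] by metis
  \<comment> \<open>The values of each \<open>f i\<close> are below \<open>top\<close>, so passing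
    to reals loses nothing.\<close>
  have "elementary_approx (borel_of X) (\<lambda>i x. enn2real (f i x)) g"
    unfolding elementary_approx_def
    using f by (auto intro!: simple_function_compose1[where f = "f _"] enn2real_mono
        simp: incseq_def le_fun_def simple_function_compose1)
  then show thesis by (rule that)
qed

context
  fixes \<phi> :: "nat \<Rightarrow> 'x \<Rightarrow> real" and g :: "'x \<Rightarrow> ennreal"
  assumes \<phi>: "elementary_approx (borel_of X) \<phi> g"
begin

lemma elementary_incseq: "incseq (\<lambda>n. elementary (\<phi> n))"
proof (rule incseq_SucI, rule regop_le_iff_scalar[THEN iffD2], intro allI impI)
  fix n and x :: 'e and x' :: "('e, real) regop"
  assume x: "0 \<le> x" "0 \<le> x'"
  have "(\<integral>\<^sup>+y. ennreal (\<phi> n y) \<partial>scalar x x') \<le> (\<integral>\<^sup>+y. ennreal (\<phi> (Suc n) y) \<partial>scalar x x')"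
    by (intro nn_integral_mono ennreal_leI elementary_approxD(3)[OF \<phi>]) auto
  then show "pair x' (elementary (\<phi> n)) x \<le> pair x' (elementary (\<phi> (Suc n))) x"
    using x by (simp add: nn_integral_elementary elementary_approxD[OF \<phi>] pair_nonneg elementary_nonneg)
qed

lemma nonneg_elementary: "0 \<le> elementary (\<phi> n)"
  by (intro elementary_nonneg elementary_approxD[OF \<phi>])

lemma nn_integral_SUP_elementary:
  assumes x: "0 \<le> x" "0 \<le> x'"
  shows "(\<integral>\<^sup>+y. g y \<partial>scalar x x') = (SUP n. ennreal (pair x' (elementary (\<phi> n)) x))"
proof -
  have "(\<integral>\<^sup>+y. g y \<partial>scalar x x') = (\<integral>\<^sup>+y. (SUP n. ennreal (\<phi> n y)) \<partial>scalar x x')"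
    by (intro nn_integral_cong) (simp add: elementary_approxD(4)[OF \<phi>])
  also have "\<dots> = (SUP n. \<integral>\<^sup>+y. ennreal (\<phi> n y) \<partial>scalar x x')"
  proof (rule nn_integral_monotone_convergence_SUP_AE)
    show "AE y in scalar x x'. ennreal (\<phi> n y) \<le> ennreal (\<phi> (Suc n) y)" for n
      by (intro AE_I2 ennreal_leI elementary_approxD(3)[OF \<phi>]) auto
    have "\<phi> n \<in> borel_measurable (borel_of X)" for n
      using elementary_approxD(1)[OF \<phi>] by (rule borel_measurable_simple_function)
    then show "(\<lambda>y. ennreal (\<phi> n y)) \<in> borel_measurable (scalar x x')" for n by measurable
  qed
  also have "\<dots> = (SUP n. ennreal (pair x' (elementary (\<phi> n)) x))"
    using x by (simp add: nn_integral_elementary elementary_approxD[OF \<phi>])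
  finally show ?thesis .
qed

lemma range_elementary_integral:
  "range (\<lambda>n. elementary_integral (borel_of X) \<mu> (\<phi> n)) = Fin ` range (\<lambda>n. elementary (\<phi> n))"
  by (simp add: elementary_integral_eq elementary_approxD[OF \<phi>] image_image)

text \<open>The least upper bound is the strong limit of the increasing elementary operators, so it
  passes through the pairing and meets the monotone convergence theorem.\<close>

lemma lub_imp_nn_integral:
  assumes L: "isLub UNIV (range (\<lambda>n. elementary (\<phi> n))) T" and x: "0 \<le> x" "0 \<le> x'"
  shows "(\<integral>\<^sup>+y. g y \<partial>scalar x x') = ennreal (pair x' T x)"
proof -
  have "(\<lambda>n. regop_apply (elementary (\<phi> n)) x) \<longlonglongrightarrow> regop_apply T x"
    by (rule increasing_regop_seq_lub[OF elementary_incseq nonneg_elementary L])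
  then have "(\<lambda>n. ennreal (pair x' (elementary (\<phi> n)) x)) \<longlonglongrightarrow> ennreal (pair x' T x)"
    by (intro tendsto_ennrealI bounded_linear.tendsto[OF bounded_linear_regop])
  moreover have "incseq (\<lambda>n. ennreal (pair x' (elementary (\<phi> n)) x))"
    using x elementary_incseq by (auto simp: incseq_def intro!: ennreal_leI pair_mono)
  ultimately show ?thesis unfolding nn_integral_SUP_elementary[OF x]
    using LIMSEQ_SUP LIMSEQ_unique by blast
qed

text \<open>Converse of the preceding lemma, by testing operator inequalities on scalars. Together
  they show that a finite supremum does not depend on the approximating sequence.\<close>

lemma nn_integral_imp_lub:
  assumes T: "0 \<le> T"
    "\<And>x x'. 0 \<le> x \<Longrightarrow> 0 \<le> x' \<Longrightarrow> (\<integral>\<^sup>+y. g y \<partial>scalar x x') = ennreal (pair x' T x)"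
  shows "isLub UNIV (range (\<lambda>n. elementary (\<phi> n))) T"
  unfolding isLub_UNIV_iff
proof (intro conjI allI impI ballI)
  have eq: "(SUP n. ennreal (pair x' (elementary (\<phi> n)) x)) = ennreal (pair x' T x)"
    if "0 \<le> x" "0 \<le> x'" for x x'
    using T(2)[OF that] nn_integral_SUP_elementary[OF that] by simp
  have "elementary (\<phi> n) \<le> T" for n
  proof (rule regop_le_iff_scalar[THEN iffD2], intro allI impI)
    fix x :: 'e and x' :: "('e, real) regop"
    assume x: "0 \<le> x" "0 \<le> x'"
    have "ennreal (pair x' (elementary (\<phi> n)) x) \<le> ennreal (pair x' T x)"
      unfolding eq[OF x, symmetric] by (rule SUP_upper) simp
    then show "pair x' (elementary (\<phi> n)) x \<le> pair x' T x"
      using pair_nonneg[OF x T(1)] by simp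
  qed
  then show "S \<le> T" if "S \<in> range (\<lambda>n. elementary (\<phi> n))" for S using that by auto
  fix U assume "\<forall>S\<in>range (\<lambda>n. elementary (\<phi> n)). S \<le> U"
  then have U: "elementary (\<phi> n) \<le> U" for n by simp
  then have "0 \<le> U" using nonneg_elementary[of 0] by (rule order_trans[rotated])
  show "T \<le> U"
  proof (rule regop_le_iff_scalar[THEN iffD2], intro allI impI)
    fix x :: 'e and x' :: "('e, real) regop"
    assume x: "0 \<le> x" "0 \<le> x'"
    have "ennreal (pair x' T x) \<le> ennreal (pair x' U x)"
      unfolding eq[OF x, symmetric] by (intro SUP_least ennreal_leI pair_mono x U)
    then show "pair x' T x \<le> pair x' U x"
      using pair_nonneg[OF x \<open>0 \<le> U\<close>] by simp
  qed
qed

end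

section \<open>Order integrals determined by scalar integrals\<close>

abbreviation "nn_int \<equiv> order_nn_integral (borel_of X) \<mu>"

text \<open>The scalar integrals do not mention a sequence, so every approximating sequence has the
  least upper bound \<open>Fin T\<close>; this gives the definite description its unique
  witness.\<close>

lemma nn_int_eqI:
  assumes g: "g \<in> borel_measurable (borel_of X)" and "0 \<le> T"
    "\<And>x x'. 0 \<le> x \<Longrightarrow> 0 \<le> x' \<Longrightarrow> (\<integral>\<^sup>+y. g y \<partial>scalar x x') = ennreal (pair x' T x)"
  shows "nn_int g = Fin T"
  unfolding order_nn_integral_def
proof (rule the_equality)
  have L: "isLub UNIV (range (\<lambda>n. elementary_integral (borel_of X) \<mu> (\<phi> n))) (Fin T)"
    if "elementary_approx (borel_of X) \<phi> g" for \<phi>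
    unfolding range_elementary_integral[OF that] isLub_Fin_iff
    by (rule nn_integral_imp_lub[OF that assms(2,3)])
  obtain \<phi> where \<phi>: "elementary_approx (borel_of X) \<phi> g" using elementary_approx_exists[OF g] .
  then show "\<exists>\<phi>. elementary_approx (borel_of X) \<phi> g \<and>
      isLub UNIV (range (\<lambda>n. elementary_integral (borel_of X) \<mu> (\<phi> n))) (Fin T)"
    using L by blast
  show "a = Fin T" if "\<exists>\<phi>. elementary_approx (borel_of X) \<phi> g \<and>
      isLub UNIV (range (\<lambda>n. elementary_integral (borel_of X) \<mu> (\<phi> n))) a" for a
    using that L isLub_unique_order by blast
qed

lemma nn_int_bounded:
  assumes \<phi>: "elementary_approx (borel_of X) \<phi> g" and g: "g \<in> borel_measurable (borel_of X)"
    and U: "\<And>n. elementary (\<phi> n) \<le> U"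
  obtains T where "nn_int g = Fin T" "0 \<le> T"
    "\<And>x x'. 0 \<le> x \<Longrightarrow> 0 \<le> x' \<Longrightarrow> (\<integral>\<^sup>+y. g y \<partial>scalar x x') = ennreal (pair x' T x)"
    "\<And>x. (\<lambda>n. regop_apply (elementary (\<phi> n)) x) \<longlonglongrightarrow> regop_apply T x"
proof -
  obtain T where T: "isLub UNIV (range (\<lambda>n. elementary (\<phi> n))) T"
    "\<And>x. (\<lambda>n. regop_apply (elementary (\<phi> n)) x) \<longlonglongrightarrow> regop_apply T x"
    using increasing_regop_seq[OF elementary_incseq[OF \<phi>] nonneg_elementary[OF \<phi>] U] by blast
  have "elementary (\<phi> 0) \<le> T" using T(1) by (simp add: isLub_UNIV_iff)
  then have "0 \<le> T" using nonneg_elementary[OF \<phi>, of 0] by (rule order_trans[rotated])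
  moreover note lub_imp_nn_integral[OF \<phi> T(1)]
  ultimately show thesis using that nn_int_eqI[OF g] T(2) by blast
qed

text \<open>A definite description without a unique witness could denote anything, so the equation
  with \<open>Fin T\<close> needs to be exploited with care. If the elementary operators had no
  upper bound, \<open>Infty\<close> would be the unique witness, which contradicts
  \<open>Fin T\<close>.\<close>

lemma nn_int_finiteD:
  assumes g: "g \<in> borel_measurable (borel_of X)" and T: "nn_int g = Fin T"
  obtains \<phi> where "0 \<le> T" "elementary_approx (borel_of X) \<phi> g"
    "\<And>x x'. 0 \<le> x \<Longrightarrow> 0 \<le> x' \<Longrightarrow> (\<integral>\<^sup>+y. g y \<partial>scalar x x') = ennreal (pair x' T x)"
    "\<And>x. (\<lambda>n. regop_apply (elementary (\<phi> n)) x) \<longlonglongrightarrow> regop_apply T x"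
proof -
  obtain \<phi> where \<phi>: "elementary_approx (borel_of X) \<phi> g" using elementary_approx_exists[OF g] .
  show thesis
  proof (cases "\<exists>U. \<forall>n. elementary (\<phi> n) \<le> U")
    case True
    then obtain U where U: "\<And>n. elementary (\<phi> n) \<le> U" by blast
    obtain S where S: "nn_int g = Fin S" "0 \<le> S"
      "\<And>x x'. 0 \<le> x \<Longrightarrow> 0 \<le> x' \<Longrightarrow> (\<integral>\<^sup>+y. g y \<partial>scalar x x') = ennreal (pair x' S x)"
      "\<And>x. (\<lambda>n. regop_apply (elementary (\<phi> n)) x) \<longlonglongrightarrow> regop_apply S x"
      using nn_int_bounded[OF \<phi> g U] by blast
    then have "S = T" using T by simp
    then show thesis using that \<phi> S by blast
  next
    case False
    let ?P = "\<lambda>a. \<exists>\<phi>. elementary_approx (borel_of X) \<phi> g \<and>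
      isLub UNIV (range (\<lambda>n. elementary_integral (borel_of X) \<mu> (\<phi> n))) a"
    have "isLub UNIV (Fin ` range (\<lambda>n. elementary (\<phi> n))) Infty"
      unfolding isLub_UNIV_iff
    proof (intro conjI allI impI)
      fix b assume "\<forall>y\<in>Fin ` range (\<lambda>n. elementary (\<phi> n)). y \<le> b"
      then show "Infty \<le> b" using False by (cases b) auto
    qed simp
    then have "?P Infty" using \<phi> range_elementary_integral[OF \<phi>] by auto
    \<comment> \<open>A second sequence with a finite supremum would have the same scalar integrals,
      and its supremum would bound the first sequence.\<close>
    moreover have "a = Infty" if "?P a" for a
    proof (cases a)
      case (Fin S)
      then obtain \<psi> where \<psi>: "elementary_approx (borel_of X) \<psi> g"
        "isLub UNIV (range (\<lambda>n. elementary_integral (borel_of X) \<mu> (\<psi> n))) (Fin S)"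
        using \<open>?P a\<close> by blast
      then have L: "isLub UNIV (range (\<lambda>n. elementary (\<psi> n))) S"
        by (simp add: range_elementary_integral[OF \<psi>(1)] isLub_Fin_iff)
      then have "elementary (\<psi> 0) \<le> S" by (simp add: isLub_UNIV_iff)
      then have "0 \<le> S" using nonneg_elementary[OF \<psi>(1), of 0] by (rule order_trans[rotated])
      then have "isLub UNIV (range (\<lambda>n. elementary (\<phi> n))) S"
        using nn_integral_imp_lub[OF \<phi>] lub_imp_nn_integral[OF \<psi>(1) L] by blast
      then show ?thesis using False by (auto simp: isLub_UNIV_iff)
    qed simp
    ultimately have "nn_int g = Infty" unfolding order_nn_integral_def by (rule the_equality)
    then show thesis using T by simp
  qed
qed

lemma nn_int_finite:
  assumes g: "g \<in> borel_measurable (borel_of X)" and T: "nn_int g = Fin T"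
  shows "0 \<le> T"
    and "0 \<le> x \<Longrightarrow> 0 \<le> x' \<Longrightarrow> (\<integral>\<^sup>+y. g y \<partial>scalar x x') = ennreal (pair x' T x)"
proof -
  have *: "0 \<le> T"
    "\<And>x x'. 0 \<le> x \<Longrightarrow> 0 \<le> x' \<Longrightarrow> (\<integral>\<^sup>+y. g y \<partial>scalar x x') = ennreal (pair x' T x)"
    using nn_int_finiteD[OF g T] by blast+
  show "0 \<le> T" by fact
  show "0 \<le> x \<Longrightarrow> 0 \<le> x' \<Longrightarrow> (\<integral>\<^sup>+y. g y \<partial>scalar x x') = ennreal (pair x' T x)" by (rule *)
qed

text \<open>The scalar integrals of \<open>h\<close> bound those of \<open>g\<close>, hence the
  elementary operators that approximate \<open>g\<close> lie below \<open>T\<close>, and their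
  increasing sequence has a supremum.\<close>

lemma nn_int_dominated:
  assumes g: "g \<in> borel_measurable (borel_of X)" and h: "h \<in> borel_measurable (borel_of X)"
    and le: "\<And>y. y \<in> topspace X \<Longrightarrow> g y \<le> h y" and T: "nn_int h = Fin T"
  shows "\<exists>S. nn_int g = Fin S"
proof -
  obtain \<phi> where \<phi>: "elementary_approx (borel_of X) \<phi> g" using elementary_approx_exists[OF g] .
  have "elementary (\<phi> n) \<le> T" for n
  proof (rule regop_le_iff_scalar[THEN iffD2], intro allI impI)
    fix x :: 'e and x' :: "('e, real) regop"
    assume x: "0 \<le> x" "0 \<le> x'"
    note T' = nn_int_finite(1)[OF h T] nn_int_finite(2)[OF h T x]
    have "ennreal (pair x' (elementary (\<phi> n)) x) \<le> (\<integral>\<^sup>+y. g y \<partial>scalar x x')"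
      unfolding nn_integral_SUP_elementary[OF \<phi> x] by (rule SUP_upper) simp
    also have "\<dots> \<le> (\<integral>\<^sup>+y. h y \<partial>scalar x x')" using le by (intro nn_integral_mono) simp
    finally show "pair x' (elementary (\<phi> n)) x \<le> pair x' T x"
      using T' pair_nonneg[OF x T'(1)] by simp
  qed
  then show ?thesis using nn_int_bounded[OF \<phi> g] by blast
qed

abbreviation "L1 \<equiv> order_L1 (borel_of X) \<mu>"
abbreviation "oint \<equiv> order_integral (borel_of X) \<mu>"

lemma L1_I:
  assumes f: "f \<in> borel_measurable (borel_of X)" and "0 \<le> T"
    "\<And>x x'. 0 \<le> x \<Longrightarrow> 0 \<le> x' \<Longrightarrow> (\<integral>\<^sup>+y. ennreal \<bar>f y\<bar> \<partial>scalar x x') = ennreal (pair x' T x)"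
  shows "f \<in> L1"
proof -
  have "nn_int (\<lambda>y. ennreal \<bar>f y\<bar>) = Fin T" using f assms(2,3) by (intro nn_int_eqI) auto
  then show ?thesis using f by (simp add: order_L1_def is_finite_iff)
qed

lemma L1_parts:
  assumes f: "f \<in> L1"
  obtains S T where "nn_int (\<lambda>y. ennreal (max 0 (f y))) = Fin S"
    "nn_int (\<lambda>y. ennreal (max 0 (- f y))) = Fin T" "oint f = S - T"
proof -
  have m: "f \<in> borel_measurable (borel_of X)" using f by (simp add: order_L1_def)
  obtain U where U: "nn_int (\<lambda>y. ennreal \<bar>f y\<bar>) = Fin U"
    using f by (auto simp: order_L1_def is_finite_iff)
  have "\<exists>S. nn_int (\<lambda>y. ennreal (max 0 (f y))) = Fin S"
    by (rule nn_int_dominated[OF _ _ _ U]) (use m in \<open>auto intro!: ennreal_leI\<close>)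
  moreover have "\<exists>T. nn_int (\<lambda>y. ennreal (max 0 (- f y))) = Fin T"
    by (rule nn_int_dominated[OF _ _ _ U]) (use m in \<open>auto intro!: ennreal_leI\<close>)
  ultimately show thesis using that by (auto simp: order_integral_def)
qed

lemma L1_scalar:
  assumes f: "f \<in> L1" and x: "0 \<le> x" "0 \<le> x'"
  shows "integrable (scalar x x') f" "integral\<^sup>L (scalar x x') f = pair x' (oint f) x"
proof -
  have m: "f \<in> borel_measurable (borel_of X)" using f by (simp add: order_L1_def)
  obtain U where U: "nn_int (\<lambda>y. ennreal \<bar>f y\<bar>) = Fin U"
    using f by (auto simp: order_L1_def is_finite_iff)
  have mm: "f \<in> borel_measurable (scalar x x')" using m by measurable
  have "(\<integral>\<^sup>+y. ennreal \<bar>f y\<bar> \<partial>scalar x x') = ennreal (pair x' U x)"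
    using m x by (intro nn_int_finite(2)[OF _ U]) auto
  then show int: "integrable (scalar x x') f" using mm by (intro integrableI_bounded) auto
  obtain S T where ST: "nn_int (\<lambda>y. ennreal (max 0 (f y))) = Fin S"
    "nn_int (\<lambda>y. ennreal (max 0 (- f y))) = Fin T" "oint f = S - T" using L1_parts[OF f] .
  have "0 \<le> S \<and> (\<integral>\<^sup>+y. ennreal (max 0 (f y)) \<partial>scalar x x') = ennreal (pair x' S x)"
    using m x by (intro conjI nn_int_finite[OF _ ST(1)]) auto
  moreover have "0 \<le> T \<and> (\<integral>\<^sup>+y. ennreal (max 0 (- f y)) \<partial>scalar x x') = ennreal (pair x' T x)"
    using m x by (intro conjI nn_int_finite[OF _ ST(2)]) auto
  ultimately show "integral\<^sup>L (scalar x x') f = pair x' (oint f) x"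
    using x by (simp add: real_lebesgue_integral_def[OF int] ST(3) pair_nonneg ennreal_max_0)
qed

lemma int_eq_iff:
  assumes f: "f \<in> L1"
  shows "(\<forall>x\<ge>0. \<forall>x'\<ge>0. pair x' T x = integral\<^sup>L (scalar x x') f) \<longleftrightarrow> T = oint f"
  using L1_scalar(2)[OF f] by (auto intro!: regop_eqI_scalar)

lemma has_order_integralI:
  assumes f: "f \<in> borel_measurable (borel_of X)" and "0 \<le> S"
    "\<And>x x'. 0 \<le> x \<Longrightarrow> 0 \<le> x' \<Longrightarrow> (\<integral>\<^sup>+y. ennreal \<bar>f y\<bar> \<partial>scalar x x') = ennreal (pair x' S x)"
    "\<And>x x'. 0 \<le> x \<Longrightarrow> 0 \<le> x' \<Longrightarrow> integral\<^sup>L (scalar x x') f = pair x' T x"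
  shows "has_order_integral (borel_of X) \<mu> f T"
proof -
  have "f \<in> L1" using assms(1-3) by (rule L1_I)
  then show ?thesis using int_eq_iff[of f T] assms(4) by (simp add: has_order_integral_def)
qed

end

section \<open>Positive operators on functions vanishing at infinity\<close>

text \<open>This completeness lets the series of humps in \<open>pi_bounded\<close> be summed inside
  \<open>C0_functions X\<close>: a uniform limit inherits smallness off a compact set from one close
  approximant.\<close>

lemma C0_uniform_limit:
  assumes lim: "uniform_limit UNIV s g sequentially" and s: "\<And>n::nat. s n \<in> C0_functions X"
  shows "g \<in> C0_functions X"
proof -
  have near: "\<exists>n. \<forall>x. \<bar>s n x - g x\<bar> < \<epsilon>" if "0 < \<epsilon>" for \<epsilon>
  proof -
    have "\<forall>\<^sub>F n in sequentially. \<forall>x\<in>UNIV. dist (s n x) (g x) < \<epsilon>"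
      using lim that by (rule uniform_limitD)
    then show ?thesis by (auto simp: eventually_sequentially dist_real_def)
  qed
  have "continuous_map X Met_TC.mtopology g"
  proof (rule Met_TC.continuous_map_uniform_limit[where F = sequentially and f = s])
    show "\<forall>\<^sub>F n in sequentially. continuous_map X Met_TC.mtopology (s n)"
      using C0_continuous[OF s] by simp
    show "\<forall>\<^sub>F n in sequentially. \<forall>x\<in>topspace X. g x \<in> UNIV \<and> dist (s n x) (g x) < \<epsilon>"
      if "0 < \<epsilon>" for \<epsilon>
      using uniform_limitD[OF lim that] by (rule eventually_mono) simp
  qed simp
  moreover have "g x = 0" if "x \<notin> topspace X" for x
  proof (rule ccontr)
    assume "g x \<noteq> 0"
    then obtain n where "\<bar>s n x - g x\<bar> < \<bar>g x\<bar>" using near[of "\<bar>g x\<bar>"] by auto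
    then show False using C0_outside[OF s that] by simp
  qed
  moreover have "\<exists>K. compactin X K \<and> (\<forall>x\<in>topspace X - K. \<bar>g x\<bar> < \<epsilon>)" if \<epsilon>: "\<epsilon> > 0" for \<epsilon>
  proof -
    obtain n where n: "\<And>x. \<bar>s n x - g x\<bar> < \<epsilon> / 2" using near[of "\<epsilon> / 2"] \<epsilon> by auto
    have "\<epsilon> / 2 > 0" using \<epsilon> by simp
    then have "compactin X {x \<in> topspace X. \<epsilon> / 2 \<le> \<bar>s n x\<bar>}"
      using s[of n] unfolding C0_iff by blast
    moreover have "\<bar>g x\<bar> < \<epsilon>" if "x \<in> topspace X - {x \<in> topspace X. \<epsilon> / 2 \<le> \<bar>s n x\<bar>}" for x
    proof -
      have "\<bar>s n x\<bar> < \<epsilon> / 2" using that by auto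
      then show ?thesis using n[of x] by linarith
    qed
    ultimately show ?thesis by blast
  qed
  ultimately show ?thesis by (simp add: C0_functions_def real_functions_def)
qed

text \<open>The Riesz formulas are suprema and infima in \<open>ennreal\<close>, while the operators
  arise as limits of nets; this lemma and its dual identify the two.\<close>

lemma SUP_ennreal_net:
  assumes dir: "directed I le" and lim: "(a \<longlongrightarrow> l) (net_filter I le)" and le: "\<And>i. i \<in> I \<Longrightarrow> a i \<le> l"
  shows "(SUP i\<in>I. ennreal (a i)) = ennreal l"
proof (rule antisym)
  show "(SUP i\<in>I. ennreal (a i)) \<le> ennreal l" by (intro SUP_least ennreal_leI le)
  have "\<forall>\<^sub>F i in net_filter I le. ennreal (a i) \<le> (SUP i\<in>I. ennreal (a i))"
    by (rule eventually_net_filterI[OF dir]) (rule SUP_upper)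
  then show "ennreal l \<le> (SUP i\<in>I. ennreal (a i))"
    using net_filter_neq_bot[OF dir] by (intro tendsto_upperbound[OF tendsto_ennrealI[OF lim]])
qed

lemma INF_ennreal_net:
  assumes dir: "directed I le" and lim: "(a \<longlongrightarrow> l) (net_filter I le)" and le: "\<And>i. i \<in> I \<Longrightarrow> l \<le> a i"
  shows "(INF i\<in>I. ennreal (a i)) = ennreal l"
proof (rule antisym)
  show "ennreal l \<le> (INF i\<in>I. ennreal (a i))" by (intro INF_greatest ennreal_leI le)
  have "\<forall>\<^sub>F i in net_filter I le. (INF i\<in>I. ennreal (a i)) \<le> ennreal (a i)"
    by (rule eventually_net_filterI[OF dir]) (rule INF_lower)
  then show "(INF i\<in>I. ennreal (a i)) \<le> ennreal l"
    using net_filter_neq_bot[OF dir] by (intro tendsto_lowerbound[OF tendsto_ennrealI[OF lim]])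
qed

lemma sums_partial_le:
  fixes s :: real
  assumes "f sums s" "\<And>n. 0 \<le> f n"
  shows "(\<Sum>n\<le>N. f n) \<le> s"
  using sum_le_suminf[of f "{..N}"] assms by (simp add: sums_iff)

locale positive_C0_operator = lch_space X for X :: "'x topology" +
  fixes \<pi> :: "('x \<Rightarrow> real) \<Rightarrow> ('e::kb_space, 'e) regop"
  assumes positive: "positive_on_C0 X \<pi>"
begin

lemma pi_add: "f \<in> C0_functions X \<Longrightarrow> g \<in> C0_functions X \<Longrightarrow> \<pi> (\<lambda>x. f x + g x) = \<pi> f + \<pi> g"
  and pi_scale: "f \<in> C0_functions X \<Longrightarrow> \<pi> (\<lambda>x. r * f x) = r *\<^sub>R \<pi> f"
  and pi_nonneg: "f \<in> C0_functions X \<Longrightarrow> (\<And>x. 0 \<le> f x) \<Longrightarrow> 0 \<le> \<pi> f"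
  using positive by (simp_all add: positive_on_C0_def)

lemma pi_mono:
  assumes f: "f \<in> C0_functions X" and g: "g \<in> C0_functions X" and le: "\<And>x. f x \<le> g x"
  shows "\<pi> f \<le> \<pi> g"
proof -
  have "\<pi> g = \<pi> f + \<pi> (\<lambda>x. g x - f x)" using pi_add[OF f C0_diff[OF g f]] by simp
  moreover have "0 \<le> \<pi> (\<lambda>x. g x - f x)" using le by (intro pi_nonneg C0_diff g f) simp
  ultimately show ?thesis by simp
qed

text \<open>The gliding hump argument by which positive operators between Banach lattices are bounded.\<close>

lemma pi_bounded:
  assumes x: "0 \<le> x"
  shows "\<exists>c. \<forall>f\<in>C0_functions X. (\<forall>y. 0 \<le> f y \<and> f y \<le> 1) \<longrightarrow> norm (regop_apply (\<pi> f) x) \<le> c"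
proof (rule ccontr)
  assume "\<not> ?thesis"
  then have "\<forall>n::nat. \<exists>f\<in>C0_functions X. (\<forall>y. 0 \<le> f y \<and> f y \<le> 1) \<and> 4 ^ n < norm (regop_apply (\<pi> f) x)"
    by (meson not_le)
  then obtain f where f: "\<And>n::nat. f n \<in> C0_functions X" "\<And>n y. 0 \<le> f n y" "\<And>n y. f n y \<le> 1"
    "\<And>n. 4 ^ n < norm (regop_apply (\<pi> (f n)) x)" by metis
  \<comment> \<open>The weights \<open>2 ^ (- n)\<close> make the sum converge uniformly, while the
    images keep norm above \<open>2 ^ n\<close> because the humps were chosen above
    \<open>4 ^ n\<close>.\<close>
  define h where "h n y = (1/2) ^ n * f n y" for n y
  have h: "h n \<in> C0_functions X" "0 \<le> h n y" "\<bar>h n y\<bar> \<le> (1/2) ^ n" for n y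
    using f(2,3)[of n y] C0_scale[OF f(1)] by (auto simp: h_def[abs_def] mult_left_le)
  have ulim: "uniform_limit UNIV (\<lambda>n y. \<Sum>i<n. h i y) (\<lambda>y. \<Sum>i. h i y) sequentially"
    by (rule Weierstrass_m_test[where M = "\<lambda>n. (1/2) ^ n"]) (use h(3) in auto)
  define g where "g y = (\<Sum>i. h i y)" for y
  have g: "g \<in> C0_functions X" unfolding g_def
    by (rule C0_uniform_limit[OF ulim]) (intro C0_sum h)
  have hg: "h n y \<le> g y" for n y
  proof -
    have "summable (\<lambda>i. h i y)"
      by (rule summable_comparison_test'[OF summable_geometric[of "1/2::real"]]) (use h(3) in auto)
    then have "(\<Sum>i\<in>{n}. h i y) \<le> g y" unfolding g_def by (intro sum_le_suminf) (auto intro: h)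
    then show ?thesis by simp
  qed
  have "2 ^ n \<le> norm (regop_apply (\<pi> g) x)" for n
  proof -
    have "2 ^ n = (1/2::real) ^ n * 4 ^ n" by (simp flip: power_mult_distrib)
    also have "\<dots> \<le> (1/2) ^ n * norm (regop_apply (\<pi> (f n)) x)"
      using f(4)[of n] by (intro mult_left_mono) auto
    also have "\<dots> = norm (regop_apply (\<pi> (h n)) x)"
      unfolding h_def[abs_def] by (simp add: pi_scale f(1))
    also have "\<dots> \<le> norm (regop_apply (\<pi> g) x)"
    proof (rule norm_mono_nonneg)
      show "0 \<le> regop_apply (\<pi> (h n)) x" using x h by (intro regop_apply_nonneg pi_nonneg)
      show "regop_apply (\<pi> (h n)) x \<le> regop_apply (\<pi> g) x"
        using pi_mono[OF h(1) g hg] x by (simp add: less_eq_regop.rep_eq)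
    qed
    finally show ?thesis .
  qed
  then show False using real_arch_pow[of 2 "norm (regop_apply (\<pi> g) x)"] by (auto simp flip: not_le)
qed

abbreviation pi_scalar :: "'e \<Rightarrow> ('e, real) regop \<Rightarrow> ('x \<Rightarrow> real) \<Rightarrow> real" where
  "pi_scalar x x' \<equiv> \<lambda>f. regop_apply x' (regop_apply (\<pi> f) x)"

lemma C0_functional_pi:
  assumes x: "0 \<le> x" "0 \<le> x'"
  shows "\<exists>B. C0_functional X (pi_scalar x x') B"
proof -
  obtain c where c: "\<And>f. f \<in> C0_functions X \<Longrightarrow> (\<And>y. 0 \<le> f y \<and> f y \<le> 1) \<Longrightarrow>
      norm (regop_apply (\<pi> f) x) \<le> c"
    using pi_bounded[OF x(1)] by blast
  obtain k where k: "0 \<le> k" "\<And>y. \<bar>regop_apply x' y\<bar> \<le> norm y * k"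
    using bounded_linear.nonneg_bounded[OF bounded_linear_regop[of x']] by auto
  have "C0_functional X (pi_scalar x x') (c * k)"
  proof
    show "positive_on_C0 X (pi_scalar x x')"
      using x by (auto simp: positive_on_C0_def pi_add pi_scale
          intro!: regop_apply_nonneg elim!: notE)
        (use positive in \<open>auto simp: positive_on_C0_def\<close>)
    fix f assume f: "f \<in> C0_functions X" "\<And>y. 0 \<le> f y \<and> f y \<le> 1"
    have "pi_scalar x x' f \<le> norm (regop_apply (\<pi> f) x) * k"
      using k(2)[of "regop_apply (\<pi> f) x"] by simp
    also have "\<dots> \<le> c * k" using c[OF f] k(1) by (intro mult_right_mono)
    finally show "pi_scalar x x' f \<le> c * k" .
  qed
  then show ?thesis ..
qed

text \<open>The construction of \<open>riesz_measure\<close> does not refer to the bound, so no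
  bound has to be chosen here; one is obtained from \<open>C0_functional_pi\<close> when properties
  of the measure are derived.\<close>

definition riesz :: "'e \<Rightarrow> ('e, real) regop \<Rightarrow> 'x measure" where
  "riesz x x' = C0_functional.riesz_measure X (pi_scalar x x')"

lemma riesz:
  assumes "0 \<le> x" "0 \<le> x'"
  shows "sets (riesz x x') = sets (borel_of X)" "finite_measure (riesz x x')"
    "openin X V \<Longrightarrow> emeasure (riesz x x') V = (SUP f\<in>{f. subordinate X f V}. ennreal (pi_scalar x x' f))"
    "A \<in> sets (borel_of X) \<Longrightarrow>
      emeasure (riesz x x') A = (INF V\<in>{V. openin X V \<and> A \<subseteq> V}. emeasure (riesz x x') V)"
    "f \<in> C0_functions X \<Longrightarrow> integrable (riesz x x') f"
    "f \<in> C0_functions X \<Longrightarrow> integral\<^sup>L (riesz x x') f = pi_scalar x x' f"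
proof -
  obtain B where "C0_functional X (pi_scalar x x') B" using C0_functional_pi[OF assms] by blast
  then interpret C0_functional X "pi_scalar x x'" B .
  show "sets (riesz x x') = sets (borel_of X)" "finite_measure (riesz x x')"
    "openin X V \<Longrightarrow> emeasure (riesz x x') V = (SUP f\<in>{f. subordinate X f V}. ennreal (pi_scalar x x' f))"
    "f \<in> C0_functions X \<Longrightarrow> integrable (riesz x x') f"
    "f \<in> C0_functions X \<Longrightarrow> integral\<^sup>L (riesz x x') f = pi_scalar x x' f"
    unfolding riesz_def
    by (simp_all add: finite_riesz emeasure_riesz_open integrable_riesz integral_riesz)
  show "emeasure (riesz x x') A = (INF V\<in>{V. openin X V \<and> A \<subseteq> V}. emeasure (riesz x x') V)"
    if "A \<in> sets (borel_of X)"
    unfolding riesz_def using that by (rule emeasure_riesz_outer)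
qed

section \<open>Operators attached to open sets and their decreasing limits\<close>

lemma subordinate_max:
  assumes f: "subordinate X f V" and g: "subordinate X g V"
  shows "subordinate X (\<lambda>x. max (f x) (g x)) V"
proof (rule subordinateI)
  note f' = subordinateD[OF f] and g' = subordinateD[OF g]
  show "(\<lambda>x. max (f x) (g x)) \<in> C0_functions X" by (intro C0_max f' g')
  show "0 \<le> max (f x) (g x) \<and> max (f x) (g x) \<le> 1" for x
    using f'(3,4)[of x] g'(3,4)[of x] by auto
  show "compactin X (fun_support X f \<union> fun_support X g)" by (intro compactin_Un f' g')
  show "fun_support X f \<union> fun_support X g \<subseteq> V" using f' g' by blast
qed (simp add: fun_support_outside subordinateD(1)[OF f] subordinateD(1)[OF g])

lemma directed_subordinate: "directed {f. subordinate X f V} (\<le>)"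
proof -
  have "\<exists>k\<in>{f. subordinate X f V}. f \<le> k \<and> g \<le> k"
    if "subordinate X f V" "subordinate X g V" for f g
    using subordinate_max[OF that] by (intro bexI[of _ "\<lambda>x. max (f x) (g x)"]) (auto simp: le_fun_def)
  moreover have "f \<le> h" if "f \<le> g" "g \<le> h" for f g h :: "'x \<Rightarrow> real"
    using that by (rule order_trans)
  ultimately show ?thesis unfolding directed_def by (intro conjI ballI impI) (use subordinate_zero in blast | simp)+
qed

lemma subordinate_lub_exists:
  obtains S where "isLub UNIV (\<pi> ` {f. subordinate X f V}) S"
proof (rule increasing_regop_net[OF directed_subordinate, where T = \<pi>])
  show "\<pi> f \<le> \<pi> g" if "f \<in> {f. subordinate X f V}" "g \<in> {f. subordinate X f V}" "f \<le> g" for f g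
    using that by (intro pi_mono) (auto simp: le_fun_def dest: subordinateD)
  show "0 \<le> \<pi> f" if "f \<in> {f. subordinate X f V}" for f
    using that by (intro pi_nonneg) (auto dest: subordinateD)
  fix x :: 'e assume "0 \<le> x"
  then obtain c where "\<forall>f\<in>C0_functions X. (\<forall>y. 0 \<le> f y \<and> f y \<le> 1) \<longrightarrow> norm (regop_apply (\<pi> f) x) \<le> c"
    using pi_bounded by blast
  then show "\<exists>c. \<forall>f\<in>{f. subordinate X f V}. norm (regop_apply (\<pi> f) x) \<le> c"
    by (intro exI[of _ c]) (auto dest: subordinateD)
qed (rule that)

definition open_op :: "'x set \<Rightarrow> ('e, 'e) regop" where
  "open_op V = (SOME S. isLub UNIV (\<pi> ` {f. subordinate X f V}) S)"

lemma open_op_lub: "isLub UNIV (\<pi> ` {f. subordinate X f V}) (open_op V)"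
  unfolding open_op_def by (rule subordinate_lub_exists[of V]) (rule someI)

lemma open_op_tendsto:
  "((\<lambda>f. regop_apply (\<pi> f) x) \<longlongrightarrow> regop_apply (open_op V) x) (net_filter {f. subordinate X f V} (\<le>))"
  by (rule increasing_regop_net_lub[OF directed_subordinate _ _ open_op_lub])
    (auto intro!: pi_mono pi_nonneg simp: le_fun_def dest: subordinateD)

lemma open_op_upper: "subordinate X f V \<Longrightarrow> \<pi> f \<le> open_op V"
  using open_op_lub[of V] by (simp add: isLub_UNIV_iff)

lemma open_op_least: "(\<And>f. subordinate X f V \<Longrightarrow> \<pi> f \<le> U) \<Longrightarrow> open_op V \<le> U"
  using open_op_lub[of V] by (simp add: isLub_UNIV_iff)

lemma open_op_nonneg: "0 \<le> open_op V"
proof -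
  have "0 \<le> \<pi> (\<lambda>x. 0)" by (rule pi_nonneg) auto
  also have "\<dots> \<le> open_op V" by (rule open_op_upper[OF subordinate_zero])
  finally show ?thesis .
qed

lemma open_op_mono: "V \<subseteq> W \<Longrightarrow> open_op V \<le> open_op W"
  by (rule open_op_least) (auto intro!: open_op_upper simp: subordinate_def)

lemma emeasure_open_op:
  assumes "openin X V" "0 \<le> x" "0 \<le> x'"
  shows "emeasure (riesz x x') V = ennreal (regop_apply x' (regop_apply (open_op V) x))"
  unfolding riesz(3)[OF assms(2,3,1)]
proof (rule SUP_ennreal_net[OF directed_subordinate])
  show "((\<lambda>f. pi_scalar x x' f) \<longlongrightarrow> regop_apply x' (regop_apply (open_op V) x))
      (net_filter {f. subordinate X f V} (\<le>))"
    by (rule bounded_linear.tendsto[OF bounded_linear_regop open_op_tendsto])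
  show "pi_scalar x x' f \<le> regop_apply x' (regop_apply (open_op V) x)" if "f \<in> {f. subordinate X f V}" for f
    using that assms by (intro regop_scalar_mono open_op_upper) auto
qed

lemma directed_open_nbhds:
  assumes "A \<subseteq> topspace X"
  shows "directed {V. openin X V \<and> A \<subseteq> V} (\<lambda>V W. W \<subseteq> V)"
  unfolding directed_def
proof (intro conjI ballI impI)
  show "{V. openin X V \<and> A \<subseteq> V} \<noteq> {}" using assms by blast
  show "W \<subseteq> U" if "V \<subseteq> U" "W \<subseteq> V" for U V W :: "'x set" using that by (rule order_trans[rotated])
  show "\<exists>U\<in>{V. openin X V \<and> A \<subseteq> V}. U \<subseteq> V \<and> U \<subseteq> W"
    if "V \<in> {V. openin X V \<and> A \<subseteq> V}" "W \<in> {V. openin X V \<and> A \<subseteq> V}" for V W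
    using that by (intro bexI[of _ "V \<inter> W"]) auto
qed simp

text \<open>The KB property concerns increasing nets; the decreasing net of the
  \<open>open_op V\<close> is turned into one by subtraction from
  \<open>open_op (topspace X)\<close>, which bounds it by monotonicity.\<close>

lemma open_op_glb_exists:
  assumes A: "A \<subseteq> topspace X"
  shows "\<exists>S. isGlb UNIV (open_op ` {V. openin X V \<and> A \<subseteq> V}) S \<and>
    (\<forall>x. ((\<lambda>V. regop_apply (open_op V) x) \<longlongrightarrow> regop_apply S x)
      (net_filter {V. openin X V \<and> A \<subseteq> V} (\<lambda>V W. W \<subseteq> V)))"
proof -
  let ?I = "{V. openin X V \<and> A \<subseteq> V}"
  let ?E = "open_op (topspace X)"
  have E: "open_op V \<le> ?E" if "V \<in> ?I" for V
    using that openin_subset by (intro open_op_mono) blast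
  obtain S where S: "isLub UNIV ((\<lambda>V. ?E - open_op V) ` ?I) S"
    "\<And>x. ((\<lambda>V. regop_apply (?E - open_op V) x) \<longlongrightarrow> regop_apply S x) (net_filter ?I (\<lambda>V W. W \<subseteq> V))"
  proof (rule increasing_regop_net[OF directed_open_nbhds[OF A], of "\<lambda>V. ?E - open_op V"])
    show "?E - open_op V \<le> ?E - open_op W" if "W \<subseteq> V" for V W
      using open_op_mono[OF that] by simp
    show "0 \<le> ?E - open_op V" if "V \<in> ?I" for V using E[OF that] by simp
    fix x :: 'e assume x: "0 \<le> x"
    have "norm (regop_apply (?E - open_op V) x) \<le> norm (regop_apply ?E x)" if "V \<in> ?I" for V
    proof (rule norm_mono_nonneg)
      show "0 \<le> regop_apply (?E - open_op V) x"
        using E[OF that] x by (intro regop_apply_nonneg) simp_all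
      show "regop_apply (?E - open_op V) x \<le> regop_apply ?E x"
        using regop_apply_nonneg[OF open_op_nonneg x, of V] by simp
    qed
    then show "\<exists>c. \<forall>V\<in>?I. norm (regop_apply (?E - open_op V) x) \<le> c" by blast
  qed (rule that)
  have "((\<lambda>V. regop_apply (open_op V) x) \<longlongrightarrow> regop_apply (?E - S) x) (net_filter ?I (\<lambda>V W. W \<subseteq> V))" for x
    using tendsto_diff[OF tendsto_const S(2)[of x], of "regop_apply ?E x"] by simp
  moreover have "isGlb UNIV (open_op ` ?I) (?E - S)"
    unfolding isGlb_UNIV_iff
  proof (intro conjI allI impI)
    show "\<forall>T\<in>open_op ` ?I. ?E - S \<le> T" using S(1) by (auto simp: isLub_UNIV_iff algebra_simps)
    fix L assume "\<forall>T\<in>open_op ` ?I. L \<le> T"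
    then have "\<forall>T\<in>(\<lambda>V. ?E - open_op V) ` ?I. T \<le> ?E - L" by auto
    then have "S \<le> ?E - L" using S(1) unfolding isLub_UNIV_iff by blast
    then show "L \<le> ?E - S" by (simp add: algebra_simps)
  qed
  ultimately show ?thesis by blast
qed

text \<open>Operator counterpart of \<open>outer\<close>. The choice records strong convergence
  along with the infimum, so that both are available for the same operator.\<close>

definition borel_op :: "'x set \<Rightarrow> ('e, 'e) regop" where
  "borel_op A = (SOME S. isGlb UNIV (open_op ` {V. openin X V \<and> A \<subseteq> V}) S \<and>
    (\<forall>x. ((\<lambda>V. regop_apply (open_op V) x) \<longlongrightarrow> regop_apply S x)
      (net_filter {V. openin X V \<and> A \<subseteq> V} (\<lambda>V W. W \<subseteq> V))))"

lemma borel_op: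
  assumes "A \<subseteq> topspace X"
  shows borel_op_glb_open_op: "isGlb UNIV (open_op ` {V. openin X V \<and> A \<subseteq> V}) (borel_op A)"
    and borel_op_tendsto_open_op: "((\<lambda>V. regop_apply (open_op V) x) \<longlongrightarrow> regop_apply (borel_op A) x)
      (net_filter {V. openin X V \<and> A \<subseteq> V} (\<lambda>V W. W \<subseteq> V))"
  using someI_ex[OF open_op_glb_exists[OF assms]] by (simp_all add: borel_op_def)

lemma borel_op_lower: "openin X V \<Longrightarrow> A \<subseteq> V \<Longrightarrow> borel_op A \<le> open_op V"
  using borel_op_glb_open_op[of A] openin_subset[of X V] by (simp add: isGlb_UNIV_iff)

lemma borel_op_greatest:
  "A \<subseteq> topspace X \<Longrightarrow> (\<And>V. openin X V \<Longrightarrow> A \<subseteq> V \<Longrightarrow> L \<le> open_op V) \<Longrightarrow> L \<le> borel_op A"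
  using borel_op_glb_open_op[of A] by (simp add: isGlb_UNIV_iff)

lemma borel_op_nonneg: "A \<subseteq> topspace X \<Longrightarrow> 0 \<le> borel_op A"
  by (rule borel_op_greatest) (auto simp: open_op_nonneg)

lemma borel_op_open: "openin X V \<Longrightarrow> borel_op V = open_op V"
  by (intro antisym borel_op_lower borel_op_greatest open_op_mono) (auto dest: openin_subset)

lemma borel_op_scalar_nonneg:
  "A \<subseteq> topspace X \<Longrightarrow> 0 \<le> x \<Longrightarrow> 0 \<le> x' \<Longrightarrow> 0 \<le> regop_apply x' (regop_apply (borel_op A) x)"
  by (intro regop_apply_nonneg borel_op_nonneg)

text \<open>Both sides are infima of the same values over open neighbourhoods; the right-hand one
  passes through the pairing because the net converges strongly.\<close>

lemma emeasure_borel_op: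
  assumes A: "A \<in> sets (borel_of X)" and x: "0 \<le> x" "0 \<le> x'"
  shows "emeasure (riesz x x') A = ennreal (regop_apply x' (regop_apply (borel_op A) x))"
proof -
  let ?I = "{V. openin X V \<and> A \<subseteq> V}"
  note AX = borel_of_subset[OF A]
  have "emeasure (riesz x x') A = (INF V\<in>?I. ennreal (regop_apply x' (regop_apply (open_op V) x)))"
    unfolding riesz(4)[OF x A] by (intro INF_cong refl emeasure_open_op x) simp
  also have "\<dots> = ennreal (regop_apply x' (regop_apply (borel_op A) x))"
  proof (rule INF_ennreal_net[OF directed_open_nbhds[OF AX]])
    show "((\<lambda>V. regop_apply x' (regop_apply (open_op V) x)) \<longlongrightarrow> regop_apply x' (regop_apply (borel_op A) x))
        (net_filter ?I (\<lambda>V W. W \<subseteq> V))"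
      by (rule bounded_linear.tendsto[OF bounded_linear_regop borel_op_tendsto_open_op[OF AX]])
    show "regop_apply x' (regop_apply (borel_op A) x) \<le> regop_apply x' (regop_apply (open_op V) x)"
      if "V \<in> ?I" for V
    proof -
      have "borel_op A \<le> open_op V" using that by (intro borel_op_lower) auto
      then show ?thesis using x by (rule regop_scalar_mono)
    qed
  qed
  finally show ?thesis .
qed

lemma measure_borel_op:
  assumes "A \<in> sets (borel_of X)" "0 \<le> x" "0 \<le> x'"
  shows "measure (riesz x x') A = regop_apply x' (regop_apply (borel_op A) x)"
  using emeasure_borel_op[OF assms] borel_op_scalar_nonneg[OF borel_of_subset[OF assms(1)] assms(2,3)]
  by (simp add: measure_def)

section \<open>The representing measure\<close>

definition rep :: "'x set \<Rightarrow> ('e, 'e) regop extd" where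
  "rep A = Fin (borel_op A)"

lemma borel_op_empty: "borel_op {} = 0"
proof (rule regop_eqI_scalar)
  fix x :: 'e and x' :: "('e, real) regop" assume "0 \<le> x" "0 \<le> x'"
  then show "regop_apply x' (regop_apply (borel_op {}) x) = regop_apply x' (regop_apply 0 x)"
    using measure_borel_op[of "{}" x x'] by simp
qed

lemma borel_op_sums_scalar:
  fixes A :: "nat \<Rightarrow> 'x set" and x' :: "('e, real) regop"
  assumes A: "range A \<subseteq> sets (borel_of X)" "disjoint_family A" and x: "0 \<le> x" "0 \<le> x'"
  shows "(\<lambda>n. regop_apply x' (regop_apply (borel_op (A n)) x)) sums
    regop_apply x' (regop_apply (borel_op (\<Union>n. A n)) x)"
proof -
  interpret finite_measure "riesz x x'" by (rule riesz(2)[OF x])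
  have "(\<lambda>n. measure (riesz x x') (A n)) sums measure (riesz x x') (\<Union>n. A n)"
    using A by (intro finite_measure_UNION) (simp_all add: riesz(1)[OF x])
  moreover have "A n \<in> sets (borel_of X)" for n using A by blast
  moreover have "(\<Union>n. A n) \<in> sets (borel_of X)" using A by blast
  ultimately show ?thesis using x by (simp add: measure_borel_op)
qed

text \<open>Additivity is inherited from the scalar measures: upper bounds of the partial sums are
  compared through the limits of the paired real partial sums.\<close>

lemma order_measure_rep: "order_measure (borel_of X) rep"
  unfolding order_measure_def
proof (intro conjI ballI allI impI)
  show "0 \<le> rep A" if "A \<in> sets (borel_of X)" for A
    using borel_op_nonneg[OF borel_of_subset[OF that]] by (simp add: rep_def zero_extd_def)
  show "rep {} = 0" by (simp add: rep_def zero_extd_def borel_op_empty)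
  fix A :: "nat \<Rightarrow> 'x set"
  assume A: "range A \<subseteq> sets (borel_of X)" "disjoint_family A"
  let ?S = "\<lambda>N. \<Sum>n\<le>N. borel_op (A n)"
  have An: "A n \<subseteq> topspace X" for n using A(1) borel_of_subset by blast
  have "isLub UNIV (range ?S) (borel_op (\<Union>n. A n))"
    unfolding isLub_UNIV_iff
  proof (intro conjI allI impI)
    have "?S N \<le> borel_op (\<Union>n. A n)" for N
    proof (rule regop_le_iff_scalar[THEN iffD2], intro allI impI)
      fix x :: 'e and x' :: "('e, real) regop" assume x: "0 \<le> x" "0 \<le> x'"
      show "regop_apply x' (regop_apply (?S N) x) \<le> regop_apply x' (regop_apply (borel_op (\<Union>n. A n)) x)"
        using borel_op_sums_scalar[OF A x] borel_op_scalar_nonneg[OF An x]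
        by (simp add: regop_apply_sum_left regop_apply_sum_right sums_partial_le)
    qed
    then show "\<forall>T\<in>range ?S. T \<le> borel_op (\<Union>n. A n)" by blast
    fix U assume "\<forall>T\<in>range ?S. T \<le> U"
    then have U: "?S N \<le> U" for N by blast
    show "borel_op (\<Union>n. A n) \<le> U"
    proof (rule regop_le_iff_scalar[THEN iffD2], intro allI impI)
      fix x :: 'e and x' :: "('e, real) regop" assume x: "0 \<le> x" "0 \<le> x'"
      have "(\<lambda>N. regop_apply x' (regop_apply (?S N) x)) \<longlonglongrightarrow>
          regop_apply x' (regop_apply (borel_op (\<Union>n. A n)) x)"
        using borel_op_sums_scalar[OF A x]
        by (simp add: sums_def_le regop_apply_sum_left regop_apply_sum_right)
      moreover have "regop_apply x' (regop_apply (?S N) x) \<le> regop_apply x' (regop_apply U x)" for N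
        using U[of N] x by (rule regop_scalar_mono)
      ultimately show "regop_apply x' (regop_apply (borel_op (\<Union>n. A n)) x) \<le> regop_apply x' (regop_apply U x)"
        by (intro LIMSEQ_le_const2) blast+
    qed
  qed
  moreover have "range (\<lambda>N. \<Sum>n\<le>N. rep (A n)) = Fin ` range ?S"
    by (simp add: rep_def sum_Fin image_image)
  ultimately show "isLub UNIV (range (\<lambda>N. \<Sum>n\<le>N. rep (A n))) (rep (\<Union>n. A n))"
    by (simp add: rep_def isLub_Fin_iff)
qed

sublocale rep: finite_operator_measure X rep
  by standard (simp_all add: order_measure_rep, simp add: rep_def is_finite_def)

lemma op_rep: "rep.op A = borel_op A"
  by (simp add: rep.op_def rep_def)

lemma scalar_rep:
  assumes "0 \<le> x" "0 \<le> x'"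
  shows "pairing_measure X rep x x' = riesz x x'"
  by (rule measure_eqI)
    (simp_all add: riesz(1) assms rep.emeasure_scalar op_rep emeasure_borel_op)

text \<open>Finiteness of the order integral of the absolute value is witnessed by
  \<open>\<pi>\<close> of the absolute value, which again belongs to
  \<open>C0_functions X\<close>.\<close>

lemma has_order_integral_C0:
  assumes f: "f \<in> C0_functions X"
  shows "has_order_integral (borel_of X) rep f (\<pi> f)"
proof (rule rep.has_order_integralI)
  show "f \<in> borel_measurable (borel_of X)"
    by (rule borel_measurable_continuous_map[OF C0_continuous[OF f]])
  show "0 \<le> \<pi> (\<lambda>x. \<bar>f x\<bar>)" by (rule pi_nonneg[OF C0_abs[OF f]]) simp
  fix x :: 'e and x' :: "('e, real) regop" assume x: "0 \<le> x" "0 \<le> x'"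
  show "(\<integral>\<^sup>+y. ennreal \<bar>f y\<bar> \<partial>pairing_measure X rep x x') = ennreal (pi_scalar x x' (\<lambda>x. \<bar>f x\<bar>))"
    using riesz(5,6)[OF x C0_abs[OF f]] by (subst nn_integral_eq_integral) (simp_all add: scalar_rep x)
  show "integral\<^sup>L (pairing_measure X rep x x') f = pi_scalar x x' f"
    using riesz(6)[OF x f] by (simp add: scalar_rep x)
qed

section \<open>Regularity of the representing measure\<close>

lemma borel_op_mono:
  assumes "A \<subseteq> B" "B \<subseteq> topspace X"
  shows "borel_op A \<le> borel_op B"
  using assms by (intro borel_op_greatest borel_op_lower) auto

text \<open>Every open set containing \<open>K\<close> contains the support, so
  \<open>\<pi> f\<close> lies below all the operators whose infimum is
  \<open>borel_op K\<close>.\<close>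

lemma pi_le_borel_op:
  assumes f: "subordinate X f V" and K: "fun_support X f \<subseteq> K" "K \<subseteq> topspace X"
  shows "\<pi> f \<le> borel_op K"
  using f K by (intro borel_op_greatest open_op_upper) (auto simp: subordinate_def)

lemma borel_op_le_pi:
  assumes f: "f \<in> C0_functions X" "\<And>y. 0 \<le> f y" and K: "K \<in> sets (borel_of X)" "\<And>y. y \<in> K \<Longrightarrow> f y = 1"
  shows "borel_op K \<le> \<pi> f"
proof (rule regop_le_iff_scalar[THEN iffD2], intro allI impI)
  fix x :: 'e and x' :: "('e, real) regop" assume x: "0 \<le> x" "0 \<le> x'"
  interpret finite_measure "riesz x x'" by (rule riesz(2)[OF x])
  have "measure (riesz x x') K = (\<integral>y. indicator K y \<partial>riesz x x')"
    using borel_of_subset[OF K(1)] sets_eq_imp_space_eq[OF riesz(1)[OF x]] by (simp add: Int_absorb2)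
  also have "\<dots> \<le> (\<integral>y. f y \<partial>riesz x x')"
    using f K by (intro integral_mono riesz(5)[OF x f(1)] integrable_real_indicator)
      (auto simp: riesz(1)[OF x] emeasure_eq_measure split: split_indicator)
  finally show "regop_apply x' (regop_apply (borel_op K) x) \<le> pi_scalar x x' f"
    using x K f by (simp add: measure_borel_op riesz(6))
qed

text \<open>Scalar integration bounds \<open>borel_op K\<close> by every dominating
  \<open>\<pi> f\<close>. Conversely, a Urysohn function for \<open>K\<close> inside an open
  \<open>V\<close> is dominating and its image lies below \<open>open_op V\<close>, so a lower bound
  of the \<open>\<pi> f\<close> is one of the \<open>open_op V\<close>.\<close>

lemma compact_glb:
  assumes K: "compactin X K"
  shows "isGlb UNIV {\<pi> f |f. dominates X K f} (borel_op K)"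
  unfolding isGlb_UNIV_iff
proof (intro conjI allI impI ballI)
  note KX = compactin_subset_topspace[OF K]
  show "borel_op K \<le> T" if "T \<in> {\<pi> f |f. dominates X K f}" for T
  proof -
    obtain f where f: "T = \<pi> f" "dominates X K f" using \<open>T \<in> _\<close> by blast
    then have C0: "f \<in> C0_functions X" using Cc_subset_C0 by (auto simp: dominates_def)
    have "0 \<le> f y" for y
      using f(2) C0_outside[OF C0, of y] by (cases "y \<in> topspace X") (auto simp: dominates_def)
    then show ?thesis unfolding f(1) using f(2) K
      by (intro borel_op_le_pi C0 borel_of_compact) (auto simp: dominates_def)
  qed
  fix L assume L: "\<forall>T\<in>{\<pi> f |f. dominates X K f}. L \<le> T"
  have "L \<le> open_op V" if V: "openin X V" "K \<subseteq> V" for V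
  proof -
    obtain f W where f: "subordinate X f V" "openin X W" "K \<subseteq> W" "\<And>x. x \<in> W \<Longrightarrow> f x = 1"
      by (rule Urysohn_compact_open[OF K V]) (rule that)
    have "\<forall>x\<in>K. f x = 1" using f(3,4) by blast
    then have "dominates X K f" using f(1) by (simp add: dominates_def subordinate_def)
    then have "L \<le> \<pi> f" using L by blast
    also have "\<dots> \<le> open_op V" by (rule open_op_upper[OF f(1)])
    finally show ?thesis .
  qed
  then show "L \<le> borel_op K" by (intro borel_op_greatest KX)
qed

text \<open>The supports of the functions subordinate to \<open>V\<close> are compact subsets of
  \<open>V\<close> whose operators already dominate the \<open>\<pi> f\<close>.\<close>

lemma open_lub_compact:
  assumes V: "openin X V"
  shows "isLub UNIV (borel_op ` {K. compactin X K \<and> K \<subseteq> V}) (borel_op V)"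
  unfolding isLub_UNIV_iff
proof (intro conjI allI impI)
  show "\<forall>T\<in>borel_op ` {K. compactin X K \<and> K \<subseteq> V}. T \<le> borel_op V"
    using openin_subset[OF V] by (auto intro: borel_op_mono)
  fix U assume U: "\<forall>T\<in>borel_op ` {K. compactin X K \<and> K \<subseteq> V}. T \<le> U"
  have "\<pi> f \<le> U" if f: "subordinate X f V" for f
  proof -
    have "\<pi> f \<le> borel_op (fun_support X f)"
      using f compactin_subset_topspace[OF subordinateD(5)[OF f]] by (intro pi_le_borel_op) auto
    also have "\<dots> \<le> U" using U subordinateD(5,6)[OF f] by blast
    finally show ?thesis .
  qed
  then show "borel_op V \<le> U" unfolding borel_op_open[OF V] by (rule open_op_least)
qed

lemma borel_glb_open:
  assumes A: "A \<subseteq> topspace X"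
  shows "isGlb UNIV (borel_op ` {V. openin X V \<and> A \<subseteq> V}) (borel_op A)"
proof -
  have "borel_op ` {V. openin X V \<and> A \<subseteq> V} = open_op ` {V. openin X V \<and> A \<subseteq> V}"
    by (intro image_cong refl borel_op_open) simp
  then show ?thesis using borel_op_glb_open_op[OF A] by simp
qed

lemma regular_rep: "regular_borel_measure X rep"
  unfolding regular_borel_measure_def
proof (intro conjI allI impI ballI)
  show "order_measure (borel_of X) rep" by (rule order_measure_rep)
  show "is_finite (rep K)" for K by (simp add: rep_def is_finite_def)
  show "isLub UNIV {rep K |K. compactin X K \<and> K \<subseteq> V} (rep V)" if "openin X V" for V
  proof -
    have "{rep K |K. compactin X K \<and> K \<subseteq> V} = Fin ` borel_op ` {K. compactin X K \<and> K \<subseteq> V}"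
      by (auto simp: rep_def)
    then show ?thesis using open_lub_compact[OF that] by (simp add: rep_def isLub_Fin_iff)
  qed
  show "isGlb UNIV {rep V |V. openin X V \<and> A \<subseteq> V} (rep A)" if A: "A \<in> sets (borel_of X)" for A
  proof -
    have "{rep V |V. openin X V \<and> A \<subseteq> V} = Fin ` borel_op ` {V. openin X V \<and> A \<subseteq> V}"
      by (auto simp: rep_def)
    moreover have "borel_op ` {V. openin X V \<and> A \<subseteq> V} \<noteq> {}" using borel_of_subset[OF A] by auto
    ultimately show ?thesis using borel_glb_open[OF borel_of_subset[OF A]] by (simp add: rep_def isGlb_Fin_iff)
  qed
qed

text \<open>Instead of pairing the order suprema and infima of operators, the proof reads regularity
  off the Riesz formulas for the scalar measure, with supports of subordinate functions as compact
  sets.\<close>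

lemma regular_pairing:
  assumes x: "0 \<le> x" "0 \<le> x'"
  shows "regular_borel_measure X (\<lambda>A. Fin (pairing rep x x' A))"
proof -
  interpret finite_measure "riesz x x'" by (rule riesz(2)[OF x])
  let ?p = "pairing rep x x'"
  have p: "?p A = regop_apply x' (regop_apply (borel_op A) x)" for A
    by (simp add: rep.pairing_eq op_rep)
  have p_nonneg: "0 \<le> ?p A" if "A \<subseteq> topspace X" for A
    unfolding p by (rule borel_op_scalar_nonneg[OF that x])
  have p_mono: "?p A \<le> ?p B" if "A \<subseteq> B" "B \<subseteq> topspace X" for A B
    unfolding p using borel_op_mono[OF that] x by (rule regop_scalar_mono)
  have em: "emeasure (riesz x x') A = ennreal (?p A)" if "A \<in> sets (borel_of X)" for A
    unfolding p by (rule emeasure_borel_op[OF that x])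
  have lub: "isLub UNIV (?p ` {K. compactin X K \<and> K \<subseteq> V}) (?p V)" if V: "openin X V" for V
    unfolding isLub_UNIV_iff
  proof (intro conjI allI impI)
    show "\<forall>r\<in>?p ` {K. compactin X K \<and> K \<subseteq> V}. r \<le> ?p V"
      using openin_subset[OF V] by (auto intro: p_mono)
    fix b assume b: "\<forall>r\<in>?p ` {K. compactin X K \<and> K \<subseteq> V}. r \<le> b"
    \<comment> \<open>\<open>ennreal\<close> truncates negative numbers, so the final comparison
      requires \<open>b \<ge> 0\<close>; the empty compact set gives it.\<close>
    have "0 \<le> b" using b p_nonneg[of "{}"] by (force intro: order_trans)
    have "ennreal (?p V) = (SUP f\<in>{f. subordinate X f V}. ennreal (pi_scalar x x' f))"
      using V em[of V] riesz(3)[OF x V] by (simp add: borel_of_open)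
    also have "\<dots> \<le> ennreal b"
    proof (intro SUP_least ennreal_leI)
      fix f assume "f \<in> {f. subordinate X f V}"
      then have f: "subordinate X f V" by simp
      have "\<pi> f \<le> borel_op (fun_support X f)"
        using f compactin_subset_topspace[OF subordinateD(5)[OF f]] by (intro pi_le_borel_op) auto
      then have "pi_scalar x x' f \<le> ?p (fun_support X f)" unfolding p
        using x by (rule regop_scalar_mono)
      also have "\<dots> \<le> b" using b subordinateD(5,6)[OF f] by blast
      finally show "pi_scalar x x' f \<le> b" .
    qed
    finally show "?p V \<le> b" using \<open>0 \<le> b\<close> by simp
  qed
  have glb: "isGlb UNIV (?p ` {V. openin X V \<and> A \<subseteq> V}) (?p A)" if A: "A \<in> sets (borel_of X)" for A
    unfolding isGlb_UNIV_iff
  proof (intro conjI allI impI)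
    show "\<forall>r\<in>?p ` {V. openin X V \<and> A \<subseteq> V}. ?p A \<le> r" using openin_subset by (auto intro: p_mono)
    fix b assume b: "\<forall>r\<in>?p ` {V. openin X V \<and> A \<subseteq> V}. b \<le> r"
    have "ennreal b \<le> (INF V\<in>{V. openin X V \<and> A \<subseteq> V}. emeasure (riesz x x') V)"
      using b by (intro INF_greatest) (auto simp: em borel_of_open intro!: ennreal_leI)
    also have "\<dots> = ennreal (?p A)" using em[OF A] riesz(4)[OF x A] by simp
    finally show "b \<le> ?p A" using p_nonneg[OF borel_of_subset[OF A]] by (simp add: ennreal_le_iff)
  qed
  show ?thesis unfolding regular_borel_measure_def
  proof (intro conjI allI impI ballI)
    show "order_measure (borel_of X) (\<lambda>A. Fin (?p A))"
      unfolding order_measure_def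
    proof (intro conjI ballI allI impI)
      show "0 \<le> Fin (?p A)" if "A \<in> sets (borel_of X)" for A
        using p_nonneg[OF borel_of_subset[OF that]] by (simp add: zero_extd_def)
      show "Fin (?p {}) = 0" by (simp add: zero_extd_def p borel_op_empty)
      fix A :: "nat \<Rightarrow> 'x set" assume A: "range A \<subseteq> sets (borel_of X)" "disjoint_family A"
      have s: "(\<lambda>n. ?p (A n)) sums ?p (\<Union>n. A n)" unfolding p by (rule borel_op_sums_scalar[OF A x])
      have nn: "0 \<le> ?p (A n)" for n using A borel_of_subset by (intro p_nonneg) blast
      have "isLub UNIV (range (\<lambda>N. \<Sum>n\<le>N. ?p (A n))) (?p (\<Union>n. A n))"
        unfolding isLub_UNIV_iff
      proof (intro conjI allI impI)
        show "\<forall>r\<in>range (\<lambda>N. \<Sum>n\<le>N. ?p (A n)). r \<le> ?p (\<Union>n. A n)"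
          using sums_partial_le[OF s nn] by blast
        fix b assume "\<forall>r\<in>range (\<lambda>N. \<Sum>n\<le>N. ?p (A n)). r \<le> b"
        then show "?p (\<Union>n. A n) \<le> b" using s by (intro LIMSEQ_le_const2[OF s[unfolded sums_def_le]]) auto
      qed
      moreover have "range (\<lambda>N. \<Sum>n\<le>N. Fin (?p (A n))) = Fin ` range (\<lambda>N. \<Sum>n\<le>N. ?p (A n))"
        by (simp add: sum_Fin image_image)
      ultimately show "isLub UNIV (range (\<lambda>N. \<Sum>n\<le>N. Fin (?p (A n)))) (Fin (?p (\<Union>n. A n)))"
        by (simp add: isLub_Fin_iff)
    qed
    show "is_finite (Fin (?p K))" for K by (simp add: is_finite_def)
    show "isLub UNIV {Fin (?p K) |K. compactin X K \<and> K \<subseteq> V} (Fin (?p V))" if "openin X V" for V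
    proof -
      have "{Fin (?p K) |K. compactin X K \<and> K \<subseteq> V} = Fin ` ?p ` {K. compactin X K \<and> K \<subseteq> V}" by auto
      then show ?thesis using lub[OF that] by (simp add: isLub_Fin_iff)
    qed
    show "isGlb UNIV {Fin (?p V) |V. openin X V \<and> A \<subseteq> V} (Fin (?p A))" if A: "A \<in> sets (borel_of X)" for A
    proof -
      have "{Fin (?p V) |V. openin X V \<and> A \<subseteq> V} = Fin ` ?p ` {V. openin X V \<and> A \<subseteq> V}" by auto
      moreover have "?p ` {V. openin X V \<and> A \<subseteq> V} \<noteq> {}" using borel_of_subset[OF A] by auto
      ultimately show ?thesis using glb[OF A] by (simp add: isGlb_Fin_iff)
    qed
  qed
qed

end

section \<open>Uniqueness of the representing measure\<close>

lemma order_measure_isLub: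
  fixes A :: "nat \<Rightarrow> 'x set"
  assumes "order_measure M \<nu>" "range A \<subseteq> sets M" "disjoint_family A"
  shows "isLub UNIV (range (\<lambda>N. \<Sum>n\<le>N. \<nu> (A n))) (\<nu> (\<Union>n. A n))"
  using assms by (simp add: order_measure_def)

lemma order_measure_mono:
  assumes \<nu>: "order_measure M \<nu>" and AB: "A \<in> sets M" "B \<in> sets M" "A \<subseteq> B"
  shows "\<nu> A \<le> \<nu> B"
proof -
  \<comment> \<open>The first partial sum is \<open>\<nu> A\<close> alone, and it lies below the
    supremum; no subtraction in the extended space is involved.\<close>
  let ?A = "\<lambda>n::nat. if n = 0 then A else if n = 1 then B - A else {}"
  have "range ?A \<subseteq> sets M" "disjoint_family ?A" using AB by (auto simp: disjoint_family_on_def)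
  then have "isLub UNIV (range (\<lambda>N. \<Sum>n\<le>N. \<nu> (?A n))) (\<nu> (\<Union>n. ?A n))"
    by (rule order_measure_isLub[OF \<nu>])
  then have "(\<Sum>n\<le>0. \<nu> (?A n)) \<le> \<nu> (\<Union>n. ?A n)" by (simp only: isLub_UNIV_iff) blast
  moreover have "(\<Union>n. ?A n) = B" using AB(3) by (auto split: if_splits)
  ultimately show ?thesis by simp
qed

context
  fixes M :: "'x measure" and \<nu> :: "'x set \<Rightarrow> 'f::ordered_real_vector extd" and K :: "'x set"
  assumes K: "K \<in> sets M"
begin

lemma order_measure_restrict:
  assumes "order_measure M \<nu>"
  shows "order_measure M (\<lambda>A. \<nu> (A \<inter> K))"
  unfolding order_measure_def
proof (intro conjI ballI allI impI)
  show "0 \<le> \<nu> (A \<inter> K)" if "A \<in> sets M" for A using assms that K by (simp add: order_measure_def)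
  show "\<nu> ({} \<inter> K) = 0" using assms by (simp add: order_measure_def)
  fix A :: "nat \<Rightarrow> 'x set" assume A: "range A \<subseteq> sets M" "disjoint_family A"
  have "range (\<lambda>n. A n \<inter> K) \<subseteq> sets M" "disjoint_family (\<lambda>n. A n \<inter> K)"
    using A K by (auto simp: disjoint_family_on_def)
  then have "isLub UNIV (range (\<lambda>N. \<Sum>n\<le>N. \<nu> (A n \<inter> K))) (\<nu> (\<Union>n. A n \<inter> K))"
    by (rule order_measure_isLub[OF assms])
  moreover have "(\<Union>n. A n \<inter> K) = (\<Union>n. A n) \<inter> K" by blast
  ultimately show "isLub UNIV (range (\<lambda>N. \<Sum>n\<le>N. \<nu> (A n \<inter> K))) (\<nu> ((\<Union>n. A n) \<inter> K))" by simp
qed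

text \<open>Values of \<open>\<nu>\<close> on the zero set of \<open>\<phi>\<close>, possibly infinite, do not contribute, since \<open>0 \<cdot> \<infinity> = 0\<close>.\<close>

lemma elementary_integral_restrict:
  assumes "\<And>y. y \<in> space M \<Longrightarrow> y \<notin> K \<Longrightarrow> \<phi> y = 0"
  shows "elementary_integral M (\<lambda>A. \<nu> (A \<inter> K)) \<phi> = elementary_integral M \<nu> \<phi>"
  unfolding elementary_integral_def
proof (intro sum.cong refl)
  have zero: "0 *\<^sub>R a = Fin 0" for a :: "'f extd" by (cases a) auto
  fix r
  show "r *\<^sub>R \<nu> (\<phi> -` {r} \<inter> space M \<inter> K) = r *\<^sub>R \<nu> (\<phi> -` {r} \<inter> space M)"
  proof (cases "r = 0")
    case False
    then have "\<phi> -` {r} \<inter> space M \<inter> K = \<phi> -` {r} \<inter> space M" using assms by auto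
    then show ?thesis by simp
  qed (simp add: zero)
qed

lemma order_nn_integral_restrict:
  assumes "\<And>y. y \<in> space M \<Longrightarrow> y \<notin> K \<Longrightarrow> g y = 0"
  shows "order_nn_integral M (\<lambda>A. \<nu> (A \<inter> K)) g = order_nn_integral M \<nu> g"
proof -
  have "elementary_integral M (\<lambda>A. \<nu> (A \<inter> K)) (\<phi> n) = elementary_integral M \<nu> (\<phi> n)"
    if \<phi>: "elementary_approx M \<phi> g" for \<phi> n
  proof (rule elementary_integral_restrict)
    fix y assume y: "y \<in> space M" "y \<notin> K"
    \<comment> \<open>Approximants lie below \<open>g\<close>, hence vanish wherever
      \<open>g\<close> does.\<close>
    have "ennreal (\<phi> n y) \<le> (SUP n. ennreal (\<phi> n y))" by (rule SUP_upper) simp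
    also have "\<dots> = 0" using \<phi> y assms by (simp add: elementary_approx_def)
    finally show "\<phi> n y = 0" using \<phi> y by (simp add: elementary_approx_def ennreal_eq_0_iff antisym)
  qed
  then have "(elementary_approx M \<phi> g \<and> isLub UNIV (range (\<lambda>n. elementary_integral M (\<lambda>A. \<nu> (A \<inter> K)) (\<phi> n))) a) =
      (elementary_approx M \<phi> g \<and> isLub UNIV (range (\<lambda>n. elementary_integral M \<nu> (\<phi> n))) a)" for \<phi> a
    by auto
  then show ?thesis by (simp add: order_nn_integral_def)
qed

lemma has_order_integral_restrict:
  assumes "\<And>y. y \<in> space M \<Longrightarrow> y \<notin> K \<Longrightarrow> f y = 0"
  shows "has_order_integral M (\<lambda>A. \<nu> (A \<inter> K)) f T \<longleftrightarrow> has_order_integral M \<nu> f T"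
  using assms
  by (simp add: has_order_integral_def order_L1_def order_integral_def order_nn_integral_restrict)

end

context lch_space
begin

context
  fixes \<nu> :: "'x set \<Rightarrow> ('e::kb_space, 'e) regop extd" and f :: "'x \<Rightarrow> real" and T
  assumes \<nu>: "regular_borel_measure X \<nu>" and f: "f \<in> Cc_functions X" "\<And>y. 0 \<le> f y \<and> f y \<le> 1"
    and T: "has_order_integral (borel_of X) \<nu> f T"
begin

text \<open>\<open>\<nu>\<close> may be infinite on noncompact sets, but it is finite on the support
  of \<open>f\<close>; cutting it down there gives a finite operator measure with the same integral
  of \<open>f\<close>, to which the scalar theory applies.\<close>

lemma restrict_support:
  "finite_operator_measure X (\<lambda>A. \<nu> (A \<inter> fun_support X f))"
  "has_order_integral (borel_of X) (\<lambda>A. \<nu> (A \<inter> fun_support X f)) f T"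
proof -
  let ?K = "fun_support X f"
  have K: "compactin X ?K" using f(1) by (simp add: Cc_functions_def)
  note KB = borel_of_compact[OF K]
  have om: "order_measure (borel_of X) \<nu>" using \<nu> by (simp add: regular_borel_measure_def)
  show "finite_operator_measure X (\<lambda>A. \<nu> (A \<inter> ?K))"
  proof
    show "order_measure (borel_of X) (\<lambda>A. \<nu> (A \<inter> ?K))" by (rule order_measure_restrict[OF KB om])
    fix A assume "A \<in> sets (borel_of X)"
    then have "\<nu> (A \<inter> ?K) \<le> \<nu> ?K" using KB by (intro order_measure_mono[OF om]) auto
    moreover have "is_finite (\<nu> ?K)" using \<nu> K by (simp add: regular_borel_measure_def)
    ultimately show "is_finite (\<nu> (A \<inter> ?K))" by (auto simp: is_finite_iff le_Fin_iff)
  qed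
  show "has_order_integral (borel_of X) (\<lambda>A. \<nu> (A \<inter> ?K)) f T"
    using T fun_support_outside[OF f(1)] by (subst has_order_integral_restrict[OF KB]) auto
qed

text \<open>Integration of \<open>f \<le> 1\<close> against the restricted measure, whose total
  value is \<open>\<nu> (fun_support X f)\<close>.\<close>

lemma integral_le_order_measure: "Fin T \<le> \<nu> (fun_support X f)"
proof -
  let ?K = "fun_support X f"
  interpret r: finite_operator_measure X "\<lambda>A. \<nu> (A \<inter> ?K)" by (rule restrict_support)
  have L1: "f \<in> r.L1" and oint: "r.oint f = T"
    using restrict_support(2) by (simp_all add: has_order_integral_def)
  have KX: "?K \<subseteq> topspace X" by (simp add: fun_support_def closure_of_subset_topspace)
  have top: "topspace X \<in> sets (borel_of X)" by (intro borel_of_open) simp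
  have "T \<le> r.op (topspace X)"
  proof (rule regop_le_iff_scalar[THEN iffD2], intro allI impI)
    fix x :: 'e and x' :: "('e, real) regop" assume x: "0 \<le> x" "0 \<le> x'"
    interpret finite_measure "r.scalar x x'" by (rule r.finite_scalar[OF x])
    have "integral\<^sup>L (r.scalar x x') f \<le> (\<integral>y. 1 \<partial>r.scalar x x')"
      using f(2) by (intro integral_mono r.L1_scalar[OF L1 x]) auto
    also have "\<dots> = r.pair x' (r.op (topspace X)) x"
      using r.emeasure_scalar[OF x top] r.pair_nonneg[OF x r.op_nonneg[OF top]] by (simp add: measure_def)
    finally show "r.pair x' T x \<le> r.pair x' (r.op (topspace X)) x"
      using r.L1_scalar(2)[OF L1 x] by (simp add: oint)
  qed
  then have "Fin T \<le> Fin (r.op (topspace X))" by simp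
  also have "\<dots> = \<nu> (topspace X \<inter> ?K)" by (rule r.Fin_op[OF top, symmetric])
  also have "topspace X \<inter> ?K = ?K" using KX by blast
  finally show ?thesis .
qed

text \<open>Integration of the indicator of \<open>C\<close>, which is at most \<open>f\<close>;
  \<open>C\<close> lies in the support because \<open>f = 1\<close> there, so the restriction does
  not change \<open>\<nu> C\<close>.\<close>

lemma order_measure_le_integral:
  assumes C: "compactin X C" "\<And>y. y \<in> C \<Longrightarrow> f y = 1"
  shows "\<nu> C \<le> Fin T"
proof -
  let ?K = "fun_support X f"
  interpret r: finite_operator_measure X "\<lambda>A. \<nu> (A \<inter> ?K)" by (rule restrict_support)
  have L1: "f \<in> r.L1" and oint: "r.oint f = T"
    using restrict_support(2) by (simp_all add: has_order_integral_def)
  note CB = borel_of_compact[OF C(1)]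
  have CK: "C \<subseteq> ?K" using C(2) fun_support_outside[OF f(1)] by fastforce
  have "r.op C \<le> T"
  proof (rule regop_le_iff_scalar[THEN iffD2], intro allI impI)
    fix x :: 'e and x' :: "('e, real) regop" assume x: "0 \<le> x" "0 \<le> x'"
    interpret finite_measure "r.scalar x x'" by (rule r.finite_scalar[OF x])
    have "r.pair x' (r.op C) x = measure (r.scalar x x') C"
      using r.emeasure_scalar[OF x CB] r.pair_nonneg[OF x r.op_nonneg[OF CB]] by (simp add: measure_def)
    also have "\<dots> = (\<integral>y. indicator C y \<partial>r.scalar x x')"
      using borel_of_subset[OF CB] by (simp add: Int_absorb2)
    also have "\<dots> \<le> integral\<^sup>L (r.scalar x x') f"
      using f(2) C(2) CB by (intro integral_mono r.L1_scalar[OF L1 x] integrable_real_indicator)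
        (auto simp: emeasure_eq_measure split: split_indicator)
    finally show "r.pair x' (r.op C) x \<le> r.pair x' T x"
      using r.L1_scalar(2)[OF L1 x] by (simp add: oint)
  qed
  moreover have "\<nu> C = Fin (r.op C)" using r.Fin_op[OF CB] CK by (simp add: Int_absorb2)
  ultimately show ?thesis by simp
qed

end

end

context positive_C0_operator
begin

text \<open>On an open set \<open>V\<close> the values are squeezed through the operators
  \<open>\<pi> f\<close>: those with \<open>f\<close> subordinate to \<open>V\<close> lie below
  \<open>\<nu> V\<close> and have supremum \<open>rep V\<close>, while inner regularity of
  \<open>\<nu>\<close> and Urysohn functions give the reverse inequality. Outer regularity transfers
  the equality to Borel sets.\<close>

lemma rep_unique:
  assumes \<nu>: "regular_borel_measure X \<nu>"
    and int: "\<And>f. f \<in> Cc_functions X \<Longrightarrow> has_order_integral (borel_of X) \<nu> f (\<pi> f)"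
    and A: "A \<in> sets (borel_of X)"
  shows "\<nu> A = rep A"
proof -
  have "\<nu> V = rep V" if V: "openin X V" for V
  proof (rule antisym)
    have om: "order_measure (borel_of X) \<nu>"
      and lub: "isLub UNIV {\<nu> K |K. compactin X K \<and> K \<subseteq> V} (\<nu> V)"
      using \<nu> V by (simp_all add: regular_borel_measure_def)
    have up: "Fin (\<pi> f) \<le> \<nu> V" if f: "subordinate X f V" for f
    proof -
      note fD = subordinateD[OF f]
      have "Fin (\<pi> f) \<le> \<nu> (fun_support X f)"
        using integral_le_order_measure[OF \<nu> fD(1) _ int[OF fD(1)]] fD(3,4) by blast
      also have "\<dots> \<le> \<nu> V" using fD V by (intro order_measure_mono[OF om]) auto
      finally show ?thesis .
    qed
    show "rep V \<le> \<nu> V"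
    \<comment> \<open>\<open>open_op_least\<close> compares finite operators only; for
      \<open>\<nu> V = Infty\<close> there is nothing to show.\<close>
    proof (cases "\<nu> V")
      case (Fin U)
      then show ?thesis using up by (auto simp: rep_def borel_op_open[OF V] intro!: open_op_least)
    qed simp
    have "\<nu> K \<le> rep V" if K: "compactin X K" "K \<subseteq> V" for K
    proof -
      obtain f W where f: "subordinate X f V" "openin X W" "K \<subseteq> W" "\<And>x. x \<in> W \<Longrightarrow> f x = 1"
        by (rule Urysohn_compact_open[OF K(1) V K(2)]) (rule that)
      note fD = subordinateD[OF f(1)]
      have "\<nu> K \<le> Fin (\<pi> f)"
        using order_measure_le_integral[OF \<nu> fD(1) _ int[OF fD(1)] K(1)] fD(3,4) f(3,4) by blast
      also have "\<dots> \<le> rep V" by (simp add: rep_def borel_op_open[OF V] open_op_upper[OF f(1)])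
      finally show ?thesis .
    qed
    then have "\<forall>a\<in>{\<nu> K |K. compactin X K \<and> K \<subseteq> V}. a \<le> rep V" by blast
    then show "\<nu> V \<le> rep V" using lub by (simp only: isLub_UNIV_iff)
  qed
  then have "{\<nu> V |V. openin X V \<and> A \<subseteq> V} = {rep V |V. openin X V \<and> A \<subseteq> V}" by force
  moreover have "isGlb UNIV {\<nu> V |V. openin X V \<and> A \<subseteq> V} (\<nu> A)"
    using \<nu> A by (simp add: regular_borel_measure_def)
  moreover have "isGlb UNIV {rep V |V. openin X V \<and> A \<subseteq> V} (rep A)"
    using regular_rep A by (simp add: regular_borel_measure_def)
  ultimately show ?thesis by (simp add: isGlb_UNIV_iff antisym)
qed

lemma borel_op_sums:
  "range A \<subseteq> sets (borel_of X) \<Longrightarrow> disjoint_family A \<Longrightarrow>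
    (\<lambda>n. regop_apply (borel_op (A n)) x) sums regop_apply (borel_op (\<Union>n. A n)) x"
  using rep.op_sums[of A x] by (simp add: op_rep)

end


section \<open>Closed subspaces in the strong operator topology\<close>

lemma regop_blinfun_apply [simp]: "blinfun_apply (regop_blinfun T) = regop_apply T"
  by (rule regop_blinfun.rep_eq)

lemma regop_blinfun_linear:
  "regop_blinfun (S + T) = regop_blinfun S + regop_blinfun T"
  "regop_blinfun (S - T) = regop_blinfun S - regop_blinfun T"
  "regop_blinfun (r *\<^sub>R T) = r *\<^sub>R regop_blinfun T"
  "regop_blinfun 0 = 0"
  by (rule blinfun_eqI; simp add: blinfun.bilinear_simps)+

lemma regop_blinfun_sum: "regop_blinfun (\<Sum>i\<in>I. T i) = (\<Sum>i\<in>I. regop_blinfun (T i))"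
  by (induction I rule: infinite_finite_induct) (auto simp: regop_blinfun_linear)

text \<open>The strong operator topology is pulled back from the product topology on functions, so
  norm convergence at each vector is convergence in it and cannot leave a closed set.\<close>

lemma sot_closed_tendsto:
  fixes T :: "'i \<Rightarrow> 'a::real_normed_vector \<Rightarrow>\<^sub>L 'b::real_normed_vector"
  assumes W: "closedin strong_operator_topology W" and F: "F \<noteq> bot"
    and T: "\<forall>\<^sub>F i in F. T i \<in> W" "\<And>x. ((\<lambda>i. blinfun_apply (T i) x) \<longlongrightarrow> blinfun_apply S x) F"
  shows "S \<in> W"
proof (rule ccontr)
  assume "S \<notin> W"
  have "openin strong_operator_topology (- W)"
    using W by (simp add: closedin_def strong_operator_topology_topspace Compl_eq_Diff_UNIV)
  then obtain U where U: "open U" "- W = blinfun_apply -` U"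
    by (auto simp: strong_operator_topology_def openin_pullback_topology)
  have "limitin (product_topology (\<lambda>i. euclidean) UNIV) (\<lambda>i. blinfun_apply (T i)) (blinfun_apply S) F"
    unfolding limitin_componentwise using T(2) by simp
  then have "((\<lambda>i. blinfun_apply (T i)) \<longlongrightarrow> blinfun_apply S) F"
    by (simp add: euclidean_product_topology)
  moreover have "blinfun_apply S \<in> U" using U(2) \<open>S \<notin> W\<close> by blast
  ultimately have "\<forall>\<^sub>F i in F. blinfun_apply (T i) \<in> U" using U(1) by (simp add: topological_tendstoD)
  then have "\<forall>\<^sub>F i in F. False" using T(1) by eventually_elim (use U(2) in blast)
  then show False using F by (simp add: trivial_limit_def)
qed

lemma sot_closed_span:
  fixes S :: "('e::banach_lattice, 'e) regop set"
  shows subspace_sot_closed_span: "subspace (sot_closed_span S)"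
    and closedin_sot_closed_span: "closedin strong_operator_topology (sot_closed_span S)"
    and sot_closed_span_superset: "T \<in> S \<Longrightarrow> regop_blinfun T \<in> sot_closed_span S"
proof -
  have "(\<lambda>W. subspace W \<and> closedin strong_operator_topology W) (sot_closed_span S)"
    unfolding sot_closed_span_def
  proof (rule hull_in)
    fix \<W> :: "('e \<Rightarrow>\<^sub>L 'e) set set"
    assume *: "\<forall>W\<in>\<W>. subspace W \<and> closedin strong_operator_topology W"
    show "subspace (\<Inter>\<W>) \<and> closedin strong_operator_topology (\<Inter>\<W>)"
    proof (cases "\<W> = {}")
      case True
      have "closedin strong_operator_topology (UNIV :: ('e \<Rightarrow>\<^sub>L 'e) set)"
        by (metis closedin_topspace strong_operator_topology_topspace)
      then show ?thesis using True by simp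
    next
      case False
      then show ?thesis using * by (auto intro!: subspace_Inter closedin_Inter)
    qed
  qed
  then show "subspace (sot_closed_span S)" "closedin strong_operator_topology (sot_closed_span S)"
    by auto
  show "T \<in> S \<Longrightarrow> regop_blinfun T \<in> sot_closed_span S"
    unfolding sot_closed_span_def using hull_subset by fast
qed

lemma sot_closed_span_subsetI:
  assumes "\<And>T. T \<in> S \<Longrightarrow> regop_blinfun T \<in> sot_closed_span S'"
  shows "sot_closed_span S \<subseteq> sot_closed_span S'"
  unfolding sot_closed_span_def[of S]
  by (rule hull_minimal) (use assms subspace_sot_closed_span closedin_sot_closed_span in auto)

lemma sot_closed_span_mono: "S \<subseteq> S' \<Longrightarrow> sot_closed_span S \<subseteq> sot_closed_span S'"
  by (intro sot_closed_span_subsetI sot_closed_span_superset) blast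

text \<open>Suprema and infima of operators enter the closed spans through this lemma, since the
  monotone nets converge at each vector.\<close>

lemma sot_closed_span_tendsto:
  assumes "F \<noteq> bot" "\<forall>\<^sub>F i in F. regop_blinfun (T i) \<in> sot_closed_span S"
    "\<And>x. ((\<lambda>i. regop_apply (T i) x) \<longlongrightarrow> regop_apply U x) F"
  shows "regop_blinfun U \<in> sot_closed_span S"
  by (rule sot_closed_tendsto[OF closedin_sot_closed_span assms(1,2)]) (simp add: assms(3))

section \<open>Order integrals inside the closed span of the measure\<close>

context finite_operator_measure
begin

text \<open>Elementary operators are finite linear combinations of values of the measure and
  converge strongly to the order integral.\<close>

lemma nn_int_in_sot_closed_span:
  assumes g: "g \<in> borel_measurable (borel_of X)" and T: "nn_int g = Fin T"
  shows "regop_blinfun T \<in> sot_closed_span {op A |A. A \<in> sets (borel_of X)}"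
proof -
  let ?W = "sot_closed_span {op A |A. A \<in> sets (borel_of X)}"
  obtain \<phi> where \<phi>: "elementary_approx (borel_of X) \<phi> g"
    "\<And>x. (\<lambda>n. regop_apply (elementary (\<phi> n)) x) \<longlonglongrightarrow> regop_apply T x"
    by (rule nn_int_finiteD[OF g T]) (rule that)
  have "regop_blinfun (elementary (\<phi> n)) \<in> ?W" for n
  proof -
    have "op (\<phi> n -` {r} \<inter> topspace X) \<in> {op A |A. A \<in> sets (borel_of X)}" for r
      using level_sets[OF elementary_approxD(1)[OF \<phi>(1)]] by blast
    then show ?thesis unfolding elementary_def regop_blinfun_sum regop_blinfun_linear
      by (intro subspace_sum subspace_scale subspace_sot_closed_span sot_closed_span_superset)
  qed
  then show ?thesis by (intro sot_closed_span_tendsto[OF _ _ \<phi>(2)]) auto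
qed

lemma oint_in_sot_closed_span:
  assumes f: "f \<in> L1"
  shows "regop_blinfun (oint f) \<in> sot_closed_span {op A |A. A \<in> sets (borel_of X)}"
proof -
  have m: "f \<in> borel_measurable (borel_of X)" using f by (simp add: order_L1_def)
  obtain S T where ST: "nn_int (\<lambda>y. ennreal (max 0 (f y))) = Fin S"
    "nn_int (\<lambda>y. ennreal (max 0 (- f y))) = Fin T" "oint f = S - T" using L1_parts[OF f] .
  have "regop_blinfun S \<in> sot_closed_span {op A |A. A \<in> sets (borel_of X)}"
    by (rule nn_int_in_sot_closed_span[OF _ ST(1)]) (use m in measurable)
  moreover have "regop_blinfun T \<in> sot_closed_span {op A |A. A \<in> sets (borel_of X)}"
    by (rule nn_int_in_sot_closed_span[OF _ ST(2)]) (use m in measurable)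
  ultimately show ?thesis
    unfolding ST(3) regop_blinfun_linear by (intro subspace_diff subspace_sot_closed_span)
qed

text \<open>A bounded function is dominated by a constant, whose order integral is a multiple of
  \<open>op (topspace X)\<close>.\<close>

lemma bounded_borel_subset_L1: "bounded_borel_functions X \<subseteq> L1"
proof
  fix f assume "f \<in> bounded_borel_functions X"
  then have f: "f \<in> borel_measurable (borel_of X)" and "bounded (f ` topspace X)"
    by (simp_all add: bounded_borel_functions_def)
  then obtain b where "\<forall>r\<in>f ` topspace X. \<bar>r\<bar> \<le> b" by (auto simp: bounded_iff)
  then have c: "\<bar>f y\<bar> \<le> max b 0" if "y \<in> topspace X" for y using that by fastforce
  have top: "topspace X \<in> sets (borel_of X)" by (intro borel_of_open) simp
  have "nn_int (\<lambda>y. ennreal (max b 0)) = Fin (max b 0 *\<^sub>R op (topspace X))"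
  proof (rule nn_int_eqI)
    show "0 \<le> max b 0 *\<^sub>R op (topspace X)" by (intro scaleR_nonneg_nonneg op_nonneg top) simp
    fix x :: 'e and x' :: "('e, real) regop" assume x: "0 \<le> x" "0 \<le> x'"
    show "(\<integral>\<^sup>+y. ennreal (max b 0) \<partial>scalar x x') = ennreal (pair x' (max b 0 *\<^sub>R op (topspace X)) x)"
      using emeasure_scalar[OF x top] pair_nonneg[OF x op_nonneg[OF top]] by (simp add: ennreal_mult)
  qed simp
  then have "\<exists>S. nn_int (\<lambda>y. ennreal \<bar>f y\<bar>) = Fin S"
    using f c by (intro nn_int_dominated) (auto intro!: ennreal_leI)
  then show "f \<in> L1" using f by (simp add: order_L1_def is_finite_iff)
qed

text \<open>Each value of the measure becomes an integral of a bounded Borel function, which puts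
  the span of the measure inside the span of these integrals.\<close>

lemma oint_indicator:
  assumes A: "A \<in> sets (borel_of X)"
  shows "indicator A \<in> bounded_borel_functions X" "oint (indicator A) = op A"
proof -
  have "bounded (indicator A ` topspace X :: real set)"
    by (rule bounded_subset[of "{0..1}"]) (auto split: split_indicator)
  then show bb: "indicator A \<in> bounded_borel_functions X"
    using A borel_of_subset[OF A]
    by (auto simp: bounded_borel_functions_def real_functions_def split: split_indicator)
  then have L1: "indicator A \<in> L1" using bounded_borel_subset_L1 by blast
  have "pair x' (op A) x = integral\<^sup>L (scalar x x') (indicator A)" if x: "0 \<le> x" "0 \<le> x'" for x x'
    using emeasure_scalar[OF x A] pair_nonneg[OF x op_nonneg[OF A]] borel_of_subset[OF A]
    by (simp add: measure_def Int_absorb2)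
  then show "oint (indicator A) = op A" using int_eq_iff[OF L1, of "op A"] by simp
qed

end

context positive_C0_operator
begin

lemma open_op_in_span_pi: "regop_blinfun (open_op V) \<in> sot_closed_span (\<pi> ` Cc_functions X)"
proof (rule sot_closed_span_tendsto[OF net_filter_neq_bot[OF directed_subordinate] _ open_op_tendsto])
  show "\<forall>\<^sub>F f in net_filter {f. subordinate X f V} (\<le>). regop_blinfun (\<pi> f) \<in> sot_closed_span (\<pi> ` Cc_functions X)"
    by (rule eventually_net_filterI[OF directed_subordinate])
      (auto intro: sot_closed_span_superset dest: subordinateD)
qed

lemma directed_compact: "directed {K. compactin X K \<and> K \<subseteq> V} (\<subseteq>)"
  unfolding directed_def
proof (intro conjI ballI impI)
  show "{K. compactin X K \<and> K \<subseteq> V} \<noteq> {}" by (auto intro: exI[of _ "{}"])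
  show "J \<subseteq> L" if "J \<subseteq> K" "K \<subseteq> L" for J K L :: "'x set" using that by (rule order_trans)
  show "\<exists>L\<in>{K. compactin X K \<and> K \<subseteq> V}. J \<subseteq> L \<and> K \<subseteq> L"
    if "J \<in> {K. compactin X K \<and> K \<subseteq> V}" "K \<in> {K. compactin X K \<and> K \<subseteq> V}" for J K
    using that by (intro bexI[of _ "J \<union> K"]) (auto intro: compactin_Un)
qed simp

text \<open>By inner regularity the operators of the compact subsets increase to
  \<open>borel_op V\<close>, hence converge strongly.\<close>

lemma open_in_span_compact:
  assumes V: "openin X V"
  shows "regop_blinfun (borel_op V) \<in> sot_closed_span {borel_op K |K. compactin X K}"
proof (rule sot_closed_span_tendsto[OF net_filter_neq_bot[OF directed_compact]])
  show "\<forall>\<^sub>F K in net_filter {K. compactin X K \<and> K \<subseteq> V} (\<subseteq>).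
      regop_blinfun (borel_op K) \<in> sot_closed_span {borel_op K |K. compactin X K}"
    by (rule eventually_net_filterI[OF directed_compact]) (auto intro: sot_closed_span_superset)
  show "((\<lambda>K. regop_apply (borel_op K) x) \<longlongrightarrow> regop_apply (borel_op V) x)
      (net_filter {K. compactin X K \<and> K \<subseteq> V} (\<subseteq>))" for x
    by (rule increasing_regop_net_lub[OF directed_compact _ _ open_lub_compact[OF V]])
      (auto intro!: borel_op_mono borel_op_nonneg dest: compactin_subset_topspace)
qed

lemma borel_in_span_open:
  assumes A: "A \<in> sets (borel_of X)"
  shows "regop_blinfun (borel_op A) \<in> sot_closed_span {borel_op V |V. openin X V}"
proof -
  note dir = directed_open_nbhds[OF borel_of_subset[OF A]]
  show ?thesis
  proof (rule sot_closed_span_tendsto[OF net_filter_neq_bot[OF dir] _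
        borel_op_tendsto_open_op[OF borel_of_subset[OF A]]])
    show "\<forall>\<^sub>F V in net_filter {V. openin X V \<and> A \<subseteq> V} (\<lambda>V W. W \<subseteq> V).
        regop_blinfun (open_op V) \<in> sot_closed_span {borel_op V |V. openin X V}"
      by (rule eventually_net_filterI[OF dir], rule sot_closed_span_superset) (auto simp flip: borel_op_open)
  qed
qed

text \<open>The inclusions form one cycle \<open>W\<close>, \<open>?W2\<close>, \<open>?W4\<close>,
  \<open>?W7\<close>, \<open>?W5\<close>, \<open>W\<close> and a detour \<open>?W5\<close>,
  \<open>?W6\<close>, \<open>?W7\<close>, \<open>?W3\<close>, \<open>?W4\<close> between its
  members. Limits of monotone nets give \<open>?W7\<close> in \<open>?W5\<close>, \<open>?W5\<close>
  in \<open>W\<close> and \<open>?W5\<close> in \<open>?W6\<close>; limits of elementary operators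
  give \<open>?W4\<close> in \<open>?W7\<close>.\<close>

lemma sot_closed_spans:
  defines "W \<equiv> sot_closed_span (\<pi> ` Cc_functions X)"
  shows "sot_closed_span (\<pi> ` C0_functions X) = W"
    "sot_closed_span (rep.oint ` bounded_borel_functions X) = W"
    "sot_closed_span (rep.oint ` rep.L1) = W"
    "sot_closed_span {borel_op V |V. openin X V} = W"
    "sot_closed_span {borel_op K |K. compactin X K} = W"
    "sot_closed_span {borel_op A |A. A \<in> sets (borel_of X)} = W"
proof -
  let ?W2 = "sot_closed_span (\<pi> ` C0_functions X)"
  let ?W3 = "sot_closed_span (rep.oint ` bounded_borel_functions X)"
  let ?W4 = "sot_closed_span (rep.oint ` rep.L1)"
  let ?W5 = "sot_closed_span {borel_op V |V. openin X V}"
  let ?W6 = "sot_closed_span {borel_op K |K. compactin X K}"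
  let ?W7 = "sot_closed_span {borel_op A |A. A \<in> sets (borel_of X)}"
  have "W \<subseteq> ?W2" unfolding W_def using Cc_subset_C0 by (intro sot_closed_span_mono image_mono)
  moreover have "?W2 \<subseteq> ?W4"
  proof (rule sot_closed_span_mono, rule subsetI)
    fix T assume "T \<in> \<pi> ` C0_functions X"
    then obtain f where "f \<in> C0_functions X" "T = \<pi> f" by blast
    then show "T \<in> rep.oint ` rep.L1"
      using has_order_integral_C0[of f] by (force simp: has_order_integral_def)
  qed
  moreover have "?W4 \<subseteq> ?W7"
    using rep.oint_in_sot_closed_span by (intro sot_closed_span_subsetI) (auto simp: op_rep)
  moreover have "?W7 \<subseteq> ?W5" using borel_in_span_open by (intro sot_closed_span_subsetI) auto
  moreover have "?W5 \<subseteq> W" unfolding W_def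
    using open_op_in_span_pi by (intro sot_closed_span_subsetI) (auto simp: borel_op_open)
  moreover have "?W5 \<subseteq> ?W6" using open_in_span_compact by (intro sot_closed_span_subsetI) auto
  moreover have "?W6 \<subseteq> ?W7" by (intro sot_closed_span_mono) auto
  moreover have "?W7 \<subseteq> ?W3"
    by (intro sot_closed_span_mono) (auto simp flip: op_rep rep.oint_indicator(2) intro!: imageI rep.oint_indicator(1))
  moreover have "?W3 \<subseteq> ?W4" using rep.bounded_borel_subset_L1 by (intro sot_closed_span_mono image_mono)
  ultimately show "?W2 = W" "?W3 = W" "?W4 = W" "?W5 = W" "?W6 = W" "?W7 = W" by simp_all
qed

end

theorem theorem6p10:
  fixes X :: "'x topology"
    and \<pi> :: "('x \<Rightarrow> real) \<Rightarrow> ('e::kb_space, 'e) regop"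
  assumes "locally_compact_space X" and "Hausdorff_space X"
    and "positive_on_C0 X \<pi>"
  shows "\<exists>\<mu> :: 'x set \<Rightarrow> ('e, 'e) regop extd.
    \<comment> \<open>existence and uniqueness of the representing measure\<close>
    regular_borel_measure X \<mu> \<and>
    (\<forall>f\<in>Cc_functions X. has_order_integral (borel_of X) \<mu> f (\<pi> f)) \<and>
    (\<forall>\<nu> :: 'x set \<Rightarrow> ('e, 'e) regop extd.
       regular_borel_measure X \<nu> \<and>
       (\<forall>f\<in>Cc_functions X. has_order_integral (borel_of X) \<nu> f (\<pi> f)) \<longrightarrow>
       (\<forall>\<Delta>\<in>sets (borel_of X). \<nu> \<Delta> = \<mu> \<Delta>)) \<and>
    \<comment> \<open>properties of the measure\<close>
    is_finite (\<mu> (topspace X)) \<and>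
    (\<forall>f\<in>C0_functions X. has_order_integral (borel_of X) \<mu> f (\<pi> f)) \<and>
    (\<forall>V. openin X V \<and> V \<noteq> {} \<longrightarrow>
       (\<exists>T. \<mu> V = Fin T \<and> isLub UNIV {\<pi> f |f. subordinate X f V} T)) \<and>
    (\<forall>K. compactin X K \<longrightarrow>
       (\<exists>T. \<mu> K = Fin T \<and> isGlb UNIV {\<pi> f |f. dominates X K f} T)) \<and>
    (\<forall>A :: nat \<Rightarrow> 'x set. range A \<subseteq> sets (borel_of X) \<and> disjoint_family A \<longrightarrow>
       (\<forall>x. (\<lambda>n. regop_apply (finite_part (\<mu> (A n))) x) sums
              regop_apply (finite_part (\<mu> (\<Union>n. A n))) x)) \<and>
    \<comment> \<open>the associated scalar measures\<close>
    (\<forall>x\<ge>0. \<forall>x'\<ge>0. (\<forall>\<Delta>\<in>sets (borel_of X). 0 \<le> pairing \<mu> x x' \<Delta>) \<and>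
       regular_borel_measure X (\<lambda>\<Delta>. Fin (pairing \<mu> x x' \<Delta>))) \<and>
    (\<forall>f\<in>order_L1 (borel_of X) \<mu>.
       (\<forall>x\<ge>0. \<forall>x'\<ge>0. integrable (pairing_measure X \<mu> x x') f) \<and>
       (\<forall>T. (\<forall>x\<ge>0. \<forall>x'\<ge>0.
               regop_apply x' (regop_apply T x) = integral\<^sup>L (pairing_measure X \<mu> x x') f) \<longleftrightarrow>
            T = order_integral (borel_of X) \<mu> f)) \<and>
    \<comment> \<open>the generated SOT-closed linear subspaces\<close>
    bounded_borel_functions X \<subseteq> order_L1 (borel_of X) \<mu> \<and>
    (let W = sot_closed_span (\<pi> ` Cc_functions X) in
       sot_closed_span (\<pi> ` C0_functions X) = W \<and>
       sot_closed_span (order_integral (borel_of X) \<mu> ` bounded_borel_functions X) = W \<and>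
       sot_closed_span (order_integral (borel_of X) \<mu> ` order_L1 (borel_of X) \<mu>) = W \<and>
       sot_closed_span {finite_part (\<mu> V) |V. openin X V} = W \<and>
       sot_closed_span {finite_part (\<mu> K) |K. compactin X K} = W \<and>
       sot_closed_span {finite_part (\<mu> \<Delta>) |\<Delta>. \<Delta> \<in> sets (borel_of X)} = W)"
proof -
  interpret positive_C0_operator X \<pi>
    using assms by unfold_locales
  have fp [simp]: "finite_part (rep A) = borel_op A" for A by (simp add: rep_def)
  show ?thesis
  proof (rule exI[of _ rep], intro conjI)
    show "regular_borel_measure X rep" by (rule regular_rep)
    show "\<forall>f\<in>Cc_functions X. has_order_integral (borel_of X) rep f (\<pi> f)"
      using has_order_integral_C0 Cc_subset_C0 by blast
    show "\<forall>\<nu> :: 'x set \<Rightarrow> ('e, 'e) regop extd.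
       regular_borel_measure X \<nu> \<and>
       (\<forall>f\<in>Cc_functions X. has_order_integral (borel_of X) \<nu> f (\<pi> f)) \<longrightarrow>
       (\<forall>\<Delta>\<in>sets (borel_of X). \<nu> \<Delta> = rep \<Delta>)"
      by (intro allI impI ballI rep_unique) blast+
    show "is_finite (rep (topspace X))" by (simp add: rep_def is_finite_def)
    show "\<forall>f\<in>C0_functions X. has_order_integral (borel_of X) rep f (\<pi> f)"
      using has_order_integral_C0 by blast
    show "\<forall>V. openin X V \<and> V \<noteq> {} \<longrightarrow>
       (\<exists>T. rep V = Fin T \<and> isLub UNIV {\<pi> f |f. subordinate X f V} T)"
      using open_op_lub by (auto simp: rep_def borel_op_open image_Collect)
    show "\<forall>K. compactin X K \<longrightarrow>
       (\<exists>T. rep K = Fin T \<and> isGlb UNIV {\<pi> f |f. dominates X K f} T)"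
      using compact_glb by (auto simp: rep_def)
    show "\<forall>A :: nat \<Rightarrow> 'x set. range A \<subseteq> sets (borel_of X) \<and> disjoint_family A \<longrightarrow>
       (\<forall>x. (\<lambda>n. regop_apply (finite_part (rep (A n))) x) sums
              regop_apply (finite_part (rep (\<Union>n. A n))) x)"
      using borel_op_sums by simp
    show "\<forall>x\<ge>0. \<forall>x'\<ge>0. (\<forall>\<Delta>\<in>sets (borel_of X). 0 \<le> pairing rep x x' \<Delta>) \<and>
       regular_borel_measure X (\<lambda>\<Delta>. Fin (pairing rep x x' \<Delta>))"
      by (intro allI impI conjI ballI regular_pairing)
        (simp_all add: pairing_def borel_op_scalar_nonneg borel_of_subset)
    show "\<forall>f\<in>order_L1 (borel_of X) rep.
       (\<forall>x\<ge>0. \<forall>x'\<ge>0. integrable (pairing_measure X rep x x') f) \<and>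
       (\<forall>T. (\<forall>x\<ge>0. \<forall>x'\<ge>0.
               regop_apply x' (regop_apply T x) = integral\<^sup>L (pairing_measure X rep x x') f) \<longleftrightarrow>
            T = order_integral (borel_of X) rep f)"
      by (intro ballI conjI allI impI rep.L1_scalar(1) rep.int_eq_iff)
    show "bounded_borel_functions X \<subseteq> order_L1 (borel_of X) rep"
      by (rule rep.bounded_borel_subset_L1)
    show "let W = sot_closed_span (\<pi> ` Cc_functions X) in
       sot_closed_span (\<pi> ` C0_functions X) = W \<and>
       sot_closed_span (order_integral (borel_of X) rep ` bounded_borel_functions X) = W \<and>
       sot_closed_span (order_integral (borel_of X) rep ` order_L1 (borel_of X) rep) = W \<and>
       sot_closed_span {finite_part (rep V) |V. openin X V} = W \<and>
       sot_closed_span {finite_part (rep K) |K. compactin X K} = W \<and>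
       sot_closed_span {finite_part (rep \<Delta>) |\<Delta>. \<Delta> \<in> sets (borel_of X)} = W"
      using sot_closed_spans by (simp add: Let_def)
  qed
qed

end
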